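(* Let $\Omega\subset\mathbb{R}^3$ be a bounded Lipschitz domain. Let $w:\Omega\to\mathbb{R}^3$ be a piecewise affine Lipschitz map such that $$\operatorname{tr}\nabla w=0\ \text{ a.e. in }\Omega,\qquad \operatorname*{ess\,inf}_{\Omega}\mu_1(e(w))>-\frac12,\qquad \operatorname*{ess\,sup}_{\Omega}\mu_3(e(w))<1.\qquad( * )$$ Then for every $\varepsilon>0$ there exists a Lipschitz map $u_\varepsilon:\Omega\to\mathbb{R}^3$ such that $$V(e(u_\varepsilon))=0\ \text{ a.e. in }\Omega,\qquad u_\varepsilon=w\ \text{ on }\partial\Omega,$$ and $\|u_\varepsilon-w\|_\infty\leq\varepsilon$. The same result holds if, instead of being piecewise affine and Lipschitz, $w\in C^{1,\alpha}(\overline{\Omega};\mathbb{R}^3)$ for some $0<\alpha<1$ and $w$ satisfies $( * )$.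
   Context: For $u:\Omega\to\mathbb{R}^3$, $e(u):=\frac12(\nabla u+(\nabla u)^T)$. For a symmetric matrix $E\in\mathbb{R}^{3\times3}$, $\mu_1(E)\leq\mu_2(E)\leq\mu_3(E)$ are its ordered eigenvalues. For every symmetric $E\in\mathbb{R}^{3\times3}$ with $\operatorname{tr}E=0$, $$V(E):=\min_{n\in S^2}|E-U_n|^2,\qquad U_n:=\frac12(3\,n\otimes n-I),$$ where $|\cdot|$ is the Euclidean (Frobenius) norm. The condition $V(e(u))=0$ a.e. includes the requirement $\operatorname{div}u=0$ a.e. A map $y:\Omega\to\mathbb{R}^m$ is called piecewise affine if it is continuous and there exist countably many mutually disjoint Lipschitz domains $\Omega_i\subseteq\Omega$ such that $y|_{\Omega_i}$ is affine for every $i$ and $|\Omega\setminus\bigcup_i\Omega_i|=0$ (Lebesgue measure). Lipschitz maps are identified with their continuous extensions to the closure; $\|\cdot\|_\infty$ is the $L^\infty$ norm. *)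

theory Defs
  imports "HOL-Analysis.Analysis" "HOL-Computational_Algebra.Fundamental_Theorem_Algebra"
    "HOL-Probability.Essential_Supremum"
begin

section \<open>Domains and maps\<close>

text \<open>
  Locally, the domain is the strict epigraph of a Lipschitz function. The direction \<open>e\<close> plays the
  role of the last coordinate axis, and \<open>y - (y \<bullet> e) *\<^sub>R e\<close>, the projection of \<open>y\<close> to
  the hyperplane orthogonal to \<open>e\<close>, that of the remaining coordinates.
\<close>

definition lipschitz_domain :: "'a::euclidean_space set \<Rightarrow> bool" where
  "lipschitz_domain \<Omega> \<longleftrightarrow> open \<Omega> \<and> connected \<Omega> \<and> \<Omega> \<noteq> {} \<and>
     (\<forall>x\<in>frontier \<Omega>. \<exists>r>0. \<exists>e \<gamma> L. norm e = 1 \<and> L-lipschitz_on {z. z \<bullet> e = 0} \<gamma> \<and>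
        \<Omega> \<inter> ball x r = {y \<in> ball x r. \<gamma> (y - (y \<bullet> e) *\<^sub>R e) < y \<bullet> e})"

definition affine_on :: "'a::real_vector set \<Rightarrow> ('a \<Rightarrow> 'b::real_vector) \<Rightarrow> bool" where
  "affine_on A f \<longleftrightarrow> (\<exists>h b. linear h \<and> (\<forall>x\<in>A. f x = h x + b))"

definition piecewise_affine ::
    "'a::euclidean_space set \<Rightarrow> ('a \<Rightarrow> 'b::euclidean_space) \<Rightarrow> bool" where
  "piecewise_affine \<Omega> f \<longleftrightarrow> continuous_on \<Omega> f \<and>
     (\<exists>\<D>. countable \<D> \<and> pairwise disjnt \<D> \<and>
        (\<forall>D\<in>\<D>. lipschitz_domain D \<and> D \<subseteq> \<Omega> \<and> affine_on D f) \<and>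
        negligible (\<Omega> - \<Union>\<D>))"

text \<open>
  A Lipschitz map on \<open>\<Omega>\<close> is identified with its continuous extension to \<open>closure \<Omega>\<close>, which is
  Lipschitz with the same constant.
\<close>

definition lipschitz_map ::
    "'a::euclidean_space set \<Rightarrow> ('a \<Rightarrow> 'b::euclidean_space) \<Rightarrow> bool" where
  "lipschitz_map \<Omega> f \<longleftrightarrow> (\<exists>L. L-lipschitz_on (closure \<Omega>) f)"

text \<open>
  \<open>G\<close> is the gradient of \<open>f\<close> in \<open>\<Omega>\<close> together with its extension to \<open>closure \<Omega>\<close>.
  For bounded \<open>\<Omega>\<close> this is the space of \<open>C\<^sup>1\<close> functions up to the boundary with Hoelder continuous
  gradient of exponent \<open>\<alpha>\<close>.
\<close>

definition C1_Hoelder ::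
    "real \<Rightarrow> (real^'n) set \<Rightarrow> (real^'n \<Rightarrow> real^'m) \<Rightarrow> bool" where
  "C1_Hoelder \<alpha> \<Omega> f \<longleftrightarrow> continuous_on (closure \<Omega>) f \<and>
     (\<exists>G. (\<forall>x\<in>\<Omega>. (f has_derivative (\<lambda>h. G x *v h)) (at x)) \<and>
        continuous_on (closure \<Omega>) G \<and>
        (\<exists>C. \<forall>x\<in>closure \<Omega>. \<forall>y\<in>closure \<Omega>. norm (G x - G y) \<le> C * dist x y powr \<alpha>))"

definition essinf :: "'a measure \<Rightarrow> ('a \<Rightarrow> ereal) \<Rightarrow> ereal" where
  "essinf M f = - esssup M (\<lambda>x. - f x)"

definition Linf_norm :: "'a::euclidean_space set \<Rightarrow> ('a \<Rightarrow> 'b::real_normed_vector) \<Rightarrow> ereal" where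
  "Linf_norm \<Omega> f = esssup (lebesgue_on \<Omega>) (\<lambda>x. ereal (norm (f x)))"


section \<open>Strain\<close>

text \<open>
  The gradient of a Lipschitz map is its classical derivative, which exists almost everywhere
  (Rademacher) and agrees almost everywhere with the weak gradient.
\<close>

definition strain :: "(real^'n \<Rightarrow> real^'n) \<Rightarrow> real^'n \<Rightarrow> real^'n^'n" where
  "strain u x = (1/2) *\<^sub>R (jacobian u (at x) + transpose (jacobian u (at x)))"


section \<open>Ordered eigenvalues\<close>

definition char_poly :: "real^'n^'n \<Rightarrow> real poly" where
  "char_poly E = det (\<chi> i j. (if i = j then [:0, 1:] else 0) - [:E $ i $ j:])"

text \<open>
  Eigenvalues are counted with multiplicity and indexed from 1. The sorted list has length 3 for
  symmetric \<open>E\<close>, see \<open>length_eigenvalues\<close> below.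
\<close>

definition mu :: "nat \<Rightarrow> real^3^3 \<Rightarrow> real" where
  "mu k E = sorted_list_of_multiset (proots (char_poly E)) ! (k - 1)"

lemma poly_char_poly:
  "poly (char_poly E) x = det (mat x - E)" for E :: "real^3^3"
  by (simp add: char_poly_def det_3 mat_def algebra_simps)

lemma char_poly_eq:
  "char_poly E = [:- det E,
     E$1$1*E$2$2 + E$1$1*E$3$3 + E$2$2*E$3$3 - E$1$2*E$2$1 - E$1$3*E$3$1 - E$2$3*E$3$2,
     - trace E, 1:]" (is "_ = ?p") for E :: "real^3^3"
proof -
  have "poly (char_poly E) x = poly ?p x" for x
    unfolding poly_char_poly by (simp add: det_3 mat_def trace_def sum_3 algebra_simps)
  then show ?thesis by (simp add: poly_eq_poly_eq_iff[symmetric] fun_eq_iff)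
qed

lemma char_poly_nz: "char_poly E \<noteq> 0" for E :: "real^3^3"
  by (simp add: char_poly_eq)

lemma degree_char_poly: "degree (char_poly E) = 3" for E :: "real^3^3"
  by (simp add: char_poly_eq)

lemma det_eq_0_kernel:
  fixes A :: "'a::field^'n^'n"
  assumes "det A = 0"
  obtains v where "v \<noteq> 0" "A *v v = 0"
  using assms by (metis invertible_det_nz invertible_left_inverse matrix_left_invertible_ker)

lemma eigenvalue_iff:
  fixes E :: "real^3^3"
  shows "x \<in># proots (char_poly E) \<longleftrightarrow> (\<exists>v. v \<noteq> 0 \<and> E *v v = x *\<^sub>R v)"
proof -
  have m: "(mat x - E) *v v = x *\<^sub>R v - E *v v" for v
    by (simp add: vec_eq_iff forall_3 matrix_vector_mult_def mat_def sum_3 algebra_simps)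
  have "x \<in># proots (char_poly E) \<longleftrightarrow> det (mat x - E) = 0"
    using char_poly_nz by (simp add: poly_char_poly)
  also have "\<dots> \<longleftrightarrow> (\<exists>v. v \<noteq> 0 \<and> (mat x - E) *v v = 0)"
    by (metis invertible_det_nz invertible_left_inverse matrix_left_invertible_ker)
  finally show ?thesis by (auto simp: m)
qed

lemma size_proots_real:
  fixes p :: "real poly"
  assumes "p \<noteq> 0" "\<And>z. poly (map_poly complex_of_real p) z = 0 \<Longrightarrow> z \<in> \<real>"
  shows "size (proots p) = degree p"
  using assms
proof (induction "degree p" arbitrary: p)
  case 0
  then show ?case by (metis degree_0_id proots_const size_empty)
next
  case (Suc n)
  have "degree (map_poly complex_of_real p) = Suc n"
    using Suc.hyps(2) by (simp add: degree_map_poly)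
  then obtain z where z: "poly (map_poly complex_of_real p) z = 0"
    by (metis constant_degree fundamental_theorem_of_algebra nat.distinct(1))
  then obtain r where r: "z = of_real r"
    using Suc.prems(2) Reals_cases by blast
  have mp: "poly (map_poly complex_of_real q) (of_real y) = of_real (poly q y)" for q y
    by (induction q) (simp_all add: map_poly_pCons)
  have "poly p r = 0" using z mp[of p r] r by simp
  then obtain q where q: "p = [:-r, 1:] * q" using poly_eq_0_iff_dvd dvdE by blast
  have "q \<noteq> 0" using Suc.prems(1) q by auto
  then have dq: "degree q = n"
    using Suc.hyps(2) unfolding q by (subst (asm) degree_mult_eq) auto
  have "poly (map_poly complex_of_real p) y = (y - of_real r) * poly (map_poly of_real q) y" for y
  proof -
    have "[:-r, 1:] * q = pCons 0 q - smult r q" by simp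
    moreover have "map_poly complex_of_real (a - b) = map_poly of_real a - map_poly of_real b" for a b
      by (intro poly_eqI) (simp add: coeff_map_poly)
    ultimately show ?thesis
      unfolding q by (simp add: map_poly_smult map_poly_pCons left_diff_distrib)
  qed
  then have "\<And>z. poly (map_poly complex_of_real q) z = 0 \<Longrightarrow> z \<in> \<real>"
    using Suc.prems(2) by simp
  then have "size (proots q) = n" using Suc.hyps(1) dq \<open>q \<noteq> 0\<close> by metis
  then show ?case using q \<open>q \<noteq> 0\<close> Suc.hyps(2) by (simp add: proots_mult del: mult_pCons_left)
qed

lemma length_eigenvalues:
  fixes E :: "real^3^3"
  assumes "transpose E = E"
  shows "length (sorted_list_of_multiset (proots (char_poly E))) = 3"
proof -
  have sym: "E$2$1 = E$1$2" "E$3$1 = E$1$3" "E$3$2 = E$2$3"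
    using assms by (auto simp: transpose_def vec_eq_iff)
  have real: "z \<in> \<real>" if z: "poly (map_poly complex_of_real (char_poly E)) z = 0" for z
  proof -
    define F :: "complex^3^3" where "F = (\<chi> i j. of_real (E$i$j))"
    have "det (mat z - F) = poly (map_poly complex_of_real (char_poly E)) z"
      by (simp add: char_poly_eq det_3 mat_def F_def trace_def sum_3 map_poly_pCons algebra_simps)
    then obtain v where v: "v \<noteq> 0" "(mat z - F) *v v = 0"
      using det_eq_0_kernel[of "mat z - F"] z by auto
    have "(mat z - F) *v v = (\<chi> i. z * v$i - (\<Sum>j\<in>UNIV. of_real (E$i$j) * v$j))"
      by (simp add: vec_eq_iff forall_3 matrix_vector_mult_def mat_def F_def sum_3 algebra_simps)
    with v(2) have ev: "z * v$i = (\<Sum>j\<in>UNIV. of_real (E$i$j) * v$j)" for i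
      by (simp add: vec_eq_iff)
    define N where "N = (\<Sum>i\<in>UNIV. cmod (v$i) ^ 2)"
    have "N > 0"
    proof -
      from v(1) obtain i where "v$i \<noteq> 0" by (auto simp: vec_eq_iff)
      then show ?thesis unfolding N_def by (intro sum_pos2[of _ i]) auto
    qed
    have "z * of_real N = (\<Sum>i\<in>UNIV. cnj (v$i) * (z * v$i))"
      by (simp add: N_def sum_distrib_left mult_ac complex_norm_square del: of_real_power)
    also have "\<dots> = (\<Sum>i\<in>UNIV. \<Sum>j\<in>UNIV. of_real (E$i$j) * (cnj (v$i) * v$j))"
      by (simp add: ev sum_distrib_left mult_ac)
    finally have *: "z * of_real N = \<dots>" .
    have "cnj (z * of_real N) = z * of_real N"
      unfolding * by (simp add: sum_3 sym algebra_simps)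
    then have "cnj z = z" using \<open>N > 0\<close> by simp
    then show ?thesis by (simp add: Reals_cnj_iff)
  qed
  have "size (proots (char_poly E)) = 3"
    using size_proots_real[OF char_poly_nz real] by (simp add: degree_char_poly)
  then show ?thesis by (simp flip: size_mset)
qed


section \<open>The energy density\<close>

definition U_mat :: "real^3 \<Rightarrow> real^3^3" where
  "U_mat n = (1/2) *\<^sub>R (3 *\<^sub>R (\<chi> i j. n $ i * n $ j) - mat 1)"

text \<open>The infimum is a minimum, see \<open>V_energy_attained\<close> below. The norm is the Frobenius norm.\<close>

definition V_energy :: "real^3^3 \<Rightarrow> real" where
  "V_energy E = (INF n\<in>sphere 0 1. (norm (E - U_mat n))\<^sup>2)"

lemma V_energy_attained: "\<exists>n\<in>sphere 0 1. V_energy E = (norm (E - U_mat n))\<^sup>2 \<and>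
    (\<forall>m\<in>sphere 0 1. (norm (E - U_mat n))\<^sup>2 \<le> (norm (E - U_mat m))\<^sup>2)"
proof -
  have "continuous_on (sphere 0 1) (\<lambda>n. (norm (E - U_mat n))\<^sup>2)"
    unfolding U_mat_def
    by (intro continuous_intros continuous_on_vec_lambda continuous_on_component)
  moreover have "sphere (0::real^3) 1 \<noteq> {}" by simp
  ultimately obtain n where n: "n \<in> sphere 0 1"
      "\<And>m. m \<in> sphere 0 1 \<Longrightarrow> (norm (E - U_mat n))\<^sup>2 \<le> (norm (E - U_mat m))\<^sup>2"
    using continuous_attains_inf[OF compact_sphere, of 0 1 "\<lambda>n. (norm (E - U_mat n))\<^sup>2"] by blast
  then have "V_energy E = (norm (E - U_mat n))\<^sup>2"
    unfolding V_energy_def by (intro cInf_eq_minimum) auto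
  with n show ?thesis by blast
qed

text \<open>
  The requirement that the energy vanishes almost everywhere includes that the divergence does.
\<close>

definition zero_energy :: "(real^3) set \<Rightarrow> (real^3 \<Rightarrow> real^3) \<Rightarrow> bool" where
  "zero_energy \<Omega> u \<longleftrightarrow> (AE x in lebesgue_on \<Omega>.
     u differentiable (at x) \<and> trace (jacobian u (at x)) = 0 \<and> V_energy (strain u x) = 0)"

end

theory Submission
  imports Defs
begin

text \<open>
  The proof is a convex integration in which every object is classical: all maps are Lipschitz, and
  gradients are pointwise derivatives on open sets of full measure.

  For a trace free matrix \<open>F\<close> put \<open>P = sym F + I/2\<close>, a symmetric matrix of trace \<open>3/2\<close>. The energy of
  \<open>sym F\<close> vanishes iff \<open>P\<close> is positive semidefinite of rank one, and the hypothesis on \<open>w\<close> says that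
  \<open>P\<close> is positive definite.
  If \<open>P\<close> has eigenvalues \<open>p \<ge> q \<ge> r > 0\<close>, the excess \<open>3/2 - |sym F|\<^sup>2 = 2(pq + qr + pr)\<close> measures
  the distance to rank one. With \<open>a\<close>, \<open>b\<close> the eigenvectors of \<open>p\<close>, \<open>q\<close> and \<open>\<tau> = sqrt (2pq)\<close>, both
  matrices \<open>F + \<tau> a \<otimes> b\<close> and \<open>F - \<tau> a \<otimes> b\<close> are again trace free and positive definite, and their
  excess is smaller by \<open>pq\<close>, which is at least a sixth of the excess of \<open>F\<close> (\<open>admissible_split\<close>). As
  \<open>\<tau>\<close> is at most the square root of the excess, iterating this splitting makes the excess decay
  geometrically with steps of summable size, in the full gradient and not only in its symmetric part.
  Hence the skew parts of the gradients, which the energy does not see, stay bounded as well.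

  A splitting is realized by a map without any transition layer: on a thin lens orthogonal to \<open>b\<close> there
  is a divergence free Lipschitz field which vanishes on the boundary and whose gradient is almost
  everywhere close to one of \<open>\<tau> a \<otimes> b\<close> and \<open>- \<tau> a \<otimes> b\<close> (\<open>oscillating_block\<close>). Open sets are filled up
  to null sets by small copies of a lens (\<open>fill_by_copies\<close>), and since the gradients are continuous on an
  open set of full measure, each point has a neighbourhood in which one block works. Gluing the copies
  gives a correction of small sup norm, with Lipschitz constant proportional to \<open>\<tau>\<close>, after which all gradients satisfy
  the improved estimate (\<open>perturbation_step\<close>).

  The corrections and their Lipschitz constants are summable, so their sum is Lipschitz and may be
  differentiated term by term at almost every point (\<open>has_derivative_lipschitz_series\<close>). The limit
  gradient is trace free with \<open>P\<close> positive semidefinite and zero excess, hence of zero energy.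

  Both classes of boundary data are continuously differentiable on an open set of full measure, and the
  iteration starts from there. That \<open>C\<^sup>1\<close> data are Lipschitz up to the boundary uses the geometry of the
  domain (\<open>C1_lipschitz_domain_lipschitz\<close>).
\<close>

section \<open>Dyadic products and symmetric matrices\<close>

definition outer :: "real^'n \<Rightarrow> real^'n \<Rightarrow> real^'n^'n" where
  "outer a b = (\<chi> i j. a $ i * b $ j)"

lemma outer_mult_vec: "outer a b *v h = (b \<bullet> h) *\<^sub>R a"
  by (simp add: vec_eq_iff outer_def matrix_vector_mult_def inner_vec_def sum_distrib_left mult_ac)

lemma inner_outer: "outer a b \<bullet> outer c d = (a \<bullet> c) * (b \<bullet> d)"
  by (simp add: outer_def inner_vec_def sum_product mult_ac)

lemma norm_outer: "norm (outer a b) = norm a * norm b"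
  by (simp add: norm_eq_sqrt_inner inner_outer real_sqrt_mult)

lemma trace_outer: "trace (outer a b) = a \<bullet> b"
  by (simp add: trace_def outer_def inner_vec_def)

lemma transpose_outer: "transpose (outer a b) = outer b a"
  by (simp add: vec_eq_iff transpose_def outer_def mult.commute)

lemma bounded_bilinear_outer: "bounded_bilinear outer"
proof
  show "\<exists>K. \<forall>a b. norm (outer a b) \<le> norm a * norm b * K"
    by (rule exI[of _ 1]) (simp add: norm_outer)
qed (simp_all add: outer_def vec_eq_iff algebra_simps)

lemmas outer_simps =
  bounded_bilinear.add_left[OF bounded_bilinear_outer]
  bounded_bilinear.add_right[OF bounded_bilinear_outer]
  bounded_bilinear.diff_left[OF bounded_bilinear_outer]
  bounded_bilinear.diff_right[OF bounded_bilinear_outer]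
  bounded_bilinear.scaleR_left[OF bounded_bilinear_outer]
  bounded_bilinear.scaleR_right[OF bounded_bilinear_outer]
  bounded_bilinear.minus_left[OF bounded_bilinear_outer]
  bounded_bilinear.minus_right[OF bounded_bilinear_outer]

lemma trace_scaleR: "trace (c *\<^sub>R A) = c * trace A" for A :: "real^'n^'n"
  by (simp add: trace_def sum_distrib_left)

lemma trace_transpose: "trace (transpose A) = trace A" for A :: "real^'n^'n"
  by (simp add: trace_def transpose_def)

lemma transpose_add: "transpose (A + B) = transpose A + transpose B" for A B :: "real^'n^'n"
  by (simp add: transpose_def vec_eq_iff)

lemma transpose_scale: "transpose (c *\<^sub>R A) = c *\<^sub>R transpose A" for A :: "real^'n^'n"
  by (simp add: transpose_def vec_eq_iff)

lemma symmetric_inner: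
  fixes E :: "real^'n^'n"
  assumes "transpose E = E"
  shows "x \<bullet> (E *v y) = y \<bullet> (E *v x)"
  by (metis assms dot_lmul_matrix inner_commute transpose_matrix_vector)

text \<open>
  On the unit sphere of the subspace the quadratic form has a maximizer \<open>a\<close>, with value \<open>p\<close>. Along
  the line through \<open>a\<close> in the direction of the residual \<open>p a - E a\<close>, the first order condition forces
  the residual to vanish.
\<close>

lemma max_eigenvector:
  fixes E :: "real^'n^'n"
  assumes E: "transpose E = E" and S: "subspace S" "S \<noteq> {0}"
    and inv: "\<And>x. x \<in> S \<Longrightarrow> E *v x \<in> S"
  obtains a p where "a \<in> S" "norm a = 1" "E *v a = p *\<^sub>R a"
    "\<And>x. x \<in> S \<Longrightarrow> x \<bullet> (E *v x) \<le> p * (x \<bullet> x)"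
proof -
  obtain s where s: "s \<in> S" "s \<noteq> 0" using S subspace_0 by blast
  have cpt: "compact (sphere 0 1 \<inter> S)"
    using S(1) by (intro compact_Int_closed compact_sphere closed_subspace)
  have ne: "sphere 0 1 \<inter> S \<noteq> {}"
  proof -
    have "(1 / norm s) *\<^sub>R s \<in> sphere 0 1 \<inter> S" using s S(1) by (simp add: subspace_scale)
    then show ?thesis by blast
  qed
  have "continuous_on (sphere 0 1 \<inter> S) (\<lambda>x. x \<bullet> (E *v x))"
    by (intro continuous_intros)
  from continuous_attains_sup[OF cpt ne this] obtain a where a: "a \<in> S" "norm a = 1"
    and amax: "\<And>x. \<lbrakk>x \<in> S; norm x = 1\<rbrakk> \<Longrightarrow> x \<bullet> (E *v x) \<le> a \<bullet> (E *v a)" by auto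
  define p where "p = a \<bullet> (E *v a)"
  have bound: "x \<bullet> (E *v x) \<le> p * (x \<bullet> x)" if "x \<in> S" for x
  proof (cases "x = 0")
    case False
    define y where "y = (1 / norm x) *\<^sub>R x"
    have "y \<in> S" "norm y = 1" using False that S(1) by (auto simp: y_def subspace_scale)
    then have "y \<bullet> (E *v y) \<le> p" using amax p_def by blast
    moreover have "y \<bullet> (E *v y) = (x \<bullet> (E *v x)) / (x \<bullet> x)"
      by (simp add: y_def matrix_vector_mult_scaleR dot_square_norm power2_eq_square)
    ultimately show ?thesis using False by (simp add: field_simps)
  qed simp
  define z where "z = p *\<^sub>R a - E *v a"
  have zS: "z \<in> S" using a inv S(1) by (simp add: z_def subspace_diff subspace_scale)
  define g where "g = p * (z \<bullet> z) - z \<bullet> (E *v z)"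
  have g0: "0 \<le> g" using bound[OF zS] by (simp add: g_def)
  \<comment> \<open>maximality, tested at the point \<open>a - t z\<close>\<close>
  have quad: "2 * t * (z \<bullet> z) \<le> t\<^sup>2 * g" for t
  proof -
    have "a - t *\<^sub>R z \<in> S" using a zS S(1) by (simp add: subspace_diff subspace_scale)
    from bound[OF this] have "0 \<le> p * ((a - t *\<^sub>R z) \<bullet> (a - t *\<^sub>R z)) - (a - t *\<^sub>R z) \<bullet> (E *v (a - t *\<^sub>R z))"
      by simp
    also have "\<dots> = (p * (a \<bullet> a) - p) - 2 * t * (z \<bullet> z) + t\<^sup>2 * g"
    proof -
      have "z \<bullet> (E *v a) = p * (z \<bullet> a) - z \<bullet> z" by (simp add: z_def inner_diff_right inner_diff_left)
      moreover have "a \<bullet> (E *v z) = z \<bullet> (E *v a)" by (rule symmetric_inner[OF E])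
      moreover have "a \<bullet> (E *v a) = p" by (simp add: p_def)
      ultimately show ?thesis
        by (simp add: g_def inner_diff_left inner_diff_right matrix_vector_mult_diff_distrib
            matrix_vector_mult_scaleR inner_commute[of a z] power2_eq_square)
           (simp add: algebra_simps)
    qed
    finally show ?thesis using a by (simp add: dot_square_norm)
  qed
  have "z \<bullet> z \<le> 0"
  proof (rule ccontr)
    assume "\<not> z \<bullet> z \<le> 0"
    then have zz: "z \<bullet> z > 0" by linarith
    \<comment> \<open>a step so small that the linear term dominates the quadratic one\<close>
    define t where "t = (z \<bullet> z) / (g + 1)"
    have t: "t > 0" "t * (g + 1) = z \<bullet> z" using zz g0 by (auto simp: t_def)
    have "t * (2 * (z \<bullet> z)) \<le> t * (t * g)" using quad[of t] by (simp add: power2_eq_square mult_ac)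
    then have "2 * (z \<bullet> z) \<le> t * g" using t by (simp only: mult_le_cancel_left_pos)
    also have "\<dots> \<le> z \<bullet> z" using t by (simp add: algebra_simps)
    finally show False using zz by simp
  qed
  then have "z \<bullet> z = 0" using inner_ge_zero[of z] by linarith
  then have "z = 0" by simp
  then have "E *v a = p *\<^sub>R a" by (simp add: z_def)
  from that[OF a this bound] show ?thesis .
qed

lemma orthonormal_triple_expand:
  fixes a b c x :: "real^3"
  assumes "norm a = 1" "norm b = 1" "norm c = 1" "a \<bullet> b = 0" "a \<bullet> c = 0" "b \<bullet> c = 0"
  shows "x = (a \<bullet> x) *\<^sub>R a + (b \<bullet> x) *\<^sub>R b + (c \<bullet> x) *\<^sub>R c"
proof -
  let ?B = "{a, b, c}"
  have ne: "a \<noteq> b" "a \<noteq> c" "b \<noteq> c" using assms by (auto simp: dot_square_norm)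
  have po: "pairwise orthogonal ?B"
    using assms by (auto simp: pairwise_def orthogonal_def inner_commute)
  have ind: "independent ?B"
    using po assms by (intro pairwise_orthogonal_independent) auto
  have "x \<in> span ?B"
    using card_ge_dim_independent[of ?B UNIV] ind ne by auto
  then have "(\<Sum>i\<in>?B. (x \<bullet> i) *\<^sub>R i) = x"
    using assms po by (intro orthonormal_basis_expand) auto
  then show ?thesis using ne by (simp add: inner_commute add.assoc)
qed

text \<open>
  Symmetric maps preserve orthogonal complements of eigenvectors, so the maximization is applied on the
  whole space and then on the complement of the first eigenvector. This also orders the eigenvalues.
\<close>

lemma symmetric_diagonalization_3:
  fixes E :: "real^3^3"
  assumes E: "transpose E = E"
  obtains a b c p q r where "norm a = 1" "norm b = 1" "norm c = 1" "a \<bullet> b = 0" "a \<bullet> c = 0" "b \<bullet> c = 0"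
    "p \<ge> q" "q \<ge> r" "E = p *\<^sub>R outer a a + q *\<^sub>R outer b b + r *\<^sub>R outer c c"
proof -
  have "(axis 1 1 :: real^3) \<noteq> 0" by simp
  then have "UNIV \<noteq> {0::real^3}" by (metis UNIV_I singletonD)
  from max_eigenvector[OF E subspace_UNIV this] obtain a p where a: "norm a = 1" "E *v a = p *\<^sub>R a"
    and pm: "\<And>x. x \<bullet> (E *v x) \<le> p * (x \<bullet> x)" by auto
  let ?S = "{x. a \<bullet> x = 0}"
  obtain b0 where "b0 \<noteq> 0" "orthogonal a b0"
    using orthogonal_to_vector_exists[of a] by auto
  then have "?S \<noteq> {0}" by (auto simp: orthogonal_def)
  moreover have "E *v x \<in> ?S" if "x \<in> ?S" for x
    using that symmetric_inner[OF E, of a x] a by (simp add: inner_commute)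
  ultimately obtain b q where "b \<in> ?S" and b': "norm b = 1" "E *v b = q *\<^sub>R b"
    and "\<And>x. x \<in> ?S \<Longrightarrow> x \<bullet> (E *v x) \<le> q * (x \<bullet> x)"
    using max_eigenvector[OF E subspace_hyperplane] by metis
  then have b: "a \<bullet> b = 0" "norm b = 1" "E *v b = q *\<^sub>R b"
    and qm: "\<And>x. a \<bullet> x = 0 \<Longrightarrow> x \<bullet> (E *v x) \<le> q * (x \<bullet> x)" by auto
  have "dim {a, b} < DIM(real^3)"
  proof -
    have "card {a, b} \<le> 2" by (cases "a = b") auto
    moreover have "dim {a, b} \<le> card {a, b}" by (rule dim_le_card') simp
    ultimately show ?thesis by simp
  qed
  then obtain c0 where c0: "c0 \<noteq> 0" "\<And>y. y \<in> span {a,b} \<Longrightarrow> orthogonal c0 y"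
    by (rule orthogonal_to_subspace_exists) (rule that)
  have c0_orth: "orthogonal c0 a" "orthogonal c0 b" by (simp_all add: c0(2) span_base)
  define c where "c = (1 / norm c0) *\<^sub>R c0"
  have c: "norm c = 1" "a \<bullet> c = 0" "b \<bullet> c = 0"
    using c0(1) c0_orth by (simp_all add: c_def orthogonal_def inner_commute)
  define r where "r = c \<bullet> (E *v c)"
  have ex: "x = (a \<bullet> x) *\<^sub>R a + (b \<bullet> x) *\<^sub>R b + (c \<bullet> x) *\<^sub>R c" for x
    using orthonormal_triple_expand a b c by blast
  have "a \<bullet> (E *v c) = 0" "b \<bullet> (E *v c) = 0"
    using symmetric_inner[OF E, of a c] symmetric_inner[OF E, of b c] a b c by (simp_all add: inner_commute)
  then have Ec: "E *v c = r *\<^sub>R c" using ex[of "E *v c"] by (simp add: r_def)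
  have "E *v x = (p *\<^sub>R outer a a + q *\<^sub>R outer b b + r *\<^sub>R outer c c) *v x" for x
  proof -
    have "E *v x = E *v ((a \<bullet> x) *\<^sub>R a + (b \<bullet> x) *\<^sub>R b + (c \<bullet> x) *\<^sub>R c)" using ex[of x] by simp
    also have "\<dots> = (p *\<^sub>R outer a a + q *\<^sub>R outer b b + r *\<^sub>R outer c c) *v x"
      by (simp add: matrix_vector_right_distrib matrix_vector_mult_scaleR a b Ec
          matrix_vector_mult_add_rdistrib outer_mult_vec mult.commute flip: scaleR_matrix_vector_assoc)
    finally show ?thesis .
  qed
  then have "E = p *\<^sub>R outer a a + q *\<^sub>R outer b b + r *\<^sub>R outer c c" by (simp add: matrix_eq)
  moreover have "q \<le> p" using pm[of b] b by (simp add: dot_square_norm)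
  moreover have "r \<le> q" using qm[of c] c Ec by (simp add: dot_square_norm)
  ultimately show ?thesis using that a b c by metis
qed

section \<open>Splitting of admissible gradients\<close>

definition sym_part :: "real^'n^'n \<Rightarrow> real^'n^'n" where
  "sym_part F = (1/2) *\<^sub>R (F + transpose F)"

lemma bounded_linear_sym_part: "bounded_linear sym_part"
  unfolding linear_conv_bounded_linear[symmetric]
  by (rule linearI) (simp_all add: sym_part_def transpose_add transpose_scale scaleR_add_right)

lemma sym_part_add: "sym_part (A + B) = sym_part A + sym_part B"
  by (rule linear_add[OF bounded_linear.linear[OF bounded_linear_sym_part]])

lemma sym_part_scale: "sym_part (c *\<^sub>R A) = c *\<^sub>R sym_part A"
  by (rule linear_scale[OF bounded_linear.linear[OF bounded_linear_sym_part]])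

lemma transpose_sym_part: "transpose (sym_part F) = sym_part F"
  by (simp add: sym_part_def transpose_scale transpose_add add.commute)

lemma trace_sym_part: "trace (sym_part F) = trace F"
  by (simp add: sym_part_def trace_scaleR trace_add trace_transpose)

lemma quadratic_sym_part: "x \<bullet> (sym_part F *v x) = x \<bullet> (F *v x)"
proof -
  have "x \<bullet> (transpose F *v x) = x \<bullet> (F *v x)"
    using dot_lmul_matrix[of x F x] by (simp add: inner_commute)
  then show ?thesis
    by (simp add: sym_part_def matrix_vector_mult_add_rdistrib inner_add_right flip: scaleR_matrix_vector_assoc)
qed

lemma norm_add_scaleR_sq:
  fixes x y :: "'a::real_inner"
  shows "(norm (x + c *\<^sub>R y))\<^sup>2 = (norm x)\<^sup>2 + 2 * c * (x \<bullet> y) + c\<^sup>2 * (y \<bullet> y)"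
  unfolding power2_norm_eq_inner
  by (simp add: inner_add_left inner_add_right inner_commute[of y x] power2_eq_square[of c] algebra_simps)

text \<open>
  The middle condition says that \<open>sym F + I/2\<close> is positive definite. The bounded quantity is the excess:
  for trace free \<open>F\<close> it is twice the second elementary symmetric function of the eigenvalues of
  \<open>sym F + I/2\<close>, so among positive semidefinite matrices it vanishes only for those of rank one.
\<close>

definition admissible :: "real \<Rightarrow> (real^3^3) set" where
  "admissible s = {F. trace F = 0 \<and> (\<forall>x. x \<noteq> 0 \<longrightarrow> 0 < x \<bullet> (F *v x) + (x \<bullet> x) / 2) \<and>
     3/2 - (norm (sym_part F))\<^sup>2 < s}"

text \<open>
  All that is used about a trace free gradient is read off an orthonormal eigenbasis of \<open>sym F + I/2\<close>.
  The formula for the excess is \<open>(p + q + r)\<^sup>2 - p\<^sup>2 - q\<^sup>2 - r\<^sup>2\<close> with \<open>p + q + r = 3/2\<close>.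
\<close>

lemma strain_eigenbasis:
  fixes F :: "real^3^3"
  assumes tr: "trace F = 0"
  obtains a b c p q r where "norm a = 1" "norm b = 1" "norm c = 1" "a \<bullet> b = 0" "a \<bullet> c = 0" "b \<bullet> c = 0"
    "p \<ge> q" "q \<ge> r" "p + q + r = 3/2"
    "sym_part F + (1/2) *\<^sub>R mat 1 = p *\<^sub>R outer a a + q *\<^sub>R outer b b + r *\<^sub>R outer c c"
    "3/2 - (norm (sym_part F))\<^sup>2 = 2 * (p * q + q * r + p * r)"
    "\<And>x. x \<bullet> (F *v x) + (x \<bullet> x) / 2 = p * (a \<bullet> x)\<^sup>2 + q * (b \<bullet> x)\<^sup>2 + r * (c \<bullet> x)\<^sup>2"
    "\<And>x. x \<bullet> x = (a \<bullet> x)\<^sup>2 + (b \<bullet> x)\<^sup>2 + (c \<bullet> x)\<^sup>2"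
proof -
  let ?P = "sym_part F + (1/2) *\<^sub>R mat 1"
  have trI: "transpose (mat 1 :: real^3^3) = mat 1" by (simp add: transpose_mat)
  then have "transpose ?P = ?P" by (simp add: transpose_add transpose_scale transpose_sym_part)
  then obtain a b c p q r where
    o: "norm a = 1" "norm b = 1" "norm c = 1" "a \<bullet> b = 0" "a \<bullet> c = 0" "b \<bullet> c = 0"
    and pqr: "p \<ge> q" "q \<ge> r" and P: "?P = p *\<^sub>R outer a a + q *\<^sub>R outer b b + r *\<^sub>R outer c c"
    by (rule symmetric_diagonalization_3) (rule that)
  have oo: "a \<bullet> a = 1" "b \<bullet> b = 1" "c \<bullet> c = 1" "b \<bullet> a = 0" "c \<bullet> a = 0" "c \<bullet> b = 0"
    using o by (auto simp: dot_square_norm inner_commute)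
  have "trace ?P = 3/2" by (simp add: trace_add trace_scaleR trace_sym_part tr trace_I)
  then have sum: "p + q + r = 3/2" unfolding P by (simp add: trace_add trace_scaleR trace_outer oo)
  have I1: "A \<bullet> mat 1 = trace A" for A :: "real^3^3"
    by (simp add: inner_vec_def trace_def mat_def sum_3)
  have "?P \<bullet> ?P = p\<^sup>2 + q\<^sup>2 + r\<^sup>2"
    unfolding P by (simp add: inner_add_left inner_add_right inner_outer o oo power2_eq_square)
  moreover have "?P \<bullet> ?P = (norm (sym_part F))\<^sup>2 + 3/4"
  proof -
    have "mat 1 \<bullet> (mat 1 :: real^3^3) = 3" by (simp only: I1) (simp add: trace_I)
    then show ?thesis
      unfolding power2_norm_eq_inner[symmetric] norm_add_scaleR_sq I1 trace_sym_part tr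
      by (simp only:) (simp add: power2_eq_square)
  qed
  moreover have "(p + q + r)\<^sup>2 = 9/4" by (simp add: sum power2_eq_square)
  ultimately have s: "3/2 - (norm (sym_part F))\<^sup>2 = 2 * (p * q + q * r + p * r)"
    by (simp add: power2_eq_square algebra_simps)
  have quad: "x \<bullet> (F *v x) + (x \<bullet> x) / 2 = p * (a \<bullet> x)\<^sup>2 + q * (b \<bullet> x)\<^sup>2 + r * (c \<bullet> x)\<^sup>2" for x
  proof -
    have "x \<bullet> (F *v x) + (x \<bullet> x) / 2 = x \<bullet> (?P *v x)"
      by (simp add: matrix_vector_mult_add_rdistrib inner_add_right quadratic_sym_part flip: scaleR_matrix_vector_assoc)
    also have "\<dots> = p * (a \<bullet> x)\<^sup>2 + q * (b \<bullet> x)\<^sup>2 + r * (c \<bullet> x)\<^sup>2"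
      unfolding P by (simp add: matrix_vector_mult_add_rdistrib inner_add_right outer_mult_vec
          inner_commute[of x] power2_eq_square flip: scaleR_matrix_vector_assoc)
    finally show ?thesis .
  qed
  have "x \<bullet> x = (a \<bullet> x)\<^sup>2 + (b \<bullet> x)\<^sup>2 + (c \<bullet> x)\<^sup>2" for x
  proof -
    have "x \<bullet> x = ((a \<bullet> x) *\<^sub>R a + (b \<bullet> x) *\<^sub>R b + (c \<bullet> x) *\<^sub>R c) \<bullet> x"
      using orthonormal_triple_expand[OF o, of x] by simp
    also have "\<dots> = (a \<bullet> x)\<^sup>2 + (b \<bullet> x)\<^sup>2 + (c \<bullet> x)\<^sup>2"
      by (simp add: inner_add_left power2_eq_square)
    finally show ?thesis .
  qed
  from that[OF o pqr sum P s quad this] show ?thesis .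
qed

lemma norm_mult_vec_le:
  fixes A :: "real^'n^'m"
  shows "norm (A *v x) \<le> norm A * norm x"
proof -
  have "norm (A *v x) = L2_set (\<lambda>i. \<bar>A $ i \<bullet> x\<bar>) UNIV"
    by (simp add: norm_vec_def matrix_vector_mul_component)
  also have "\<dots> \<le> L2_set (\<lambda>i. norm (A $ i) * norm x) UNIV"
    by (intro L2_set_mono Cauchy_Schwarz_ineq2) auto
  also have "\<dots> = norm A * norm x" by (simp add: norm_vec_def[of A] L2_set_right_distrib flip: L2_set_left_distrib)
  finally show ?thesis .
qed

text \<open>
  The excess of a trace free matrix is at most \<open>3/2\<close>, so the bound \<open>2\<close> is a convenient start.
\<close>

lemma admissible_two:
  assumes "trace F = 0" "\<And>x. x \<noteq> 0 \<Longrightarrow> 0 < x \<bullet> (F *v x) + (x \<bullet> x) / 2"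
  shows "F \<in> admissible 2"
proof -
  have "3/2 - (norm (sym_part F))\<^sup>2 < 2" using zero_le_power2[of "norm (sym_part F)"] by linarith
  then show ?thesis using assms by (simp add: admissible_def)
qed

lemma pos_def_coeffs:
  assumes o: "norm a = 1" "norm b = 1" "norm c = 1" "a \<bullet> b = 0" "a \<bullet> c = 0" "b \<bullet> c = 0"
    and "\<And>x. x \<noteq> 0 \<Longrightarrow> 0 < p * (a \<bullet> x)\<^sup>2 + q * (b \<bullet> x)\<^sup>2 + r * (c \<bullet> x)\<^sup>2"
  shows "p > 0" "q > 0" "r > 0"
proof -
  have "a \<noteq> 0" "b \<noteq> 0" "c \<noteq> 0" using o by auto
  then show "p > 0" "q > 0" "r > 0" using assms(7)[of a] assms(7)[of b] assms(7)[of c] o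
    by (auto simp: dot_square_norm inner_commute)
qed

text \<open>
  The direction \<open>a \<otimes> b\<close> is spanned by the eigenvectors of the two largest eigenvalues \<open>p\<close>, \<open>q\<close> of
  \<open>sym F + I/2\<close>. Its symmetric part is orthogonal to \<open>sym F\<close>, which is diagonal in this basis, so both signs raise
  \<open>|sym F|\<^sup>2\<close> by the same amount \<open>\<tau>\<^sup>2 / 2 = pq\<close>. Since \<open>pq\<close> is the largest of the three products
  of eigenvalues, this removes at least a sixth of the excess. The choice \<open>\<tau>\<^sup>2 = 2pq\<close> is half of the
  value at which positive definiteness would be lost.
\<close>

lemma admissible_split:
  assumes F: "F \<in> admissible s"
  obtains a b \<tau> where "norm a = 1" "norm b = 1" "a \<bullet> b = 0" "0 < \<tau>" "\<tau> \<le> sqrt s"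
    "F + \<tau> *\<^sub>R outer a b \<in> admissible (5/6 * s)" "F - \<tau> *\<^sub>R outer a b \<in> admissible (5/6 * s)"
proof -
  have tr: "trace F = 0" and pd: "\<And>x. x \<noteq> 0 \<Longrightarrow> 0 < x \<bullet> (F *v x) + (x \<bullet> x) / 2"
    and sF: "3/2 - (norm (sym_part F))\<^sup>2 < s"
    using F by (auto simp: admissible_def)
  obtain a b c p q r where
    o: "norm a = 1" "norm b = 1" "norm c = 1" "a \<bullet> b = 0" "a \<bullet> c = 0" "b \<bullet> c = 0"
    and pqr: "p \<ge> q" "q \<ge> r" "p + q + r = 3/2"
    and P: "sym_part F + (1/2) *\<^sub>R mat 1 = p *\<^sub>R outer a a + q *\<^sub>R outer b b + r *\<^sub>R outer c c"
    and s: "3/2 - (norm (sym_part F))\<^sup>2 = 2 * (p * q + q * r + p * r)"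
    and quad: "\<And>x. x \<bullet> (F *v x) + (x \<bullet> x) / 2 = p * (a \<bullet> x)\<^sup>2 + q * (b \<bullet> x)\<^sup>2 + r * (c \<bullet> x)\<^sup>2"
    and sq: "\<And>x. x \<bullet> x = (a \<bullet> x)\<^sup>2 + (b \<bullet> x)\<^sup>2 + (c \<bullet> x)\<^sup>2"
    by (rule strain_eigenbasis[OF tr]) (rule that)
  have pos: "p > 0" "q > 0" "r > 0"
    using pos_def_coeffs[OF o, of p q r] pd quad by auto
  have oo: "a \<bullet> a = 1" "b \<bullet> b = 1" "c \<bullet> c = 1" "b \<bullet> a = 0" "c \<bullet> a = 0" "c \<bullet> b = 0"
    using o by (auto simp: dot_square_norm inner_commute)
  define \<tau> where "\<tau> = sqrt (2 * p * q)"
  have \<tau>2: "\<tau>\<^sup>2 = 2 * p * q" using pos by (simp add: \<tau>_def)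
  have \<tau>0: "\<tau> > 0" using pos by (simp add: \<tau>_def)
  have "q * r \<le> p * q" "p * r \<le> p * q" using pos pqr by (auto simp: mult.commute)
  then have big: "2 * (p * q + q * r + p * r) \<le> 6 * (p * q)" by simp
  have "2 * p * q \<le> s" using sF mult_pos_pos[OF pos(2,3)] mult_pos_pos[OF pos(1,3)] unfolding s by simp
  then have "\<tau> \<le> sqrt s" by (simp add: \<tau>_def)
  moreover have "F + \<sigma> *\<^sub>R \<tau> *\<^sub>R outer a b \<in> admissible (5/6 * s)" if \<sigma>: "\<sigma>\<^sup>2 = 1" for \<sigma> :: real
    unfolding admissible_def
  proof (intro CollectI conjI allI impI)
    show "trace (F + \<sigma> *\<^sub>R \<tau> *\<^sub>R outer a b) = 0"
      by (simp add: trace_add trace_scaleR trace_outer tr o)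
    show "0 < x \<bullet> ((F + \<sigma> *\<^sub>R \<tau> *\<^sub>R outer a b) *v x) + (x \<bullet> x) / 2" if x: "x \<noteq> 0" for x
    proof -
      let ?\<alpha> = "a \<bullet> x" and ?\<beta> = "b \<bullet> x" and ?\<gamma> = "c \<bullet> x"
      have eq: "x \<bullet> ((F + \<sigma> *\<^sub>R \<tau> *\<^sub>R outer a b) *v x) + (x \<bullet> x) / 2 =
          p * ?\<alpha>\<^sup>2 + q * ?\<beta>\<^sup>2 + r * ?\<gamma>\<^sup>2 + \<sigma> * \<tau> * ?\<alpha> * ?\<beta>"
        using quad[of x]
        by (simp add: matrix_vector_mult_add_rdistrib inner_add_right outer_mult_vec inner_commute[of x a]
            flip: scaleR_matrix_vector_assoc)
      have "x \<bullet> x > 0" using x by simp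
      then have nz: "?\<alpha>\<^sup>2 + ?\<beta>\<^sup>2 + ?\<gamma>\<^sup>2 > 0" using sq[of x] by simp
      \<comment> \<open>complete the square; the subtracted term uses up only half of \<open>p q (b \<bullet> x)\<^sup>2\<close>\<close>
      have "p * (p * ?\<alpha>\<^sup>2 + q * ?\<beta>\<^sup>2 + r * ?\<gamma>\<^sup>2 + \<sigma> * \<tau> * ?\<alpha> * ?\<beta>) =
          (p * ?\<alpha> + \<sigma> * \<tau> * ?\<beta> / 2)\<^sup>2 + (p * q / 2) * ?\<beta>\<^sup>2 + p * r * ?\<gamma>\<^sup>2"
      proof -
        define X where "X = \<sigma> * \<tau> * ?\<beta> / 2"
        have X2: "X\<^sup>2 = p * q / 2 * ?\<beta>\<^sup>2"
          by (simp add: X_def power_mult_distrib power_divide \<sigma> \<tau>2)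
        have "(p * ?\<alpha> + X)\<^sup>2 = p * (p * ?\<alpha>\<^sup>2) + p * (2 * ?\<alpha> * X) + p * q / 2 * ?\<beta>\<^sup>2"
          unfolding power2_sum X2 by (simp add: power_mult_distrib) (simp add: power2_eq_square)
        then show ?thesis unfolding X_def[symmetric] by (simp add: X_def algebra_simps)
      qed
      also have "\<dots> > 0"
      proof (cases "?\<beta> = 0 \<and> ?\<gamma> = 0")
        case True
        then show ?thesis using nz pos by auto
      next
        case False
        then have "(p * q / 2) * ?\<beta>\<^sup>2 + p * r * ?\<gamma>\<^sup>2 > 0"
          using pos by (auto intro: add_pos_nonneg add_nonneg_pos)
        then show ?thesis by (simp add: add_nonneg_pos add.assoc)
      qed
      finally show ?thesis unfolding eq using pos by (simp add: zero_less_mult_iff)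
    qed
    have "sym_part (F + \<sigma> *\<^sub>R \<tau> *\<^sub>R outer a b) = sym_part F + (\<sigma> * \<tau> / 2) *\<^sub>R (outer a b + outer b a)"
      by (simp add: sym_part_add sym_part_scale) (simp add: sym_part_def transpose_outer)
    moreover have "sym_part F \<bullet> (outer a b + outer b a) = 0"
    proof -
      have "sym_part F = (p *\<^sub>R outer a a + q *\<^sub>R outer b b + r *\<^sub>R outer c c) - (1/2) *\<^sub>R mat 1"
        using P by (simp add: algebra_simps)
      moreover have "mat 1 \<bullet> A = trace A" for A :: "real^3^3"
        by (simp add: inner_vec_def trace_def mat_def sum_3)
      ultimately show ?thesis
        by (simp add: inner_diff_left inner_add_left inner_add_right inner_outer o oo trace_outer)
    qed
    moreover have "(outer a b + outer b a) \<bullet> (outer a b + outer b a) = 2"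
      by (simp add: inner_add_left inner_add_right inner_outer o oo)
    ultimately have "(norm (sym_part (F + \<sigma> *\<^sub>R \<tau> *\<^sub>R outer a b)))\<^sup>2 =
        (norm (sym_part F))\<^sup>2 + (\<sigma> * \<tau> / 2)\<^sup>2 * 2"
      by (simp only: norm_add_scaleR_sq)
    also have "(\<sigma> * \<tau> / 2)\<^sup>2 * 2 = p * q" by (simp add: power_mult_distrib power_divide \<sigma> \<tau>2)
    finally show "3/2 - (norm (sym_part (F + \<sigma> *\<^sub>R \<tau> *\<^sub>R outer a b)))\<^sup>2 < 5/6 * s"
      using sF s big by linarith
  qed
  from this[of 1] this[of "-1"]
  have "F + \<tau> *\<^sub>R outer a b \<in> admissible (5/6 * s)" "F - \<tau> *\<^sub>R outer a b \<in> admissible (5/6 * s)"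
    by simp_all
  ultimately show ?thesis using that[OF o(1,2,4) \<tau>0] by blast
qed

text \<open>
  Positive definiteness with smallest eigenvalue \<open>r\<close> survives perturbations of norm less than \<open>r\<close>.
\<close>

lemma admissible_open:
  assumes F: "F \<in> admissible s"
  obtains \<eta> where "\<eta> > 0" "\<And>H. \<lbrakk>trace H = 0; norm (H - F) < \<eta>\<rbrakk> \<Longrightarrow> H \<in> admissible s"
proof -
  have tr: "trace F = 0" and pd: "\<And>x. x \<noteq> 0 \<Longrightarrow> 0 < x \<bullet> (F *v x) + (x \<bullet> x) / 2"
    and sF: "3/2 - (norm (sym_part F))\<^sup>2 < s"
    using F by (auto simp: admissible_def)
  obtain a b c p q r where
    o: "norm a = 1" "norm b = 1" "norm c = 1" "a \<bullet> b = 0" "a \<bullet> c = 0" "b \<bullet> c = 0"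
    and pqr: "p \<ge> q" "q \<ge> r"
    and quad: "\<And>x. x \<bullet> (F *v x) + (x \<bullet> x) / 2 = p * (a \<bullet> x)\<^sup>2 + q * (b \<bullet> x)\<^sup>2 + r * (c \<bullet> x)\<^sup>2"
    and sq: "\<And>x. x \<bullet> x = (a \<bullet> x)\<^sup>2 + (b \<bullet> x)\<^sup>2 + (c \<bullet> x)\<^sup>2"
    by (rule strain_eigenbasis[OF tr]) (rule that)
  have r: "r > 0" using pos_def_coeffs[OF o, of p q r] pd quad by auto
  have lower: "x \<bullet> (F *v x) + (x \<bullet> x) / 2 \<ge> r * (x \<bullet> x)" for x
  proof -
    have "r * (a \<bullet> x)\<^sup>2 \<le> p * (a \<bullet> x)\<^sup>2" "r * (b \<bullet> x)\<^sup>2 \<le> q * (b \<bullet> x)\<^sup>2"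
      using pqr by (auto intro: mult_right_mono)
    moreover have "r * (x \<bullet> x) = r * (a \<bullet> x)\<^sup>2 + r * (b \<bullet> x)\<^sup>2 + r * (c \<bullet> x)\<^sup>2"
      using sq[of x] by (simp add: distrib_left)
    ultimately show ?thesis using quad[of x] by linarith
  qed
  have "isCont (\<lambda>H. 3/2 - (norm (sym_part H))\<^sup>2) F"
    by (intro continuous_intros bounded_linear.isCont[OF bounded_linear_sym_part])
  then have "((\<lambda>H. 3/2 - (norm (sym_part H))\<^sup>2) \<longlongrightarrow> 3/2 - (norm (sym_part F))\<^sup>2) (nhds F)"
    unfolding isCont_def by (rule tendsto_at_iff_tendsto_nhds[THEN iffD1])
  from order_tendstoD(2)[OF this sF]
  have "eventually (\<lambda>H. 3/2 - (norm (sym_part H))\<^sup>2 < s) (nhds F)" .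
  then obtain d where d: "d > 0" "\<And>H. dist H F < d \<Longrightarrow> 3/2 - (norm (sym_part H))\<^sup>2 < s"
    by (auto simp: eventually_nhds_metric)
  show ?thesis
  proof (rule that[of "min d r"])
    show "min d r > 0" using d r by simp
    fix H :: "real^3^3" assume H: "trace H = 0" "norm (H - F) < min d r"
    have "0 < x \<bullet> (H *v x) + (x \<bullet> x) / 2" if x: "x \<noteq> 0" for x
    proof -
      have "\<bar>x \<bullet> ((H - F) *v x)\<bar> \<le> norm x * norm ((H - F) *v x)"
        by (rule Cauchy_Schwarz_ineq2)
      also have "\<dots> \<le> norm x * (norm (H - F) * norm x)"
        by (intro mult_left_mono norm_mult_vec_le) simp
      also have "\<dots> < norm x * (r * norm x)" using x H by (intro mult_strict_left_mono mult_strict_right_mono) auto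
      also have "\<dots> = r * (x \<bullet> x)" by (simp add: dot_square_norm power2_eq_square)
      finally show ?thesis
        using lower[of x] by (simp add: matrix_vector_mult_diff_rdistrib inner_diff_right)
    qed
    then show "H \<in> admissible s" using H d(2)[of H] by (simp add: admissible_def dist_norm)
  qed
qed

text \<open>
  Zero excess forces all products of two eigenvalues of \<open>sym F + I/2\<close> to vanish, so only the largest
  one, which then equals the trace \<open>3/2\<close>, is different from zero, and \<open>sym F\<close> is \<open>U\<^sub>a\<close> for the
  corresponding eigenvector \<open>a\<close>.
\<close>

lemma V_energy_zero:
  fixes F :: "real^3^3"
  assumes tr: "trace F = 0" and psd: "\<And>x. 0 \<le> x \<bullet> (F *v x) + (x \<bullet> x) / 2"
    and s: "3/2 - (norm (sym_part F))\<^sup>2 \<le> 0"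
  shows "V_energy (sym_part F) = 0"
proof -
  obtain a b c p q r where
    o: "norm a = 1" "norm b = 1" "norm c = 1" "a \<bullet> b = 0" "a \<bullet> c = 0" "b \<bullet> c = 0"
    and pqr: "p \<ge> q" "q \<ge> r" "p + q + r = 3/2"
    and P: "sym_part F + (1/2) *\<^sub>R mat 1 = p *\<^sub>R outer a a + q *\<^sub>R outer b b + r *\<^sub>R outer c c"
    and s': "3/2 - (norm (sym_part F))\<^sup>2 = 2 * (p * q + q * r + p * r)"
    and quad: "\<And>x. x \<bullet> (F *v x) + (x \<bullet> x) / 2 = p * (a \<bullet> x)\<^sup>2 + q * (b \<bullet> x)\<^sup>2 + r * (c \<bullet> x)\<^sup>2"
    by (rule strain_eigenbasis[OF tr]) (rule that)
  have r: "r \<ge> 0" using psd[of c] quad[of c] o by (simp add: dot_square_norm)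
  have p: "p > 0" using pqr by linarith
  have "p * q + q * r + p * r \<le> 0" using s s' by simp
  moreover have "p * q \<ge> 0" "q * r \<ge> 0" "p * r \<ge> 0" using p pqr r by simp_all
  ultimately have "p * q = 0" "p * r = 0" by linarith+
  then have "q = 0" "r = 0" "p = 3/2" using p pqr by auto
  then have "sym_part F = U_mat a"
    using P by (simp add: U_mat_def outer_def algebra_simps eq_diff_eq)
  then have "(norm (sym_part F - U_mat a))\<^sup>2 = 0" by simp
  moreover obtain n where n: "V_energy (sym_part F) = (norm (sym_part F - U_mat n))\<^sup>2"
    "\<forall>m\<in>sphere 0 1. (norm (sym_part F - U_mat n))\<^sup>2 \<le> (norm (sym_part F - U_mat m))\<^sup>2"
    using V_energy_attained by metis
  moreover have "a \<in> sphere 0 1" using o by simp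
  ultimately show ?thesis by (metis zero_le_power2 order_antisym)
qed

text \<open>
  The vector belonging to the smallest coefficient \<open>r\<close> of the diagonalization is an eigenvector of
  \<open>sym F\<close> with eigenvalue \<open>r - 1/2\<close>. This eigenvalue therefore occurs in the sorted list of
  roots whose head is \<open>mu 1\<close>, and \<open>r > 0\<close> follows.
\<close>

lemma mu_1_pos_def:
  fixes F :: "real^3^3"
  assumes mu: "mu 1 (sym_part F) > -1/2" and tr: "trace F = 0" and x: "x \<noteq> 0"
  shows "0 < x \<bullet> (F *v x) + (x \<bullet> x) / 2"
proof -
  obtain a b c p q r where
    o: "norm a = 1" "norm b = 1" "norm c = 1" "a \<bullet> b = 0" "a \<bullet> c = 0" "b \<bullet> c = 0"
    and pqr: "p \<ge> q" "q \<ge> r" "p + q + r = 3/2"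
    and P: "sym_part F + (1/2) *\<^sub>R mat 1 = p *\<^sub>R outer a a + q *\<^sub>R outer b b + r *\<^sub>R outer c c"
    and s': "3/2 - (norm (sym_part F))\<^sup>2 = 2 * (p * q + q * r + p * r)"
    and quad: "\<And>x. x \<bullet> (F *v x) + (x \<bullet> x) / 2 = p * (a \<bullet> x)\<^sup>2 + q * (b \<bullet> x)\<^sup>2 + r * (c \<bullet> x)\<^sup>2"
    and sq: "\<And>x. x \<bullet> x = (a \<bullet> x)\<^sup>2 + (b \<bullet> x)\<^sup>2 + (c \<bullet> x)\<^sup>2"
    by (rule strain_eigenbasis[OF tr]) (rule that)
  let ?E = "sym_part F"
  have "(?E + (1/2) *\<^sub>R mat 1) *v c = r *\<^sub>R c"
    unfolding P using o by (simp add: matrix_vector_mult_add_rdistrib outer_mult_vec dot_square_norm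
          flip: scaleR_matrix_vector_assoc)
  then have "?E *v c = (r - 1/2) *\<^sub>R c"
    by (simp add: matrix_vector_mult_add_rdistrib algebra_simps flip: scaleR_matrix_vector_assoc)
  moreover have "c \<noteq> 0" using o by auto
  ultimately have "r - 1/2 \<in># proots (char_poly ?E)" by (auto simp: eigenvalue_iff)
  moreover define l where "l = sorted_list_of_multiset (proots (char_poly ?E))"
  ultimately have l: "r - 1/2 \<in> set l" "sorted l" by (auto simp: l_def)
  have "l ! 0 \<le> r - 1/2"
    using l by (metis in_set_conv_nth sorted_nth_mono le0)
  then have r: "r > 0" using mu by (simp add: mu_def l_def)
  have "0 < r * (x \<bullet> x)" using r x by simp
  also have "\<dots> \<le> x \<bullet> (F *v x) + (x \<bullet> x) / 2"
  proof -
    have "r * (a \<bullet> x)\<^sup>2 \<le> p * (a \<bullet> x)\<^sup>2" "r * (b \<bullet> x)\<^sup>2 \<le> q * (b \<bullet> x)\<^sup>2"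
      using pqr by (auto intro: mult_right_mono)
    moreover have "r * (x \<bullet> x) = r * (a \<bullet> x)\<^sup>2 + r * (b \<bullet> x)\<^sup>2 + r * (c \<bullet> x)\<^sup>2"
      using sq[of x] by (simp add: distrib_left)
    ultimately show ?thesis using quad[of x] by linarith
  qed
  finally show ?thesis .
qed

section \<open>A divergence free block with two gradients\<close>

text \<open>
  A segment that leaves \<open>S\<close> meets its frontier, where \<open>g\<close> vanishes.
\<close>

lemma lipschitz_zero_extension:
  fixes g :: "'a::real_normed_vector \<Rightarrow> 'b::real_normed_vector"
  assumes S: "open S" and g: "L-lipschitz_on (closure S) g" and g0: "\<And>x. x \<in> frontier S \<Longrightarrow> g x = 0"
  shows "L-lipschitz_on UNIV (\<lambda>x. if x \<in> S then g x else 0)"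
proof -
  let ?f = "\<lambda>x. if x \<in> S then g x else 0"
  have cross: "dist (g x) 0 \<le> L * dist x y" if x: "x \<in> S" and y: "y \<notin> S" for x y
  proof -
    have "closed_segment x y \<inter> frontier S \<noteq> {}"
      using x y by (intro connected_Int_frontier connected_segment) auto
    then obtain z where z: "z \<in> closed_segment x y" "z \<in> frontier S" by blast
    then have "dist (g x) (g z) \<le> L * dist x z"
      using x closure_subset by (intro lipschitz_onD[OF g]) (auto simp: frontier_def)
    also have "\<dots> \<le> L * dist x y"
      using z(1) lipschitz_on_nonneg[OF g] segment_bound(1)[of z x y]
      by (intro mult_left_mono) (auto simp: dist_norm norm_minus_commute)
    finally show ?thesis using g0[OF z(2)] by simp
  qed
  show ?thesis
  proof (rule lipschitz_onI)
    show "0 \<le> L" using g by (rule lipschitz_on_nonneg)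
    fix x y :: 'a
    consider "x \<in> S" "y \<in> S" | "x \<in> S" "y \<notin> S" | "x \<notin> S" "y \<in> S" | "x \<notin> S" "y \<notin> S" by blast
    then show "dist (?f x) (?f y) \<le> L * dist x y"
    proof cases
      case 1
      then show ?thesis using closure_subset by (auto intro!: lipschitz_onD[OF g])
    next
      case 2
      then show ?thesis using cross[of x y] by simp
    next
      case 3
      then show ?thesis using cross[of y x] by (simp add: dist_commute)
    qed (use lipschitz_on_nonneg[OF g] in simp)
  qed
qed

lemma abs_max_diff_le: "\<bar>max a b - max c d\<bar> \<le> K" if "\<bar>a - c\<bar> \<le> K" "\<bar>b - d\<bar> \<le> K" for a b c d :: real
  using that by linarith

lemma abs_min_diff_le: "\<bar>min a b - min c d\<bar> \<le> K" if "\<bar>a - c\<bar> \<le> K" "\<bar>b - d\<bar> \<le> K" for a b c d :: real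
  using that by linarith

text \<open>
  The vector \<open>b\<close> is normal to the layers, \<open>a\<close> is the direction of the displacement, \<open>\<tau>\<close> is the
  amplitude of the gradient and \<open>\<epsilon>\<close> the thickness of the lens.
\<close>

locale lens_block =
  fixes a b :: "real^'n" and \<tau> \<epsilon> :: real
  assumes a1: "norm a = 1" and b1: "norm b = 1" and ab: "a \<bullet> b = 0"
    and \<tau>: "0 < \<tau>" and \<epsilon>: "0 < \<epsilon>" "\<epsilon> \<le> 1/4"
begin

lemma bb: "b \<bullet> b = 1" and ba: "b \<bullet> a = 0"
  using b1 ab by (simp_all add: dot_square_norm inner_commute)

definition perp :: "real^'n \<Rightarrow> real^'n" where "perp x = x - (b \<bullet> x) *\<^sub>R b"

text \<open>
  The lens has the points with \<open>|b \<bullet> x| < \<rho> x\<close>; as the subtracted term is the squared distance from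
  the axis through \<open>b\<close>, the half thickness \<open>\<rho>\<close> is constant along \<open>b\<close>.
\<close>

definition \<rho> :: "real^'n \<Rightarrow> real" where "\<rho> x = \<epsilon> * (1 - (x \<bullet> x - (b \<bullet> x)\<^sup>2))"

lemma perp_sq: "perp x \<bullet> perp x = x \<bullet> x - (b \<bullet> x)\<^sup>2"
  by (simp add: perp_def inner_diff_left inner_diff_right bb inner_commute[of x b] power2_eq_square)

lemma \<rho>_perp: "\<rho> x = \<epsilon> * (1 - (norm (perp x))\<^sup>2)"
  by (simp add: \<rho>_def power2_norm_eq_inner perp_sq)

lemma norm_perp_le: "norm (perp x) \<le> norm x"
  by (simp add: norm_le perp_sq)

lemma perp_diff: "perp x - perp z = perp (x - z)"
  by (simp add: perp_def inner_diff_right algebra_simps)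

definition lens :: "(real^'n) set" where "lens = {x. \<bar>b \<bullet> x\<bar> < \<rho> x}"

lemma continuous_\<rho>: "continuous_on S \<rho>"
  unfolding \<rho>_def[abs_def] by (intro continuous_intros)

lemma open_lens: "open lens"
  unfolding lens_def by (intro open_Collect_less continuous_intros continuous_\<rho>)

lemma zero_in_lens: "0 \<in> lens"
  using \<epsilon> by (simp add: lens_def \<rho>_def)

lemma closure_lens: "closure lens \<subseteq> {x. \<bar>b \<bullet> x\<bar> \<le> \<rho> x}"
  by (intro closure_minimal closed_Collect_le continuous_intros continuous_\<rho>) (auto simp: lens_def)

lemma lens_bounds:
  assumes "\<bar>b \<bullet> x\<bar> \<le> \<rho> x"
  shows "0 \<le> \<rho> x" "\<rho> x \<le> \<epsilon>" "norm (perp x) \<le> 1" "\<bar>a \<bullet> x\<bar> \<le> 1" "norm x \<le> 2"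
proof -
  show \<rho>0: "0 \<le> \<rho> x" using assms by linarith
  show \<rho>1: "\<rho> x \<le> \<epsilon>" using \<epsilon> by (simp add: \<rho>_perp)
  have "(norm (perp x))\<^sup>2 \<le> 1" using \<rho>0 \<epsilon> by (simp add: \<rho>_perp zero_le_mult_iff)
  then show p: "norm (perp x) \<le> 1" by (simp add: power_le_one_iff)
  have "a \<bullet> x = a \<bullet> perp x" by (simp add: perp_def inner_diff_right ab)
  then show "\<bar>a \<bullet> x\<bar> \<le> 1" using Cauchy_Schwarz_ineq2[of a "perp x"] a1 p by simp
  have "x = perp x + (b \<bullet> x) *\<^sub>R b" by (simp add: perp_def)
  then have "norm x \<le> norm (perp x) + norm ((b \<bullet> x) *\<^sub>R b)" by (metis norm_triangle_ineq)
  then show "norm x \<le> 2" using p assms \<rho>1 \<epsilon> b1 by simp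
qed

text \<open>
  Along any ray from the origin the difference \<open>|b \<bullet> x| - \<kappa> \<rho> x\<close> is strictly increasing, so this
  closed set meets the ray at most once.
\<close>

lemma negligible_graph:
  assumes "\<kappa> > 0"
  shows "negligible {x. \<bar>b \<bullet> x\<bar> = \<kappa> * \<rho> x}"
proof (rule starlike_negligible[where a = 0])
  show "closed {x. \<bar>b \<bullet> x\<bar> = \<kappa> * \<rho> x}"
    by (intro closed_Collect_eq continuous_intros continuous_\<rho>)
  fix c x
  assume "0 + c *\<^sub>R x \<in> {x. \<bar>b \<bullet> x\<bar> = \<kappa> * \<rho> x}" and c: "0 \<le> c" and "0 + x \<in> {x. \<bar>b \<bullet> x\<bar> = \<kappa> * \<rho> x}"
  define N where "N = x \<bullet> x - (b \<bullet> x)\<^sup>2"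
  have N: "N \<ge> 0" using perp_sq[of x] by (metis N_def inner_ge_zero)
  from \<open>0 + c *\<^sub>R x \<in> _\<close> have 1: "c * \<bar>b \<bullet> x\<bar> = \<kappa> * \<epsilon> * (1 - c\<^sup>2 * N)"
    using c by (simp add: \<rho>_def N_def abs_mult power2_eq_square algebra_simps)
  from \<open>0 + x \<in> _\<close> have 2: "\<bar>b \<bullet> x\<bar> = \<kappa> * \<epsilon> * (1 - N)"
    by (simp add: \<rho>_def N_def)
  have "\<kappa> * \<epsilon> * ((c - 1) * (1 + c * N)) = 0"
    using 1 unfolding 2 by (simp add: power2_eq_square algebra_simps)
  moreover have "1 + c * N > 0" using c N by (simp add: add_pos_nonneg)
  ultimately show "c = 1" using assms \<epsilon> by auto
qed

lemma frontier_lens: "frontier lens \<subseteq> {x. \<bar>b \<bullet> x\<bar> = \<rho> x}"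
proof
  fix x assume "x \<in> frontier lens"
  then have "x \<in> closure lens" "x \<notin> lens" by (auto simp: frontier_def interior_open[OF open_lens])
  then show "x \<in> {x. \<bar>b \<bullet> x\<bar> = \<rho> x}" using closure_lens by (auto simp: lens_def)
qed

lemma negligible_frontier_lens: "negligible (frontier lens)"
  using negligible_subset[OF negligible_graph[of 1]] frontier_lens by simp

text \<open>
  Write \<open>y = b \<bullet> x\<close>. Let \<open>h\<close> be the function on \<open>[-1, 1]\<close> with \<open>h'' = -1/2\<close> for \<open>|s| < 1/2\<close> and
  \<open>h'' = 1/2\<close> for \<open>|s| > 1/2\<close> which vanishes together with \<open>h'\<close> at both ends. The potential
  \<open>\<psi> = 2 \<tau> \<rho>\<^sup>2 h (y / \<rho>)\<close> and its gradient vanish on the boundary of the lens, its second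
  derivative along \<open>b\<close> takes the values \<open>\<tau>\<close> and \<open>- \<tau>\<close> only, and its other second derivatives are
  small with \<open>\<epsilon>\<close>. The field \<open>(\<partial>\<^sub>b \<psi>) a - (\<partial>\<^sub>a \<psi>) b\<close> is divergence free as \<open>a\<close> and \<open>b\<close>
  are orthogonal, and \<open>profile\<close> is this field written out: \<open>saw\<close> is \<open>\<partial>\<^sub>b \<psi> / \<tau>\<close>, and
  \<open>hat\<close> is \<open>2 \<rho> (2 h - s h')\<close> at \<open>s = y / \<rho>\<close>.
\<close>

definition saw :: "real^'n \<Rightarrow> real" where
  "saw x = max (b \<bullet> x - \<rho> x) (min (- (b \<bullet> x)) (b \<bullet> x + \<rho> x))"

definition hat :: "real^'n \<Rightarrow> real" where
  "hat x = min (\<rho> x / 2) (\<rho> x - \<bar>b \<bullet> x\<bar>)"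

definition profile :: "real^'n \<Rightarrow> real^'n" where
  "profile x = (\<tau> * saw x) *\<^sub>R a + (2 * \<epsilon> * \<tau> * ((a \<bullet> x) * hat x)) *\<^sub>R b"

definition field :: "real^'n \<Rightarrow> real^'n" where
  "field x = (if x \<in> lens then profile x else 0)"

lemma \<rho>_lipschitz:
  assumes "norm (perp x) \<le> 1" "norm (perp z) \<le> 1"
  shows "\<bar>\<rho> x - \<rho> z\<bar> \<le> 2 * \<epsilon> * norm (x - z)"
proof -
  let ?s = "norm (perp x)" and ?t = "norm (perp z)"
  have "\<rho> x - \<rho> z = \<epsilon> * ((?t - ?s) * (?s + ?t))"
    by (simp add: \<rho>_perp power2_eq_square algebra_simps)
  then have "\<bar>\<rho> x - \<rho> z\<bar> = \<epsilon> * (\<bar>?t - ?s\<bar> * (?s + ?t))"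
    using \<epsilon> by (simp add: abs_mult)
  also have "\<dots> \<le> \<epsilon> * (norm (x - z) * 2)"
  proof (intro mult_left_mono mult_mono)
    have "\<bar>?t - ?s\<bar> \<le> norm (perp x - perp z)"
      using norm_triangle_ineq3[of "perp x" "perp z"] by linarith
    then show "\<bar>?t - ?s\<bar> \<le> norm (x - z)"
      using norm_perp_le[of "x - z"] by (simp add: perp_diff)
  qed (use assms \<epsilon> in auto)
  finally show ?thesis by (simp add: mult_ac)
qed

lemma profile_lipschitz: "(3 * \<tau>)-lipschitz_on (closure lens) profile"
proof (rule lipschitz_onI)
  show "0 \<le> 3 * \<tau>" using \<tau> by simp
  fix x z assume "x \<in> closure lens" "z \<in> closure lens"
  then have x: "\<bar>b \<bullet> x\<bar> \<le> \<rho> x" and z: "\<bar>b \<bullet> z\<bar> \<le> \<rho> z" using closure_lens by auto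
  let ?D = "norm (x - z)"
  let ?K = "(1 + 2 * \<epsilon>) * ?D"
  have \<rho>d: "\<bar>\<rho> x - \<rho> z\<bar> \<le> 2 * \<epsilon> * ?D" using \<rho>_lipschitz lens_bounds x z by blast
  have yd: "\<bar>b \<bullet> x - b \<bullet> z\<bar> \<le> ?D"
    using Cauchy_Schwarz_ineq2[of b "x - z"] b1 by (simp add: inner_diff_right)
  have ad: "\<bar>a \<bullet> x - a \<bullet> z\<bar> \<le> ?D"
    using Cauchy_Schwarz_ineq2[of a "x - z"] a1 by (simp add: inner_diff_right)
  have K: "?K = ?D + 2 * \<epsilon> * ?D" by (simp add: algebra_simps)
  have e0: "0 \<le> \<epsilon> * ?D" using \<epsilon> by simp
  have saw: "\<bar>saw x - saw z\<bar> \<le> ?K"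
    unfolding saw_def by (intro abs_max_diff_le abs_min_diff_le) (use K \<rho>d yd e0 in linarith)+
  have hat: "\<bar>hat x - hat z\<bar> \<le> ?K"
    unfolding hat_def by (intro abs_min_diff_le) (use K \<rho>d yd e0 in linarith)+
  have hat0: "\<bar>hat z\<bar> \<le> \<epsilon>" using z lens_bounds(1,2)[OF z] unfolding hat_def by linarith
  have "\<bar>(a \<bullet> x) * hat x - (a \<bullet> z) * hat z\<bar> = \<bar>(a \<bullet> x) * (hat x - hat z) + (a \<bullet> x - a \<bullet> z) * hat z\<bar>"
    by (simp add: algebra_simps)
  also have "\<dots> \<le> \<bar>a \<bullet> x\<bar> * \<bar>hat x - hat z\<bar> + \<bar>a \<bullet> x - a \<bullet> z\<bar> * \<bar>hat z\<bar>"
    by (metis abs_mult abs_triangle_ineq)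
  also have "\<dots> \<le> 1 * ?K + ?D * \<epsilon>"
    using lens_bounds(4)[OF x] saw hat ad hat0 \<epsilon> by (intro add_mono mult_mono) auto
  finally have ah: "\<bar>(a \<bullet> x) * hat x - (a \<bullet> z) * hat z\<bar> \<le> 1 * ?K + ?D * \<epsilon>" .
  have "profile x - profile z = (\<tau> * (saw x - saw z)) *\<^sub>R a +
      (2 * \<epsilon> * \<tau> * ((a \<bullet> x) * hat x - (a \<bullet> z) * hat z)) *\<^sub>R b"
    by (simp add: profile_def algebra_simps)
  then have "norm (profile x - profile z) \<le> \<bar>\<tau> * (saw x - saw z)\<bar> +
      \<bar>2 * \<epsilon> * \<tau> * ((a \<bullet> x) * hat x - (a \<bullet> z) * hat z)\<bar>"
    using norm_triangle_ineq a1 b1 by (metis norm_scaleR mult.right_neutral)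
  also have "\<dots> = \<tau> * \<bar>saw x - saw z\<bar> + \<tau> * (2 * \<epsilon> * \<bar>(a \<bullet> x) * hat x - (a \<bullet> z) * hat z\<bar>)"
    using \<tau> \<epsilon> by (simp add: abs_mult)
  also have "\<dots> \<le> \<tau> * ?K + \<tau> * (2 * \<epsilon> * (1 * ?K + ?D * \<epsilon>))"
    using saw ah \<tau> \<epsilon> by (intro add_mono mult_left_mono) auto
  also have "\<dots> = \<tau> * ?D * (1 + 4 * \<epsilon> + 6 * \<epsilon>\<^sup>2)"
    by (simp add: power2_eq_square algebra_simps)
  also have "\<dots> \<le> \<tau> * ?D * 3"
  proof (intro mult_left_mono)
    have "\<epsilon>\<^sup>2 \<le> (1/4)\<^sup>2" using \<epsilon> by (intro power_mono) auto
    then have "\<epsilon>\<^sup>2 \<le> 1/16" by (simp add: power2_eq_square)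
    then show "1 + 4 * \<epsilon> + 6 * \<epsilon>\<^sup>2 \<le> 3" using \<epsilon> by linarith
  qed (use \<tau> in auto)
  finally show "dist (profile x) (profile z) \<le> 3 * \<tau> * dist x z" by (simp add: dist_norm mult_ac)
qed

lemma profile_frontier: "profile x = 0" if "x \<in> frontier lens"
proof -
  have *: "\<bar>b \<bullet> x\<bar> = \<rho> x" using that frontier_lens by blast
  then have "saw x = 0" "hat x = 0" unfolding saw_def hat_def by linarith+
  then show ?thesis by (simp add: profile_def)
qed

lemma field_lipschitz: "(3 * \<tau>)-lipschitz_on UNIV field"
  using lipschitz_zero_extension[OF open_lens profile_lipschitz profile_frontier]
  by (simp add: field_def[abs_def])

definition \<rho>_grad :: "real^'n \<Rightarrow> real^'n" where "\<rho>_grad x = (- 2 * \<epsilon>) *\<^sub>R perp x"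

lemma \<rho>_has_derivative: "(\<rho> has_derivative (\<lambda>h. \<rho>_grad x \<bullet> h)) (at x)"
  unfolding \<rho>_def[abs_def] \<rho>_grad_def perp_def power2_eq_square
  by (auto intro!: derivative_eq_intros simp: inner_diff_left inner_commute algebra_simps)

lemma isCont_\<rho>_grad: "isCont \<rho>_grad x"
  unfolding \<rho>_grad_def[abs_def] perp_def by (intro continuous_intros)

lemma isCont_\<rho>: "isCont \<rho> x"
  using continuous_\<rho>[of UNIV] by (simp add: continuous_on_eq_continuous_at)

lemma \<rho>_grad_bound: "norm (\<rho>_grad x) \<le> 2 * \<epsilon>" if "\<bar>b \<bullet> x\<bar> \<le> \<rho> x"
  using lens_bounds(3)[OF that] \<epsilon> by (simp add: \<rho>_grad_def)

lemma \<rho>_grad_inner: "b \<bullet> \<rho>_grad x = 0" "a \<bullet> \<rho>_grad x = - 2 * \<epsilon> * (a \<bullet> x)"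
  by (simp_all add: \<rho>_grad_def perp_def inner_diff_right ab bb)

text \<open>
  On \<open>core\<close>, the region \<open>|y| < \<rho> / 2\<close>, the gradient is close to \<open>- \<tau> a \<otimes> b\<close>; on the caps above
  and below it is close to \<open>\<tau> a \<otimes> b\<close>. The sign \<open>\<sigma>\<close> distinguishes the two caps.
\<close>

definition core :: "(real^'n) set" where "core = {x. \<bar>b \<bullet> x\<bar> < \<rho> x / 2}"
definition cap :: "real \<Rightarrow> (real^'n) set" where "cap \<sigma> = {x. \<rho> x / 2 < \<sigma> * (b \<bullet> x) \<and> \<sigma> * (b \<bullet> x) < \<rho> x}"

definition core_grad :: "real^'n \<Rightarrow> real^'n^'n" where
  "core_grad x = (- \<tau>) *\<^sub>R outer a b + (\<epsilon> * \<tau>) *\<^sub>R outer b (\<rho> x *\<^sub>R a + (a \<bullet> x) *\<^sub>R \<rho>_grad x)"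
definition cap_grad :: "real \<Rightarrow> real^'n \<Rightarrow> real^'n^'n" where
  "cap_grad \<sigma> x = \<tau> *\<^sub>R outer a (b - \<sigma> *\<^sub>R \<rho>_grad x) +
     (2 * \<epsilon> * \<tau>) *\<^sub>R outer b ((\<rho> x - \<sigma> * (b \<bullet> x)) *\<^sub>R a + (a \<bullet> x) *\<^sub>R (\<rho>_grad x - \<sigma> *\<^sub>R b))"

lemma open_core: "open core" and open_cap: "open (cap \<sigma>)"
  unfolding core_def cap_def
  by (intro open_Collect_less open_Collect_conj continuous_intros continuous_\<rho>; simp)+

lemma field_core: "field x = (- \<tau> * (b \<bullet> x)) *\<^sub>R a + (\<epsilon> * \<tau> * ((a \<bullet> x) * \<rho> x)) *\<^sub>R b" if "x \<in> core"
proof -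
  have x: "\<bar>b \<bullet> x\<bar> < \<rho> x / 2" using that by (simp add: core_def)
  then have "x \<in> lens" by (simp add: lens_def) 
  moreover have "saw x = - (b \<bullet> x)" "hat x = \<rho> x / 2" using x unfolding saw_def hat_def by linarith+
  ultimately show ?thesis by (simp add: field_def profile_def)
qed

lemma field_cap:
  assumes "x \<in> cap \<sigma>" and \<sigma>: "\<sigma> = 1 \<or> \<sigma> = -1"
  shows "field x = (\<tau> * (b \<bullet> x - \<sigma> * \<rho> x)) *\<^sub>R a + (2 * \<epsilon> * \<tau> * ((a \<bullet> x) * (\<rho> x - \<sigma> * (b \<bullet> x)))) *\<^sub>R b"
proof -
  have x: "\<rho> x / 2 < \<sigma> * (b \<bullet> x)" "\<sigma> * (b \<bullet> x) < \<rho> x" using assms by (auto simp: cap_def)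
  then have "x \<in> lens" "saw x = b \<bullet> x - \<sigma> * \<rho> x" "hat x = \<rho> x - \<sigma> * (b \<bullet> x)"
    using \<sigma> by (auto simp: lens_def saw_def hat_def)
  then show ?thesis by (simp add: field_def profile_def)
qed

lemma core_derivative: "(field has_derivative (*v) (core_grad x)) (at x)" if "x \<in> core"
proof -
  have "((\<lambda>x. (- \<tau> * (b \<bullet> x)) *\<^sub>R a + (\<epsilon> * \<tau> * ((a \<bullet> x) * \<rho> x)) *\<^sub>R b) has_derivative (*v) (core_grad x)) (at x)"
    by (auto intro!: derivative_eq_intros \<rho>_has_derivative simp: core_grad_def matrix_vector_mult_add_rdistrib
        outer_mult_vec algebra_simps inner_add_left simp flip: scaleR_matrix_vector_assoc)
  then show ?thesis
    by (rule has_derivative_transform_within_open[OF _ open_core that]) (simp add: field_core)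
qed

lemma cap_derivative:
  assumes "x \<in> cap \<sigma>" and \<sigma>: "\<sigma> = 1 \<or> \<sigma> = -1"
  shows "(field has_derivative (*v) (cap_grad \<sigma> x)) (at x)"
proof -
  have "((\<lambda>x. (\<tau> * (b \<bullet> x - \<sigma> * \<rho> x)) *\<^sub>R a + (2 * \<epsilon> * \<tau> * ((a \<bullet> x) * (\<rho> x - \<sigma> * (b \<bullet> x)))) *\<^sub>R b)
      has_derivative (*v) (cap_grad \<sigma> x)) (at x)"
    by (auto intro!: derivative_eq_intros \<rho>_has_derivative simp: cap_grad_def matrix_vector_mult_add_rdistrib
        outer_mult_vec algebra_simps inner_add_left inner_diff_left simp flip: scaleR_matrix_vector_assoc)
  then show ?thesis
    by (rule has_derivative_transform_within_open[OF _ open_cap assms(1)]) (simp add: field_cap \<sigma>)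
qed

lemma trace_core_grad: "trace (core_grad x) = 0"
  by (simp add: core_grad_def trace_add trace_sub trace_scaleR trace_outer ab ba inner_add_right \<rho>_grad_inner)

lemma trace_cap_grad: "trace (cap_grad \<sigma> x) = 0" if "\<sigma> = 1 \<or> \<sigma> = -1"
  using that by (auto simp: cap_grad_def trace_add trace_scaleR trace_outer ab ba bb inner_add_right
      inner_diff_right \<rho>_grad_inner algebra_simps)

lemmas isCont_outer = bounded_bilinear.isCont[OF bounded_bilinear_outer]

lemma isCont_core_grad: "isCont core_grad x" and isCont_cap_grad: "isCont (cap_grad \<sigma>) x"
  unfolding core_grad_def[abs_def] cap_grad_def[abs_def]
  by (intro continuous_intros isCont_outer isCont_\<rho> isCont_\<rho>_grad)+

lemma core_grad_near: "norm (core_grad x + \<tau> *\<^sub>R outer a b) \<le> 6 * \<epsilon> * \<tau>" if "x \<in> core"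
proof -
  have x: "\<bar>b \<bullet> x\<bar> \<le> \<rho> x" using that by (simp add: core_def)
  note B = lens_bounds[OF x] \<rho>_grad_bound[OF x]
  have "norm (\<rho> x *\<^sub>R a + (a \<bullet> x) *\<^sub>R \<rho>_grad x) \<le> \<bar>\<rho> x\<bar> * norm a + \<bar>a \<bullet> x\<bar> * norm (\<rho>_grad x)"
    by (metis norm_scaleR norm_triangle_ineq)
  also have "\<dots> \<le> \<epsilon> * 1 + 1 * (2 * \<epsilon>)" using B a1 \<epsilon> by (intro add_mono mult_mono) auto
  also have "\<dots> \<le> 6" using \<epsilon> by simp
  finally have "\<epsilon> * \<tau> * norm (\<rho> x *\<^sub>R a + (a \<bullet> x) *\<^sub>R \<rho>_grad x) \<le> \<epsilon> * \<tau> * 6"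
    using \<epsilon> \<tau> by (intro mult_left_mono) auto
  then show ?thesis using \<epsilon> \<tau> b1 by (simp add: core_grad_def norm_outer mult_ac)
qed

lemma cap_grad_near:
  assumes "x \<in> cap \<sigma>" and \<sigma>: "\<sigma> = 1 \<or> \<sigma> = -1"
  shows "norm (cap_grad \<sigma> x - \<tau> *\<^sub>R outer a b) \<le> 6 * \<epsilon> * \<tau>"
proof -
  have x: "\<bar>b \<bullet> x\<bar> \<le> \<rho> x" using assms by (auto simp: cap_def)
  note B = lens_bounds[OF x] \<rho>_grad_bound[OF x]
  have s: "\<bar>\<sigma>\<bar> = 1" using \<sigma> by auto
  have h: "\<bar>\<rho> x - \<sigma> * (b \<bullet> x)\<bar> \<le> \<epsilon>" using assms B(1,2) unfolding cap_def by auto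
  have "norm ((\<rho> x - \<sigma> * (b \<bullet> x)) *\<^sub>R a + (a \<bullet> x) *\<^sub>R (\<rho>_grad x - \<sigma> *\<^sub>R b))
      \<le> \<bar>\<rho> x - \<sigma> * (b \<bullet> x)\<bar> * norm a + \<bar>a \<bullet> x\<bar> * norm (\<rho>_grad x - \<sigma> *\<^sub>R b)"
    by (metis norm_scaleR norm_triangle_ineq)
  also have "\<dots> \<le> \<epsilon> * 1 + 1 * (2 * \<epsilon> + 1)"
  proof (intro add_mono mult_mono)
    show "norm (\<rho>_grad x - \<sigma> *\<^sub>R b) \<le> 2 * \<epsilon> + 1"
      using norm_triangle_ineq4[of "\<rho>_grad x" "\<sigma> *\<^sub>R b"] B(6) b1 s by simp
  qed (use B h a1 \<epsilon> in auto)
  also have "\<dots> \<le> 2" using \<epsilon> by simp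
  finally have 1: "norm ((\<rho> x - \<sigma> * (b \<bullet> x)) *\<^sub>R a + (a \<bullet> x) *\<^sub>R (\<rho>_grad x - \<sigma> *\<^sub>R b)) \<le> 2" .
  have "cap_grad \<sigma> x - \<tau> *\<^sub>R outer a b = \<tau> *\<^sub>R outer a (- (\<sigma> *\<^sub>R \<rho>_grad x)) +
     (2 * \<epsilon> * \<tau>) *\<^sub>R outer b ((\<rho> x - \<sigma> * (b \<bullet> x)) *\<^sub>R a + (a \<bullet> x) *\<^sub>R (\<rho>_grad x - \<sigma> *\<^sub>R b))" (is "_ = ?A + ?B")
    by (simp add: cap_grad_def outer_simps algebra_simps)
  \<comment> \<open>\<open>?A\<close> comes from the slope of \<open>\<rho>\<close>, \<open>?B\<close> from the component along \<open>b\<close> that restores the divergence\<close>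
  moreover have "norm ?A \<le> \<tau> * (2 * \<epsilon>)"
    using B(6) \<tau> a1 s by (simp add: norm_outer mult_left_mono)
  moreover have "norm ?B \<le> (2 * \<epsilon> * \<tau>) * 2"
    using 1 \<tau> \<epsilon> b1 by (simp add: norm_outer mult_left_mono)
  moreover have "norm (?A + ?B) \<le> norm ?A + norm ?B" by (rule norm_triangle_ineq)
  moreover have "\<tau> * (2 * \<epsilon>) + (2 * \<epsilon> * \<tau>) * 2 = 6 * \<epsilon> * \<tau>" by simp
  ultimately show ?thesis by (smt (verit))
qed

definition grad :: "real^'n \<Rightarrow> real^'n^'n" where
  "grad x = (if x \<in> core then core_grad x else cap_grad (sgn (b \<bullet> x)) x)"

definition smooth_part :: "(real^'n) set" where "smooth_part = core \<union> cap 1 \<union> cap (-1)"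

lemma cap_disjoint: "x \<in> cap \<sigma> \<Longrightarrow> \<sigma> = 1 \<or> \<sigma> = -1 \<Longrightarrow> x \<notin> core \<and> sgn (b \<bullet> x) = \<sigma>"
  by (auto simp: cap_def core_def sgn_if)

lemma grad_properties:
  assumes x: "x \<in> smooth_part"
  shows "(field has_derivative (*v) (grad x)) (at x)" "isCont grad x" "trace (grad x) = 0"
    "norm (grad x - \<tau> *\<^sub>R outer a b) \<le> 6 * \<epsilon> * \<tau> \<or> norm (grad x + \<tau> *\<^sub>R outer a b) \<le> 6 * \<epsilon> * \<tau>"
proof -
  consider (core) "x \<in> core" | (cap) \<sigma> where "x \<in> cap \<sigma>" "\<sigma> = 1 \<or> \<sigma> = -1"
    using x unfolding smooth_part_def by blast
  then have "(field has_derivative (*v) (grad x)) (at x) \<and> isCont grad x \<and> trace (grad x) = 0 \<and>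
    (norm (grad x - \<tau> *\<^sub>R outer a b) \<le> 6 * \<epsilon> * \<tau> \<or> norm (grad x + \<tau> *\<^sub>R outer a b) \<le> 6 * \<epsilon> * \<tau>)"
  proof cases
    case core
    have eq: "grad y = core_grad y" if "y \<in> core" for y using that by (simp add: grad_def)
    have "isCont grad x"
      using isCont_core_grad open_core core eq
      by (metis continuous_on_cong continuous_on_eq_continuous_at continuous_at_imp_continuous_on)
    then show ?thesis
      using eq[OF core] core_derivative[OF core] trace_core_grad core_grad_near[OF core] by simp
  next
    case cap
    have eq: "grad y = cap_grad \<sigma> y" if "y \<in> cap \<sigma>" for y
      using cap_disjoint[OF that cap(2)] by (simp add: grad_def)
    have "isCont grad x"
      using isCont_cap_grad open_cap cap(1) eq
      by (metis continuous_on_cong continuous_on_eq_continuous_at continuous_at_imp_continuous_on)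
    then show ?thesis
      using eq[OF cap(1)] cap_derivative[OF cap] trace_cap_grad[OF cap(2)] cap_grad_near[OF cap] by simp
  qed
  then show "(field has_derivative (*v) (grad x)) (at x)" "isCont grad x" "trace (grad x) = 0"
    "norm (grad x - \<tau> *\<^sub>R outer a b) \<le> 6 * \<epsilon> * \<tau> \<or> norm (grad x + \<tau> *\<^sub>R outer a b) \<le> 6 * \<epsilon> * \<tau>"
    by blast+
qed

lemma smooth_part_lens: "smooth_part \<subseteq> lens"
  by (auto simp: smooth_part_def lens_def core_def cap_def)

lemma negligible_rough_part: "negligible (lens - smooth_part)"
proof (rule negligible_subset[OF negligible_graph[of "1/2"]])
  show "lens - smooth_part \<subseteq> {x. \<bar>b \<bullet> x\<bar> = 1 / 2 * \<rho> x}"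
    by (auto simp: smooth_part_def lens_def core_def cap_def abs_if split: if_splits)
qed simp

lemma open_smooth_part: "open smooth_part"
  unfolding smooth_part_def by (intro open_Un open_core open_cap)

lemma bounded_lens: "bounded lens"
proof (rule boundedI)
  show "norm x \<le> 2" if "x \<in> lens" for x using that lens_bounds(5)[of x] by (simp add: lens_def)
qed

end

text \<open>
  The gradient of the block stays near the two values almost everywhere, including the neighbourhood of
  the boundary. A cutoff in a transition layer would instead leave points where the gradient has not
  improved, and repeated corrections there could not be bounded.
\<close>

lemma oscillating_block:
  fixes a b :: "real^'n"
  assumes "norm a = 1" "norm b = 1" "a \<bullet> b = 0" "0 < \<tau>" "0 < \<eta>"
  obtains Q Q' v W where "open Q" "bounded Q" "Q \<noteq> {}" "negligible (frontier Q)"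
    "open Q'" "Q' \<subseteq> Q" "negligible (Q - Q')"
    "(3 * \<tau>)-lipschitz_on UNIV v" "\<And>x. x \<notin> Q \<Longrightarrow> v x = 0"
    "\<And>x. x \<in> Q' \<Longrightarrow> (v has_derivative (*v) (W x)) (at x)" "\<And>x. x \<in> Q' \<Longrightarrow> isCont W x"
    "\<And>x. x \<in> Q' \<Longrightarrow> trace (W x) = 0"
    "\<And>x. x \<in> Q' \<Longrightarrow> norm (W x - \<tau> *\<^sub>R outer a b) < \<eta> \<or> norm (W x + \<tau> *\<^sub>R outer a b) < \<eta>"
proof -
  \<comment> \<open>the gradients of the block deviate from the two values by at most \<open>6 \<epsilon> \<tau>\<close>\<close>
  define \<epsilon> where "\<epsilon> = min (1/4) (\<eta> / (7 * \<tau>))"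
  interpret lens_block a b \<tau> \<epsilon>
    using assms by unfold_locales (auto simp: \<epsilon>_def)
  have "6 * \<epsilon> * \<tau> < 7 * \<epsilon> * \<tau>" using \<epsilon> \<tau> by simp
  also have "\<dots> \<le> \<eta>" using \<tau> by (simp add: \<epsilon>_def min_def field_simps)
  finally have \<eta>: "6 * \<epsilon> * \<tau> < \<eta>" .
  show ?thesis
  proof (rule that[of lens smooth_part field grad])
    show "norm (grad x - \<tau> *\<^sub>R outer a b) < \<eta> \<or> norm (grad x + \<tau> *\<^sub>R outer a b) < \<eta>"
      if "x \<in> smooth_part" for x using grad_properties(4)[OF that] \<eta> by linarith
  qed (use open_lens bounded_lens zero_in_lens negligible_frontier_lens open_smooth_part smooth_part_lens
       negligible_rough_part field_lipschitz grad_properties in \<open>auto simp: field_def\<close>)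
qed

section \<open>Filling open sets by small copies\<close>

lemma closure_affinity:
  fixes S :: "'a::real_normed_vector set"
  shows "closure ((\<lambda>x. z + s *\<^sub>R x) ` S) = (\<lambda>x. z + s *\<^sub>R x) ` closure S"
proof -
  have "(\<lambda>x. z + s *\<^sub>R x) ` T = (+) z ` ((*\<^sub>R) s ` T)" for T by (simp add: image_image)
  then show ?thesis by (simp add: closure_translation closure_scaleR)
qed

lemma negligible_affinity:
  fixes S :: "'a::euclidean_space set"
  assumes "negligible S"
  shows "negligible ((\<lambda>x. z + s *\<^sub>R x) ` S)"
  by (rule negligible_differentiable_image_negligible[OF _ assms]) (auto intro!: derivative_intros)

lemma measure_affinity:
  fixes S :: "'a::euclidean_space set"
  shows "measure lebesgue ((\<lambda>x. z + s *\<^sub>R x) ` S) = \<bar>s\<bar> ^ DIM('a) * measure lebesgue S"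
  using measure_lebesgue_affine[of s z S] by (simp add: add.commute)

abbreviation copy :: "'a::real_normed_vector set \<Rightarrow> 'a \<times> real \<Rightarrow> 'a set" where
  "copy Q i \<equiv> (\<lambda>x. fst i + snd i *\<^sub>R x) ` Q"

text \<open>
  A copy of \<open>Q\<close> centred in a ball, of size proportional to that of the ball, occupies a fraction of it
  that depends on \<open>Q\<close> only. By Vitali's covering theorem finitely many disjoint small balls fill at
  least half of \<open>B\<close>. Finiteness and the use of closed copies keep the remainder open.
\<close>

lemma pack_fixed_fraction:
  fixes Q :: "'a::euclidean_space set"
  assumes Q: "open Q" "bounded Q" "Q \<noteq> {}"
  shows "\<exists>\<kappa>>0. \<kappa> \<le> 1 \<and> (\<forall>B \<delta>. open B \<longrightarrow> bounded B \<longrightarrow> 0 < \<delta> \<longrightarrow>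
     (\<exists>I. finite I \<and> (\<forall>i\<in>I. 0 < snd i \<and> snd i < \<delta> \<and> copy (closure Q) i \<subseteq> B) \<and>
       pairwise (\<lambda>i j. disjnt (copy (closure Q) i) (copy (closure Q) j)) I \<and>
       measure lebesgue (B - \<Union>(copy (closure Q) ` I)) \<le> (1 - \<kappa>) * measure lebesgue B))"
proof -
  let ?m = "measure (lebesgue :: 'a measure)"
  let ?n = "DIM('a)"
  obtain R where R: "R > 0" "closure Q \<subseteq> ball 0 R"
    using bounded_subset_ballD[of "closure Q" 0] Q by auto
  have cl: "closure Q \<in> lmeasurable" using Q by (simp add: compact_imp_bounded lmeasurable_compact)
  have "0 < ?m Q"
    using Q open_not_negligible[of Q] negligible_iff_measure[of Q] lmeasurable_open[of Q]
    by (metis measure_nonneg order_le_less)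
  also have "?m Q \<le> ?m (closure Q)"
    using Q cl closure_subset by (intro measure_mono_fmeasurable) auto
  finally have pos: "0 < ?m (closure Q)" .
  define b1 where "b1 = ?m (ball 0 1)"
  have b1: "b1 > 0" by (simp add: b1_def)
  \<comment> \<open>the fraction of a ball filled by the copy in it, halved because only half of \<open>B\<close> is covered by the
    chosen balls\<close>
  define \<kappa> where "\<kappa> = ?m (closure Q) / (R ^ ?n * b1) / 2"
  have \<kappa>: "\<kappa> > 0" using pos R b1 by (simp add: \<kappa>_def)
  have frac: "?m (copy (closure Q) (x, r / R)) = 2 * \<kappa> * ?m (ball x r)" if "r > 0" for x r
    using that R(1) b1 content_ball_conv_unit_ball[of r x]
    by (simp add: measure_affinity \<kappa>_def b1_def power_divide)
  have inball: "copy (closure Q) (x, r / R) \<subseteq> ball x r" if "r > 0" for x r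
  proof
    fix y assume "y \<in> copy (closure Q) (x, r / R)"
    then obtain q where q: "q \<in> closure Q" "y = x + (r / R) *\<^sub>R q" by auto
    then have "norm q < R" using R by auto
    then have "r / R * norm q < r / R * R" using that R by (intro mult_strict_left_mono) auto
    then show "y \<in> ball x r" using q(2) that R by (simp add: dist_norm)
  qed
  have main: "\<exists>I. finite I \<and> (\<forall>i\<in>I. 0 < snd i \<and> snd i < \<delta> \<and> copy (closure Q) i \<subseteq> B) \<and>
       pairwise (\<lambda>i j. disjnt (copy (closure Q) i) (copy (closure Q) j)) I \<and>
       ?m (B - \<Union>(copy (closure Q) ` I)) \<le> (1 - \<kappa>) * ?m B"
    if B: "open B" "bounded B" and \<delta>: "0 < \<delta>" for B \<delta>
  proof (cases "B = {}")
    case True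
    then show ?thesis by (intro exI[of _ "{}"]) simp
  next
    case False
    have Bm: "B \<in> lmeasurable" using B by (rule lmeasurable_open[rotated])
    have mB: "?m B > 0"
      using B False open_not_negligible[of B] negligible_iff_measure[of B] Bm
      by (metis measure_nonneg order_le_less)
    define K where "K = {i :: 'a \<times> real. 0 < snd i \<and> snd i < \<delta> * R \<and> ball (fst i) (snd i) \<subseteq> B}"
    have "\<exists>i. i \<in> K \<and> x \<in> ball (fst i) (snd i) \<and> snd i < d" if "x \<in> B" "0 < d" for x d
    proof -
      obtain k where k: "k > 0" "ball x k \<subseteq> B" using B \<open>x \<in> B\<close> openE by blast
      define r where "r = min k (min d (\<delta> * R)) / 2"
      have "\<delta> * R > 0" using \<delta> R by simp
      then have "r > 0" "r < k" "r < d" "r < \<delta> * R" using k \<open>0 < d\<close> by (auto simp: r_def)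
      then have "(x, r) \<in> K" using k by (auto simp: K_def)
      then show ?thesis using \<open>r > 0\<close> \<open>r < d\<close> by (intro exI[of _ "(x, r)"]) simp
    qed
    note ball_at = this
    obtain C where C: "countable C" "C \<subseteq> K"
      "pairwise (\<lambda>i j. disjnt (ball (fst i) (snd i)) (ball (fst j) (snd j))) C"
      "negligible (B - (\<Union>i\<in>C. ball (fst i) (snd i)))"
      by (rule Vitali_covering_theorem_balls[of B K fst snd, OF ball_at]) (assumption, assumption, rule that)
    let ?b = "\<lambda>i. ball (fst i :: 'a) (snd i)"
    have bB: "?b i \<subseteq> B" "snd i > 0" "snd i < \<delta> * R" if "i \<in> C" for i
    proof -
      have "i \<in> K" using that C(2) by blast
      then show "?b i \<subseteq> B" "snd i > 0" "snd i < \<delta> * R" by (simp_all add: K_def)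
    qed
    have "\<exists>F\<subseteq>C. finite F \<and> ?m B / 2 \<le> ?m (\<Union>i\<in>F. ?b i)"
    proof (rule ccontr)
      assume contra: "\<not> ?thesis"
      have le: "?m (\<Union>i\<in>F. ?b i) \<le> ?m B / 2" if "F \<subseteq> C" "finite F" for F
        using contra that by force
      have Um: "(\<Union>i\<in>C. ?b i) \<in> lmeasurable"
        using fmeasurable_UN_bound[OF C(1), of ?b lebesgue "?m B / 2"] le by auto
      have "?m (\<Union>i\<in>C. ?b i) \<le> ?m B / 2"
        using measure_UN_bound[OF C(1), of ?b lebesgue "?m B / 2"] le by auto
      moreover have "?m B = ?m (\<Union>i\<in>C. ?b i)"
      proof (rule measure_negligible_symdiff[OF Um])
        have "(\<Union>i\<in>C. ?b i) - B = {}" using bB by blast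
        then show "negligible ((\<Union>i\<in>C. ?b i) - B \<union> (B - (\<Union>i\<in>C. ?b i)))"
          using C(4) by (metis Un_empty_left)
      qed
      ultimately show False using mB by simp
    qed
    then obtain F where F: "F \<subseteq> C" "finite F" "?m B / 2 \<le> ?m (\<Union>i\<in>F. ?b i)" by blast
    define g where "g = (\<lambda>i :: 'a \<times> real. (fst i, snd i / R))"
    have gsub: "copy (closure Q) (g i) \<subseteq> ?b i" if "i \<in> F" for i
      using that F(1) bB(2)[of i] inball[of "snd i" "fst i"] by (auto simp: g_def)
    have dis: "disjnt (?b i) (?b j)" if "i \<in> F" "j \<in> F" "i \<noteq> j" for i j
      using C(3) F that by (auto simp: pairwise_def)
    have gdis: "disjnt (copy (closure Q) (g i)) (copy (closure Q) (g j))" if "i \<in> F" "j \<in> F" "i \<noteq> j" for i j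
      using dis[OF that] gsub that by (meson disjnt_subset1 disjnt_subset2)
    have gm: "copy (closure Q) (g i) \<in> lmeasurable" for i
      by (intro lmeasurable_compact compact_continuous_image continuous_intros) (use Q in auto)
    let ?U = "\<Union>i\<in>F. copy (closure Q) (g i)"
    have Usub: "?U \<subseteq> B" using gsub F bB by blast
    have "?m ?U = (\<Sum>i\<in>F. ?m (copy (closure Q) (g i)))"
      using gdis gm F by (intro measure_UNION') (auto simp: pairwise_def)
    also have "\<dots> = (\<Sum>i\<in>F. 2 * \<kappa> * ?m (?b i))"
      using F bB frac by (intro sum.cong) (auto simp: g_def)
    also have "\<dots> = 2 * \<kappa> * ?m (\<Union>i\<in>F. ?b i)"
      using dis F by (subst measure_UNION') (auto simp: pairwise_def sum_distrib_left)
    also have "\<dots> \<ge> 2 * \<kappa> * (?m B / 2)"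
      using F \<kappa> by (intro mult_left_mono) auto
    finally have "?m ?U \<ge> \<kappa> * ?m B" by simp
    moreover have "?m (B - ?U) = ?m B - ?m ?U"
      using Bm gm F Usub by (intro measurable_measure_Diff) (auto intro!: fmeasurable.finite_UN)
    ultimately have "?m (B - \<Union>(copy (closure Q) ` g ` F)) \<le> (1 - \<kappa>) * ?m B"
      by (simp add: image_image algebra_simps)
    moreover have "pairwise (\<lambda>i j. disjnt (copy (closure Q) i) (copy (closure Q) j)) (g ` F)"
      using gdis by (auto simp: pairwise_def)
    moreover have "0 < snd i \<and> snd i < \<delta> \<and> copy (closure Q) i \<subseteq> B" if iF: "i \<in> g ` F" for i
    proof -
      obtain j where j: "j \<in> F" "i = g j" using iF by blast
      then have "0 < snd j" "snd j < \<delta> * R" using F(1) bB(2,3)[of j] by auto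
      then show ?thesis using j gsub[of j] F bB(1)[of j] R(1) by (auto simp: g_def field_simps)
    qed
    ultimately show ?thesis using F(2) by (intro exI[of _ "g ` F"]) auto
  qed
  show ?thesis
  proof (intro exI[of _ "min \<kappa> 1"] conjI allI impI)
    fix B :: "'a set" and \<delta> :: real assume "open B" "bounded B" "0 < \<delta>"
    moreover have "(1 - \<kappa>) * ?m B \<le> (1 - min \<kappa> 1) * ?m B" by (intro mult_right_mono) auto
    ultimately show "\<exists>I. finite I \<and> (\<forall>i\<in>I. 0 < snd i \<and> snd i < \<delta> \<and> copy (closure Q) i \<subseteq> B) \<and>
       pairwise (\<lambda>i j. disjnt (copy (closure Q) i) (copy (closure Q) j)) I \<and>
       ?m (B - \<Union>(copy (closure Q) ` I)) \<le> (1 - min \<kappa> 1) * ?m B"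
      using main[of B \<delta>] by (meson order_trans)
  qed (use \<kappa> in auto)
qed

text \<open>
  Packing a fixed fraction of the remainder again and again, the measure of the remainder decays
  geometrically. What is left are boundaries of copies and a null set.
\<close>

lemma fill_by_copies:
  fixes Q B :: "'a::euclidean_space set"
  assumes Q: "open Q" "bounded Q" "Q \<noteq> {}" "negligible (frontier Q)"
    and B: "open B" "bounded B" and \<delta>: "0 < \<delta>"
  obtains I where "countable I" "\<And>i. i \<in> I \<Longrightarrow> 0 < snd i \<and> snd i < \<delta> \<and> copy Q i \<subseteq> B"
    "disjoint_family_on (copy Q) I" "negligible (B - \<Union>(copy Q ` I))"
proof -
  let ?m = "measure (lebesgue :: 'a measure)"
  let ?cl = "\<lambda>i. copy (closure Q) i"
  define good where "good = (\<lambda>B I. finite I \<and> (\<forall>i\<in>I. 0 < snd i \<and> snd i < \<delta> \<and> ?cl i \<subseteq> B) \<and>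
       pairwise (\<lambda>i j. disjnt (?cl i) (?cl j)) I)"
  from pack_fixed_fraction[OF Q(1-3)] obtain \<kappa> where \<kappa>: "0 < \<kappa>" "\<kappa> \<le> 1"
    and pack: "\<forall>B \<delta>. open B \<longrightarrow> bounded B \<longrightarrow> 0 < \<delta> \<longrightarrow>
     (\<exists>I. finite I \<and> (\<forall>i\<in>I. 0 < snd i \<and> snd i < \<delta> \<and> ?cl i \<subseteq> B) \<and>
       pairwise (\<lambda>i j. disjnt (?cl i) (?cl j)) I \<and>
       ?m (B - \<Union>(?cl ` I)) \<le> (1 - \<kappa>) * ?m B)"
    by (elim exE conjE) (rule that)
  have "\<forall>B. \<exists>I. open B \<longrightarrow> bounded B \<longrightarrow> good B I \<and> ?m (B - \<Union>(?cl ` I)) \<le> (1 - \<kappa>) * ?m B"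
  proof
    fix B
    show "\<exists>I. open B \<longrightarrow> bounded B \<longrightarrow> good B I \<and> ?m (B - \<Union>(?cl ` I)) \<le> (1 - \<kappa>) * ?m B"
    proof (cases "open B \<and> bounded B")
      case True
      note pack[THEN spec, THEN spec, THEN mp, THEN mp, THEN mp, OF conjunct1[OF True] conjunct2[OF True] \<delta>]
      then obtain I where I: "finite I" "\<forall>i\<in>I. 0 < snd i \<and> snd i < \<delta> \<and> ?cl i \<subseteq> B"
        "pairwise (\<lambda>i j. disjnt (?cl i) (?cl j)) I" "?m (B - \<Union>(?cl ` I)) \<le> (1 - \<kappa>) * ?m B"
        by (elim exE conjE) (rule that)
      show ?thesis unfolding good_def by (intro exI[of _ I] impI conjI I)
    qed blast
  qed
  from choice[OF this] obtain f where f': "\<forall>B. open B \<longrightarrow> bounded B \<longrightarrow>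
     good B (f B) \<and> ?m (B - \<Union>(?cl ` f B)) \<le> (1 - \<kappa>) * ?m B" ..
  have f: "good B (f B)" "?m (B - \<Union>(?cl ` f B)) \<le> (1 - \<kappa>) * ?m B" if "open B" "bounded B" for B
    by (rule conjunct1[OF f'[rule_format, OF that]], rule conjunct2[OF f'[rule_format, OF that]])
  define Bs where "Bs = rec_nat B (\<lambda>_ A. A - \<Union>(?cl ` f A))"
  have Bs0: "Bs 0 = B" and BsS: "Bs (Suc n) = Bs n - \<Union>(?cl ` f (Bs n))" for n
    by (simp_all add: Bs_def)
  have closed_copy: "closed (?cl i)" for i
    using closure_affinity[of "fst i" "snd i" Q] by (metis closed_closure)
  have ob: "open (Bs n) \<and> bounded (Bs n)" for n
  proof (induction n)
    case (Suc n)
    then have "finite (f (Bs n))" using f(1) by (simp add: good_def)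
    then have "closed (\<Union>(?cl ` f (Bs n)))" using closed_copy by (intro closed_Union) auto
    then show ?case using Suc by (auto simp: BsS intro: bounded_diff)
  qed (use B in \<open>simp add: Bs0\<close>)
  have good: "good (Bs n) (f (Bs n))" for n using f(1) ob by blast
  have anti: "Bs n \<subseteq> Bs m" if "m \<le> n" for m n
    using that by (induction n rule: dec_induct) (auto simp: BsS)
  have meas: "?m (Bs n) \<le> (1 - \<kappa>) ^ n * ?m B" for n
  proof (induction n)
    case (Suc n)
    have "?m (Bs (Suc n)) \<le> (1 - \<kappa>) * ?m (Bs n)" using f(2) ob by (simp add: BsS)
    also have "\<dots> \<le> (1 - \<kappa>) * ((1 - \<kappa>) ^ n * ?m B)"
      using Suc \<kappa> by (intro mult_left_mono) auto
    finally show ?case by (simp add: mult.assoc)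
  qed (simp add: Bs0)
  have "(\<lambda>n. (1 - \<kappa>) ^ n * ?m B) \<longlonglongrightarrow> 0 * ?m B"
    using \<kappa> by (intro tendsto_intros LIMSEQ_power_zero) auto
  then have lim: "(\<lambda>n. (1 - \<kappa>) ^ n * ?m B) \<longlonglongrightarrow> 0" by simp
  have null: "negligible (\<Inter>n. Bs n)"
    unfolding negligible_outer_le
  proof (intro allI impI)
    fix e :: real assume "e > 0"
    then have "eventually (\<lambda>n. (1 - \<kappa>) ^ n * ?m B < e) sequentially"
      using lim by (simp add: order_tendstoD)
    then obtain n where "(1 - \<kappa>) ^ n * ?m B < e" by (meson eventually_happens sequentially_bot)
    then have "?m (Bs n) \<le> e" using meas[of n] by linarith
    moreover have "Bs n \<in> lmeasurable" using ob by (intro lmeasurable_open) auto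
    ultimately show "\<exists>T. (\<Inter>n. Bs n) \<subseteq> T \<and> T \<in> lmeasurable \<and> ?m T \<le> e" by blast
  qed
  define I where "I = (\<Union>n. f (Bs n))"
  have disj: "copy Q i \<inter> copy Q j = {}" if "i \<in> f (Bs m)" "j \<in> f (Bs n)" "i \<noteq> j" "m \<le> n" for i j m n
  proof -
    have "?cl i \<inter> ?cl j = {}"
    proof (cases "m = n")
      case True
      then show ?thesis using good[of n] that by (auto simp: good_def pairwise_def disjnt_def)
    next
      case False
      then have "?cl j \<subseteq> Bs (Suc m)" using good[of n] that anti[of "Suc m" n] by (auto simp: good_def)
      then show ?thesis using that(1) by (auto simp: BsS)
    qed
    moreover have "copy Q i \<subseteq> ?cl i" "copy Q j \<subseteq> ?cl j" by (intro image_mono closure_subset)+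
    ultimately show ?thesis by blast
  qed
  show ?thesis
  proof (rule that[of I])
    have "countable (f (Bs n))" for n
      using good[of n] by (auto simp: good_def intro: countable_finite)
    then show cI: "countable I" unfolding I_def by blast
    show "0 < snd i \<and> snd i < \<delta> \<and> copy Q i \<subseteq> B" if iI: "i \<in> I" for i
    proof -
      obtain n where "i \<in> f (Bs n)" using iI by (auto simp: I_def)
      then have "0 < snd i" "snd i < \<delta>" "?cl i \<subseteq> Bs n" using good[of n] by (auto simp: good_def)
      moreover have "Bs n \<subseteq> B" using anti[of 0 n] Bs0 by simp
      moreover have "copy Q i \<subseteq> ?cl i" by (intro image_mono closure_subset)
      ultimately show ?thesis by blast
    qed
    show "disjoint_family_on (copy Q) I"
      unfolding disjoint_family_on_def
    proof (intro ballI impI)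
      fix i j assume "i \<in> I" "j \<in> I" "i \<noteq> j"
      then obtain m n where "i \<in> f (Bs m)" "j \<in> f (Bs n)" by (auto simp: I_def)
      then show "copy Q i \<inter> copy Q j = {}"
        using disj[of i m j n] disj[of j n i m] \<open>i \<noteq> j\<close> by (cases "m \<le> n") auto
    qed
    have "B - \<Union>(copy Q ` I) \<subseteq> (\<Inter>n. Bs n) \<union> (\<Union>i\<in>I. copy (frontier Q) i)"
    proof
      fix x assume x: "x \<in> B - \<Union>(copy Q ` I)"
      show "x \<in> (\<Inter>n. Bs n) \<union> (\<Union>i\<in>I. copy (frontier Q) i)"
      proof (rule ccontr)
        assume c: "\<not> ?thesis"
        have "x \<in> Bs n" for n
        proof (induction n)
          case (Suc n)
          have "x \<notin> ?cl i" if "i \<in> f (Bs n)" for i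
          proof -
            have "i \<in> I" using that by (auto simp: I_def)
            moreover have "closure Q \<subseteq> Q \<union> frontier Q"
              by (simp add: closure_Un_frontier)
            ultimately show ?thesis using x c by blast
          qed
          then show ?case using Suc by (auto simp: BsS)
        qed (use x Bs0 in simp)
        then show False using c by blast
      qed
    qed
    moreover have "negligible (\<Union>i\<in>I. copy (frontier Q) i)"
      using cI negligible_affinity[OF Q(4)] by (intro negligible_countable_Union) auto
    ultimately show "negligible (B - \<Union>(copy Q ` I))"
      using null negligible_Un negligible_subset by meson
  qed
qed

section \<open>One step of the iteration\<close>

text \<open>
  For points served by different indices the difference splits into two differences, one for each of the
  two functions; this costs the factor \<open>2\<close>.
\<close>

lemma lipschitz_glue_disjoint:
  fixes f :: "'i \<Rightarrow> 'a::metric_space \<Rightarrow> 'b::real_normed_vector"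
  assumes dis: "disjoint_family_on S I" and "0 \<le> L"
    and lip: "\<And>i. i \<in> I \<Longrightarrow> L-lipschitz_on UNIV (f i)"
    and zero: "\<And>i x. \<lbrakk>i \<in> I; x \<notin> S i\<rbrakk> \<Longrightarrow> f i x = 0"
  obtains p where "\<And>i x. \<lbrakk>i \<in> I; x \<in> S i\<rbrakk> \<Longrightarrow> p x = f i x" "\<And>x. x \<notin> \<Union>(S ` I) \<Longrightarrow> p x = 0"
    "(2 * L)-lipschitz_on UNIV p"
proof -
  define p where "p = (\<lambda>x. if x \<in> \<Union>(S ` I) then f (SOME i. i \<in> I \<and> x \<in> S i) x else 0)"
  have val: "p x = f i x" if "i \<in> I" "x \<in> S i" for i x
  proof -
    have "(SOME j. j \<in> I \<and> x \<in> S j) = i"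
      using that dis by (intro some_equality) (auto simp: disjoint_family_on_def)
    then show ?thesis using that by (auto simp: p_def)
  qed
  have out: "p x = 0" if "x \<notin> \<Union>(S ` I)" for x using that by (simp only: p_def if_False)
  have "dist (p x) (p y) \<le> 2 * L * dist x y" for x y
  proof -
    \<comment> \<open>one index serves at \<open>x\<close>, another one at \<open>y\<close>; each of the two functions vanishes at the other point\<close>
    have one: "norm (f i x - f i y) \<le> L * dist x y" if "i \<in> I" for i
      using lipschitz_onD[OF lip[OF that], of x y] by (simp add: dist_norm)
    have Ld: "0 \<le> L * dist x y" using \<open>0 \<le> L\<close> by simp
    have eq: "p z = f i z" if "i \<in> I" "z \<notin> \<Union>(S ` I)" for i z
      using zero[of i z] out[of z] that by auto
    consider i j where "i \<in> I" "j \<in> I" "p x = f i x" "p y = f j y" "f i y = 0" "f j x = 0"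
      | i where "i \<in> I" "p x = f i x" "p y = f i y" | "p x = 0" "p y = 0"
    proof (cases "x \<in> \<Union>(S ` I)")
      case x: True
      then obtain i where i: "i \<in> I" "x \<in> S i" by blast
      show ?thesis
      proof (cases "y \<in> \<Union>(S ` I)")
        case True
        then obtain j where j: "j \<in> I" "y \<in> S j" by blast
        show ?thesis
        proof (cases "i = j")
          case True
          then show ?thesis using that(2)[of i] i j val by simp
        next
          case False
          then have "x \<notin> S j" "y \<notin> S i" using dis i j by (auto simp: disjoint_family_on_def)
          then show ?thesis using that(1)[of i j] i j val zero by simp
        qed
      next
        case False
        then show ?thesis using that(2)[of i] i val eq by simp
      qed
    next
      case x: False
      show ?thesis
      proof (cases "y \<in> \<Union>(S ` I)")
        case True
        then obtain j where "j \<in> I" "y \<in> S j" by blast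
        then show ?thesis using that(2)[of j] val[of j y] eq[of j x] x by blast
      next
        case False
        then show ?thesis using that(3) out x by blast
      qed
    qed
    then show ?thesis
    proof cases
      case (1 i j)
      have "norm (f i x - f j y) = norm ((f i x - f i y) + (f j x - f j y))" using 1 by simp
      also have "\<dots> \<le> L * dist x y + L * dist x y"
        by (intro norm_triangle_mono one 1)
      finally show ?thesis using 1 by (simp add: dist_norm)
    next
      case (2 i)
      then show ?thesis using one[of i] Ld by (simp add: dist_norm)
    next
      case 3
      then show ?thesis using Ld by simp
    qed
  qed
  then have "(2 * L)-lipschitz_on UNIV p" using \<open>0 \<le> L\<close> by (intro lipschitz_onI) auto
  from that[OF val out this] show ?thesis .
qed

text \<open>
  A cell consists of an open set, an open subset of full measure in it, a map supported in the former, and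
  its gradient on the latter.
\<close>

type_synonym 'n cell = "(real^'n) set \<times> (real^'n) set \<times> (real^'n \<Rightarrow> real^'n) \<times> (real^'n \<Rightarrow> real^'n^'n)"

definition is_cell ::
  "(real^'n) set \<Rightarrow> (real^'n \<Rightarrow> real^'n^'n) \<Rightarrow> (real^'n^'n) set \<Rightarrow> real \<Rightarrow> real \<Rightarrow> 'n::finite cell \<Rightarrow> bool" where
  "is_cell G F M L e = (\<lambda>(S, S', f, H). open S \<and> S \<subseteq> G \<and> open S' \<and> S' \<subseteq> S \<and> negligible (S - S') \<and>
     L-lipschitz_on UNIV f \<and> (\<forall>x. x \<notin> S \<longrightarrow> f x = 0) \<and> (\<forall>x. norm (f x) \<le> e) \<and>
     (\<forall>x\<in>S'. (f has_derivative (*v) (H x)) (at x) \<and> isCont H x \<and> F x + H x \<in> M))"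

definition is_tiling ::
  "(real^'n) set \<Rightarrow> (real^'n \<Rightarrow> real^'n^'n) \<Rightarrow> (real^'n^'n) set \<Rightarrow> real \<Rightarrow> real \<Rightarrow> 'n::finite cell set \<Rightarrow> bool" where
  "is_tiling G F M L e \<C> \<longleftrightarrow> countable \<C> \<and> (\<forall>c\<in>\<C>. is_cell G F M L e c) \<and>
     disjoint_family_on fst \<C> \<and> negligible (G - \<Union>(fst ` \<C>))"

text \<open>
  The corrections are exactly divergence free, so openness is needed in the trace free matrices only.
\<close>

definition is_open_traceless :: "(real^'n^'n) set \<Rightarrow> bool" where
  "is_open_traceless M \<longleftrightarrow> (\<forall>H\<in>M. trace H = 0 \<and> (\<exists>\<eta>>0. \<forall>H'. trace H' = 0 \<and> norm (H' - H) < \<eta> \<longrightarrow> H' \<in> M))"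

definition splits_into :: "real \<Rightarrow> (real^'n^'n) set \<Rightarrow> real^'n^'n \<Rightarrow> bool" where
  "splits_into T M A \<longleftrightarrow> trace A = 0 \<and> (\<exists>a b \<tau>. norm a = 1 \<and> norm b = 1 \<and> a \<bullet> b = 0 \<and> 0 < \<tau> \<and> \<tau> \<le> T \<and>
     A + \<tau> *\<^sub>R outer a b \<in> M \<and> A - \<tau> *\<^sub>R outer a b \<in> M)"

lemma rescaled_derivative:
  fixes v :: "real^'n \<Rightarrow> real^'n"
  assumes "s \<noteq> 0" and v: "(v has_derivative (*v) A) (at ((1 / s) *\<^sub>R (y - z)))"
  shows "((\<lambda>y. s *\<^sub>R v ((1 / s) *\<^sub>R (y - z))) has_derivative (*v) A) (at y)"
proof -
  have "((\<lambda>y. (1 / s) *\<^sub>R (y - z)) has_derivative (\<lambda>h. (1 / s) *\<^sub>R h)) (at y)"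
    by (auto intro!: derivative_eq_intros)
  from has_derivative_compose[OF this v]
  have "((\<lambda>y. v ((1 / s) *\<^sub>R (y - z))) has_derivative (\<lambda>h. A *v ((1 / s) *\<^sub>R h))) (at y)" .
  then have "((\<lambda>y. s *\<^sub>R v ((1 / s) *\<^sub>R (y - z))) has_derivative (\<lambda>h. s *\<^sub>R (A *v ((1 / s) *\<^sub>R h)))) (at y)"
    by (rule has_derivative_scaleR_right)
  then show ?thesis using \<open>s \<noteq> 0\<close> by (simp add: matrix_vector_mult_scaleR)
qed

lemma rescaled_lipschitz:
  fixes v :: "'a::real_normed_vector \<Rightarrow> 'b::real_normed_vector"
  assumes "0 < s" and v: "L-lipschitz_on UNIV v"
  shows "L-lipschitz_on UNIV (\<lambda>y. s *\<^sub>R v ((1 / s) *\<^sub>R (y - z)))"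
proof (rule lipschitz_onI)
  show "0 \<le> L" using v by (rule lipschitz_on_nonneg)
  fix x y :: 'a
  have "norm (v ((1 / s) *\<^sub>R (x - z)) - v ((1 / s) *\<^sub>R (y - z))) \<le> L * norm ((1 / s) *\<^sub>R (x - z) - (1 / s) *\<^sub>R (y - z))"
    using lipschitz_on_normD[OF v] by blast
  also have "(1 / s) *\<^sub>R (x - z) - (1 / s) *\<^sub>R (y - z) = (1 / s) *\<^sub>R (x - y)" by (simp add: algebra_simps)
  finally have "s * norm (v ((1 / s) *\<^sub>R (x - z)) - v ((1 / s) *\<^sub>R (y - z))) \<le> s * (L * norm ((1 / s) *\<^sub>R (x - y)))"
    using \<open>0 < s\<close> by (intro mult_left_mono) auto
  then show "dist (s *\<^sub>R v ((1 / s) *\<^sub>R (x - z))) (s *\<^sub>R v ((1 / s) *\<^sub>R (y - z))) \<le> L * dist x y"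
    using \<open>0 < s\<close> by (simp add: dist_norm flip: scaleR_diff_right)
qed

lemma lipschitz_zero_outside_bounded:
  fixes v :: "'a::euclidean_space \<Rightarrow> 'b::real_normed_vector"
  assumes "bounded Q" and v: "L-lipschitz_on UNIV v" and zero: "\<And>x. x \<notin> Q \<Longrightarrow> v x = 0"
  obtains K where "K \<ge> 0" "\<And>x. norm (v x) \<le> K"
proof -
  obtain R where R: "R > 0" "\<And>x. x \<in> Q \<Longrightarrow> norm x \<le> R"
    using \<open>bounded Q\<close> bounded_pos by blast
  obtain z :: 'a where z: "norm z = R + 1" using vector_choose_size[of "R + 1"] R by auto
  then have "v z = 0" using zero R(2)[of z] by force
  show ?thesis
  proof (rule that[of "L * (2 * R + 1)"])
    show "L * (2 * R + 1) \<ge> 0" using lipschitz_on_nonneg[OF v] R by simp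
    then show "norm (v x) \<le> L * (2 * R + 1)" for x
    proof (cases "x \<in> Q")
      case True
      have "norm (v x - v z) \<le> L * norm (x - z)" using lipschitz_on_normD[OF v] by blast
      also have "\<dots> \<le> L * (2 * R + 1)"
        using norm_triangle_ineq4[of x z] z R(2)[OF True] lipschitz_on_nonneg[OF v]
        by (intro mult_left_mono) auto
      finally show ?thesis using \<open>v z = 0\<close> by simp
    qed (simp add: zero)
  qed
qed

text \<open>
  Near \<open>x\<close> the gradient \<open>F\<close> is almost constant, so that the block made for \<open>F x\<close> moves all values of
  \<open>F\<close> nearby into \<open>M\<close>. Rescaling a block keeps its gradients and its Lipschitz constant, while its
  sup norm becomes as small as desired.
\<close>

lemma local_tiling:
  fixes F :: "real^'n \<Rightarrow> real^'n^'n"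
  assumes G: "open G" and tr: "\<And>y. y \<in> G \<Longrightarrow> trace (F y) = 0" and x: "x \<in> G" and F: "isCont F x"
    and split: "splits_into T M (F x)" and M: "is_open_traceless M" and e: "0 < e"
  shows "\<exists>d>0. \<forall>r. 0 < r \<and> r < d \<longrightarrow> (\<exists>\<C>. is_tiling (ball x r) F M (3 * T) e \<C>) \<and> ball x r \<subseteq> G"
proof -
  obtain a b \<tau> where ab: "norm a = 1" "norm b = 1" "a \<bullet> b = 0" and \<tau>: "0 < \<tau>" "\<tau> \<le> T"
    and AM: "F x + \<tau> *\<^sub>R outer a b \<in> M" "F x - \<tau> *\<^sub>R outer a b \<in> M"
    using split unfolding splits_into_def by blast
  obtain \<eta>1 where \<eta>1: "\<eta>1 > 0" "\<And>H. \<lbrakk>trace H = 0; norm (H - (F x + \<tau> *\<^sub>R outer a b)) < \<eta>1\<rbrakk> \<Longrightarrow> H \<in> M"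
    using M AM(1) unfolding is_open_traceless_def by blast
  obtain \<eta>2 where \<eta>2: "\<eta>2 > 0" "\<And>H. \<lbrakk>trace H = 0; norm (H - (F x - \<tau> *\<^sub>R outer a b)) < \<eta>2\<rbrakk> \<Longrightarrow> H \<in> M"
    using M AM(2) unfolding is_open_traceless_def by blast
  \<comment> \<open>one half for the deviation of the block, the other half for the variation of \<open>F\<close>\<close>
  define \<eta> where "\<eta> = min \<eta>1 \<eta>2 / 2"
  have \<eta>: "0 < \<eta>" using \<eta>1 \<eta>2 by (simp add: \<eta>_def)
  obtain Q Q' v W where Q: "open Q" "bounded Q" "Q \<noteq> {}" "negligible (frontier Q)"
    and Q': "open Q'" "Q' \<subseteq> Q" "negligible (Q - Q')"
    and v: "(3 * \<tau>)-lipschitz_on UNIV v" "\<And>q. q \<notin> Q \<Longrightarrow> v q = 0"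
    and W: "\<And>q. q \<in> Q' \<Longrightarrow> (v has_derivative (*v) (W q)) (at q)" "\<And>q. q \<in> Q' \<Longrightarrow> isCont W q"
    "\<And>q. q \<in> Q' \<Longrightarrow> trace (W q) = 0"
    "\<And>q. q \<in> Q' \<Longrightarrow> norm (W q - \<tau> *\<^sub>R outer a b) < \<eta> \<or> norm (W q + \<tau> *\<^sub>R outer a b) < \<eta>"
    by (rule oscillating_block[OF ab \<tau>(1) \<eta>]) (rule that)
  obtain K where K: "K \<ge> 0" "\<And>q. norm (v q) \<le> K"
    by (rule lipschitz_zero_outside_bounded[OF Q(2) v]) (assumption, rule that)
  obtain d1 where d1: "d1 > 0" "\<And>y. dist y x < d1 \<Longrightarrow> dist (F y) (F x) < \<eta>"
    using F \<eta> unfolding continuous_at_eps_delta by metis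
  obtain d2 where d2: "d2 > 0" "ball x d2 \<subseteq> G" using G x openE by metis
  have near: "F y + W q \<in> M" if y: "dist y x < min d1 d2" and q: "q \<in> Q'" for y q
  proof -
    have "y \<in> G" using y d2 by (auto simp: dist_commute)
    then have t: "trace (F y + W q) = 0" using tr W(3)[OF q] by (simp add: trace_add)
    have Fy: "norm (F y - F x) < \<eta>" using d1(2)[of y] y by (simp add: dist_norm)
    from W(4)[OF q] show ?thesis
    proof
      assume w: "norm (W q - \<tau> *\<^sub>R outer a b) < \<eta>"
      have "norm ((F y + W q) - (F x + \<tau> *\<^sub>R outer a b)) = norm ((F y - F x) + (W q - \<tau> *\<^sub>R outer a b))"
        by (simp add: algebra_simps)
      also have "\<dots> < \<eta>1" using norm_triangle_ineq[of "F y - F x" "W q - \<tau> *\<^sub>R outer a b"] Fy w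
        by (simp add: \<eta>_def)
      finally show ?thesis using \<eta>1(2)[OF t] by blast
    next
      assume w: "norm (W q + \<tau> *\<^sub>R outer a b) < \<eta>"
      have "norm ((F y + W q) - (F x - \<tau> *\<^sub>R outer a b)) = norm ((F y - F x) + (W q + \<tau> *\<^sub>R outer a b))"
        by (simp add: algebra_simps)
      also have "\<dots> < \<eta>2" using norm_triangle_ineq[of "F y - F x" "W q + \<tau> *\<^sub>R outer a b"] Fy w
        by (simp add: \<eta>_def)
      finally show ?thesis using \<eta>2(2)[OF t] by blast
    qed
  qed
  have "\<exists>\<C>. is_tiling (ball x r) F M (3 * T) e \<C>" if r: "0 < r" "r < min d1 d2" for r
  proof -
    \<comment> \<open>\<open>K\<close> bounds the block, so copies of size less than \<open>e / (K + 1)\<close> have sup norm below \<open>e\<close>\<close>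
    have "0 < e / (K + 1)" using e K by simp
    then obtain I where I: "countable I" "\<And>i. i \<in> I \<Longrightarrow> 0 < snd i \<and> snd i < e / (K + 1) \<and> copy Q i \<subseteq> ball x r"
      "disjoint_family_on (copy Q) I" "negligible (ball x r - \<Union>(copy Q ` I))"
      by (rule fill_by_copies[OF Q open_ball bounded_ball, of "e / (K + 1)" x r]) (rule that)
    define q where "q = (\<lambda>(i :: (real^'n) \<times> real) y. (1 / snd i) *\<^sub>R (y - fst i))"
    define c where "c = (\<lambda>i. (copy Q i, copy Q' i, \<lambda>y. snd i *\<^sub>R v (q i y), \<lambda>y. W (q i y)))"
    have mem: "y \<in> copy A i \<longleftrightarrow> q i y \<in> A" if "i \<in> I" for i y A
    proof -
      have s: "snd i \<noteq> 0" using I(2)[OF that] by auto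
      then have "y = fst i + snd i *\<^sub>R q i y" by (simp add: q_def)
      then have "q i y \<in> A \<Longrightarrow> y \<in> copy A i" by (rule image_eqI)
      moreover have "q i (fst i + snd i *\<^sub>R z) = z" for z using s by (simp add: q_def)
      then have "y \<in> copy A i \<Longrightarrow> q i y \<in> A" by auto
      ultimately show ?thesis by blast
    qed
    have "is_cell (ball x r) F M (3 * T) e (c i)" if i: "i \<in> I" for i
    proof -
      have s: "0 < snd i" "snd i < e / (K + 1)" and sub: "copy Q i \<subseteq> ball x r" using I(2)[OF i] by auto
      have "copy Q i - copy Q' i \<subseteq> copy (Q - Q') i" by blast
      then have "negligible (copy Q i - copy Q' i)"
        using negligible_affinity[OF Q'(3)] negligible_subset by blast
      moreover have "(3 * T)-lipschitz_on UNIV (\<lambda>y. snd i *\<^sub>R v (q i y))"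
        unfolding q_def using \<tau> by (intro rescaled_lipschitz s lipschitz_on_mono[OF v(1)]) auto
      moreover have "norm (snd i *\<^sub>R v (q i y)) \<le> e" for y
      proof -
        have "snd i * norm (v (q i y)) \<le> e / (K + 1) * K"
          using s K e by (intro mult_mono) auto
        also have "\<dots> \<le> e" using K e by (simp add: field_simps)
        finally show ?thesis using s by simp
      qed
      moreover have "((\<lambda>y. snd i *\<^sub>R v (q i y)) has_derivative (*v) (W (q i y))) (at y) \<and>
          isCont (\<lambda>y. W (q i y)) y \<and> F y + W (q i y) \<in> M" if y: "y \<in> copy Q' i" for y
      proof (intro conjI)
        have qy: "q i y \<in> Q'" using y mem[OF i] by simp
        show "((\<lambda>y. snd i *\<^sub>R v (q i y)) has_derivative (*v) (W (q i y))) (at y)"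
          using rescaled_derivative[of "snd i" v "W (q i y)" y "fst i"] s W(1)[OF qy] by (simp add: q_def)
        have "isCont (q i) y" unfolding q_def by (intro continuous_intros)
        then show "isCont (\<lambda>y. W (q i y)) y" using isCont_o2 W(2)[OF qy] by blast
        have "y \<in> ball x r" using y sub Q'(2) by blast
        then have "dist y x < min d1 d2" using r by (simp add: dist_commute)
        then show "F y + W (q i y) \<in> M" using near qy by blast
      qed
      moreover have "snd i *\<^sub>R v (q i y) = 0" if "y \<notin> copy Q i" for y
        using that mem[OF i] v(2) by simp
      ultimately show ?thesis
        using s sub Q' Q(1) by (auto simp: is_cell_def c_def intro!: open_affinity)
    qed
    moreover have "disjoint_family_on fst (c ` I)"
      unfolding disjoint_family_on_def
    proof (intro ballI impI)
      fix j j' assume "j \<in> c ` I" "j' \<in> c ` I" "j \<noteq> j'"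
      then obtain i i' where i: "j = c i" "j' = c i'" "i \<in> I" "i' \<in> I" "i \<noteq> i'" by blast
      have "fst j = copy Q i" "fst j' = copy Q i'" using i(1,2) by (simp_all add: c_def)
      then show "fst j \<inter> fst j' = {}" using I(3) i(3-5) by (simp add: disjoint_family_on_def)
    qed
    moreover have "fst ` c ` I = copy Q ` I" by (auto simp: c_def image_image)
    ultimately have "is_tiling (ball x r) F M (3 * T) e (c ` I)"
      using I by (simp add: is_tiling_def)
    then show ?thesis by blast
  qed
  moreover have "ball x r \<subseteq> G" if "r < min d1 d2" for r using d2 that by auto
  ultimately show ?thesis using d1(1) d2(1) by (intro exI[of _ "min d1 d2"]) auto
qed

lemma is_cell_mono: "is_cell G F M L e c \<Longrightarrow> G \<subseteq> G' \<Longrightarrow> is_cell G' F M L e c"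
  unfolding is_cell_def by (cases c) auto

lemma is_cell_subset: "is_cell G F M L e c \<Longrightarrow> fst c \<subseteq> G"
  unfolding is_cell_def by (cases c) auto

lemma global_tiling:
  fixes F :: "real^'n \<Rightarrow> real^'n^'n"
  assumes G: "open G" and F: "\<And>x. x \<in> G \<Longrightarrow> isCont F x"
    and split: "\<And>x. x \<in> G \<Longrightarrow> splits_into T M (F x)" and M: "is_open_traceless M" and e: "0 < e"
  shows "\<exists>\<C>. is_tiling G F M (3 * T) e \<C>"
proof -
  have tr: "trace (F x) = 0" if "x \<in> G" for x using split[OF that] by (simp add: splits_into_def)
  have "\<forall>x\<in>G. \<exists>d>0. \<forall>r. 0 < r \<and> r < d \<longrightarrow> (\<exists>\<C>. is_tiling (ball x r) F M (3 * T) e \<C>) \<and> ball x r \<subseteq> G"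
    using local_tiling[OF G tr _ F split M e] by blast
  from bchoice[OF this] obtain d where d: "\<And>x. x \<in> G \<Longrightarrow> 0 < d x"
    "\<And>x r. \<lbrakk>x \<in> G; 0 < r; r < d x\<rbrakk> \<Longrightarrow> (\<exists>\<C>. is_tiling (ball x r) F M (3 * T) e \<C>) \<and> ball x r \<subseteq> G" by blast
  define K where "K = {i. fst i \<in> G \<and> 0 < snd i \<and> snd i < d (fst i)}"
  have ball_at: "\<exists>i. i \<in> K \<and> x \<in> ball (fst i) (snd i) \<and> snd i < \<delta>" if "x \<in> G" "0 < \<delta>" for x \<delta>
    using d(1)[OF that(1)] that by (intro exI[of _ "(x, min \<delta> (d x) / 2)"]) (auto simp: K_def)
  let ?b = "\<lambda>i. ball (fst i :: real^'n) (snd i)"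
  obtain C where C: "countable C" "C \<subseteq> K" "pairwise (\<lambda>i j. disjnt (?b i) (?b j)) C" "negligible (G - (\<Union>i\<in>C. ?b i))"
    by (rule Vitali_covering_theorem_balls[of G K fst snd, OF ball_at]) (assumption, assumption, rule that)
  have "\<forall>i\<in>C. \<exists>\<C>. is_tiling (?b i) F M (3 * T) e \<C>" and bG: "\<And>i. i \<in> C \<Longrightarrow> ?b i \<subseteq> G"
    using C(2) d(2) by (auto simp: K_def)
  from bchoice[OF this(1)] obtain t where t: "\<And>i. i \<in> C \<Longrightarrow> is_tiling (?b i) F M (3 * T) e (t i)" by blast
  have sub: "fst c \<subseteq> ?b i" if "i \<in> C" "c \<in> t i" for i c
    using t[OF that(1)] that(2) is_cell_subset unfolding is_tiling_def by blast
  have "is_tiling G F M (3 * T) e (\<Union>i\<in>C. t i)"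
    unfolding is_tiling_def
  proof (intro conjI ballI)
    show "countable (\<Union>i\<in>C. t i)" using C(1) t by (auto simp: is_tiling_def)
    show "is_cell G F M (3 * T) e c" if "c \<in> (\<Union>i\<in>C. t i)" for c
      using that t bG is_cell_mono unfolding is_tiling_def by blast
    show "disjoint_family_on fst (\<Union>i\<in>C. t i)"
      unfolding disjoint_family_on_def
    proof (intro ballI impI)
      fix c c' assume "c \<in> (\<Union>i\<in>C. t i)" "c' \<in> (\<Union>i\<in>C. t i)" "c \<noteq> c'"
      then obtain i j where ij: "i \<in> C" "j \<in> C" "c \<in> t i" "c' \<in> t j" by blast
      show "fst c \<inter> fst c' = {}"
      proof (cases "i = j")
        case True
        then show ?thesis using t[of i] ij \<open>c \<noteq> c'\<close> unfolding is_tiling_def disjoint_family_on_def by blast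
      next
        case False
        then have "?b i \<inter> ?b j = {}" using C(3) ij by (auto simp: pairwise_def disjnt_def)
        then show ?thesis using sub ij by blast
      qed
    qed
    have "G - \<Union>(fst ` (\<Union>i\<in>C. t i)) \<subseteq> (G - (\<Union>i\<in>C. ?b i)) \<union> (\<Union>i\<in>C. ?b i - \<Union>(fst ` t i))" by blast
    moreover have "negligible (\<Union>i\<in>C. ?b i - \<Union>(fst ` t i))"
      using C(1) t by (intro negligible_countable_Union) (auto simp: is_tiling_def)
    ultimately show "negligible (G - \<Union>(fst ` (\<Union>i\<in>C. t i)))"
      using C(4) negligible_Un negligible_subset by meson
  qed
  then show ?thesis by blast
qed

text \<open>
  The corrected map is again continuously differentiable on an open set of full measure, with gradients in
  \<open>M\<close>, so the step can be repeated.
\<close>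

lemma perturbation_step:
  fixes u :: "real^'n \<Rightarrow> real^'n" and F :: "real^'n \<Rightarrow> real^'n^'n"
  assumes G: "open G" and u: "\<And>x. x \<in> G \<Longrightarrow> (u has_derivative (*v) (F x)) (at x)"
    and F: "\<And>x. x \<in> G \<Longrightarrow> isCont F x"
    and split: "\<And>x. x \<in> G \<Longrightarrow> splits_into T M (F x)" and M: "is_open_traceless M"
    and e: "0 < e" and T: "0 \<le> T"
  obtains p G' F' where "open G'" "G' \<subseteq> G" "negligible (G - G')"
    "(6 * T)-lipschitz_on UNIV p" "\<And>x. x \<notin> G \<Longrightarrow> p x = 0" "\<And>x. norm (p x) \<le> e"
    "\<And>x. x \<in> G' \<Longrightarrow> ((\<lambda>y. u y + p y) has_derivative (*v) (F' x)) (at x)"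
    "\<And>x. x \<in> G' \<Longrightarrow> isCont F' x" "\<And>x. x \<in> G' \<Longrightarrow> F' x \<in> M"
proof -
  obtain \<C> where \<C>: "is_tiling G F M (3 * T) e \<C>" using global_tiling[OF G F split M e] by blast
  define S' where "S' = (\<lambda>c :: 'n cell. fst (snd c))"
  define f where "f = (\<lambda>c :: 'n cell. fst (snd (snd c)))"
  define H where "H = (\<lambda>c :: 'n cell. snd (snd (snd c)))"
  have dis: "disjoint_family_on fst \<C>" and cnt: "countable \<C>" and cov: "negligible (G - \<Union>(fst ` \<C>))"
    using \<C> by (auto simp: is_tiling_def)
  have cell: "open (fst c)" "fst c \<subseteq> G" "open (S' c)" "S' c \<subseteq> fst c" "negligible (fst c - S' c)"
     "(3 * T)-lipschitz_on UNIV (f c)" "\<And>x. x \<notin> fst c \<Longrightarrow> f c x = 0" "\<And>x. norm (f c x) \<le> e"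
     "\<And>x. x \<in> S' c \<Longrightarrow> (f c has_derivative (*v) (H c x)) (at x)" "\<And>x. x \<in> S' c \<Longrightarrow> isCont (H c) x"
     "\<And>x. x \<in> S' c \<Longrightarrow> F x + H c x \<in> M" if "c \<in> \<C>" for c
    using \<C> that unfolding is_tiling_def is_cell_def S'_def f_def H_def case_prod_beta by blast+
  obtain p where p: "\<And>c x. \<lbrakk>c \<in> \<C>; x \<in> fst c\<rbrakk> \<Longrightarrow> p x = f c x" "\<And>x. x \<notin> \<Union>(fst ` \<C>) \<Longrightarrow> p x = 0"
    "(2 * (3 * T))-lipschitz_on UNIV p"
  proof (rule lipschitz_glue_disjoint[OF dis, of "3 * T" f])
    show "0 \<le> 3 * T" using T by simp
    show "(3 * T)-lipschitz_on UNIV (f c)" if "c \<in> \<C>" for c using cell(6)[OF that] .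
    show "f c x = 0" if "c \<in> \<C>" "x \<notin> fst c" for c x using cell(7)[OF that] .
  qed (rule that)
  define G' where "G' = (\<Union>c\<in>\<C>. S' c)"
  define F' where "F' = (\<lambda>x. F x + H (SOME c. c \<in> \<C> \<and> x \<in> S' c) x)"
  have F'_eq: "F' x = F x + H c x" if "c \<in> \<C>" "x \<in> S' c" for c x
  proof -
    have "(SOME c. c \<in> \<C> \<and> x \<in> S' c) = c"
    proof (rule some_equality)
      fix c' assume c': "c' \<in> \<C> \<and> x \<in> S' c'"
      then have "x \<in> fst c \<inter> fst c'" using that cell(4) by blast
      then show "c' = c" using dis c' that(1) by (auto simp: disjoint_family_on_def)
    qed (use that in simp)
    then show ?thesis by (simp add: F'_def)
  qed
  show ?thesis
  proof (rule that[of G' p F'])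
    show "open G'" using cell(3) by (auto simp: G'_def)
    show "G' \<subseteq> G" unfolding G'_def using cell(2,4) by blast
    have "G - G' \<subseteq> (G - \<Union>(fst ` \<C>)) \<union> (\<Union>c\<in>\<C>. fst c - S' c)" by (auto simp: G'_def)
    moreover have "negligible (\<Union>c\<in>\<C>. fst c - S' c)"
      using cnt cell(5) by (intro negligible_countable_Union) auto
    ultimately show "negligible (G - G')" using cov negligible_Un negligible_subset by meson
    show "(6 * T)-lipschitz_on UNIV p" using p(3) by simp
    show "p x = 0" if "x \<notin> G" for x using that cell(2) p(2) by blast
    show "norm (p x) \<le> e" for x
    proof (cases "x \<in> \<Union>(fst ` \<C>)")
      case True
      then obtain c where "c \<in> \<C>" "x \<in> fst c" by blast
      then show ?thesis using p(1) cell(8) by simp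
    next
      case False
      then show ?thesis using p(2)[OF False] e by simp
    qed
    fix x assume "x \<in> G'"
    then obtain c where c: "c \<in> \<C>" "x \<in> S' c" by (auto simp: G'_def)
    have xG: "x \<in> G" using c cell(2)[OF c(1)] cell(4)[OF c(1)] by blast
    have "f c y = p y" if "y \<in> S' c" for y
      using p(1)[OF c(1), of y] cell(4)[OF c(1)] that by auto
    with has_derivative_transform_within_open[OF cell(9)[OF c] cell(3)[OF c(1)] c(2)]
    have "(p has_derivative (*v) (H c x)) (at x)" .
    from has_derivative_add[OF u[OF xG] this]
    show "((\<lambda>y. u y + p y) has_derivative (*v) (F' x)) (at x)"
      by (simp add: F'_eq[OF c] matrix_vector_mult_add_rdistrib[abs_def])
    have "isCont (\<lambda>y. F y + H c y) x" using F[OF xG] cell(10)[OF c] by (intro continuous_intros)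
    moreover have "eventually (\<lambda>y. y \<in> S' c) (nhds x)"
      using c cell(3) by (intro eventually_nhds_in_open)
    then have "eventually (\<lambda>y. F' y = F y + H c y) (nhds x)"
      by eventually_elim (rule F'_eq[OF c(1)])
    from isCont_cong[OF this] calculation show "isCont F' x" by simp
    show "F' x \<in> M" using cell(11)[OF c] F'_eq[OF c] by simp
  qed
qed

section \<open>Convergence of the iteration\<close>

lemma derivative_bound_of_lipschitz:
  fixes p :: "'a::real_normed_vector \<Rightarrow> 'b::real_normed_vector"
  assumes p: "(p has_derivative D) (at x)" and lip: "L-lipschitz_on UNIV p"
  shows "norm (D h) \<le> L * norm h"
proof (rule field_le_epsilon)
  interpret D: bounded_linear D using p by (rule has_derivative_bounded_linear)
  fix e :: real assume "0 < e"
  define c where "c = norm h + 1"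
  have c: "0 < c" "norm h \<le> c" by (simp_all add: c_def add_nonneg_pos)
  define e' where "e' = e / c"
  have e': "0 < e'" using \<open>0 < e\<close> c by (simp add: e'_def)
  obtain d where d: "d > 0" "\<And>y. norm (y - x) < d \<Longrightarrow> norm (p y - p x - D (y - x)) \<le> e' * norm (y - x)"
    using p e' unfolding has_derivative_at_alt by metis
  define t where "t = d / (2 * c)"
  have t: "t > 0" using d c by (simp add: t_def)
  have nt: "norm (t *\<^sub>R h) < d"
  proof -
    have "t * norm h \<le> t * c" using t c by simp
    also have "\<dots> = d / 2" using c by (simp add: t_def)
    finally show ?thesis using d t by simp
  qed
  have "norm (D (t *\<^sub>R h)) \<le> norm (p (x + t *\<^sub>R h) - p x) + norm (p (x + t *\<^sub>R h) - p x - D (t *\<^sub>R h))"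
    using norm_triangle_ineq4[of "p (x + t *\<^sub>R h) - p x" "p (x + t *\<^sub>R h) - p x - D (t *\<^sub>R h)"] by simp
  also have "\<dots> \<le> L * norm (t *\<^sub>R h) + e' * norm (t *\<^sub>R h)"
    using d(2)[of "x + t *\<^sub>R h"] nt lipschitz_on_normD[OF lip, of "x + t *\<^sub>R h" x]
    by (intro add_mono) auto
  finally have "t * norm (D h) \<le> t * (L * norm h + e' * norm h)"
    using t by (simp add: D.scaleR algebra_simps)
  then have "norm (D h) \<le> L * norm h + e' * norm h" using t by simp
  also have "e' * norm h \<le> e' * c" using e' c by simp
  also have "e' * c = e" using c by (simp add: e'_def)
  finally show "norm (D h) \<le> L * norm h + e" by simp
qed

text \<open>
  Columns are images of unit vectors, so that every entry is bounded by \<open>L\<close>.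
\<close>

lemma matrix_norm_bound:
  fixes A :: "real^'n^'m"
  assumes "\<And>h. norm (A *v h) \<le> L * norm h"
  shows "norm A \<le> real CARD('m) * real CARD('n) * L"
proof -
  have entry: "\<bar>A $ i $ j\<bar> \<le> L" for i j
  proof -
    have "A $ i $ j = (A *v axis j 1) $ i"
      by (simp add: matrix_vector_mul_component inner_axis)
    then have "\<bar>A $ i $ j\<bar> \<le> norm (A *v axis j 1)" by (metis component_le_norm_cart)
    also have "\<dots> \<le> L" using assms[of "axis j 1"] by simp
    finally show ?thesis .
  qed
  have "norm A \<le> (\<Sum>i\<in>UNIV. norm (A $ i))" unfolding norm_vec_def by (rule L2_set_le_sum) simp
  also have "\<dots> \<le> (\<Sum>i\<in>(UNIV::'m set). \<Sum>j\<in>(UNIV::'n set). L)"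
    by (intro sum_mono order_trans[OF norm_le_l1_cart]) (simp add: entry)
  finally show ?thesis by simp
qed

text \<open>
  Difference quotients of the tail of the series are bounded by the tail of \<open>L\<close>, uniformly in the
  increment. This makes termwise differentiation possible at a single point \<open>x\<close>; the summands of the
  application are differentiable at almost every point only.
\<close>

lemma has_derivative_lipschitz_series:
  fixes p :: "nat \<Rightarrow> real^'n \<Rightarrow> real^'m" and D :: "nat \<Rightarrow> real^'n^'m"
  assumes lip: "\<And>k. (L k)-lipschitz_on UNIV (p k)" and L: "summable L"
    and sm: "\<And>y. summable (\<lambda>k. p k y)"
    and D: "\<And>k. (p k has_derivative (*v) (D k)) (at x)"
  shows "summable D" "((\<lambda>y. \<Sum>k. p k y) has_derivative (*v) (\<Sum>k. D k)) (at x)"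
proof -
  define c where "c = real CARD('m) * real CARD('n)"
  have nD: "norm (D k) \<le> c * L k" for k
    unfolding c_def by (intro matrix_norm_bound derivative_bound_of_lipschitz[OF D lip])
  have "summable (\<lambda>k. norm (D k))"
    by (rule summable_comparison_test'[OF summable_mult[OF L, of c], of 0]) (simp add: nD)
  then show sD: "summable D" by (rule summable_norm_cancel)
  have bl: "bounded_linear (\<lambda>A. A *v h)" for h :: "real^'n"
    unfolding linear_conv_bounded_linear[symmetric]
    by (rule linearI) (simp_all add: matrix_vector_mult_add_rdistrib scaleR_matrix_vector_assoc)
  define q where "q = (\<lambda>k y. p k y - p k x - D k *v (y - x))"
  define M where "M = (\<lambda>k. L k + norm (D k))"
  have sM: "summable M" unfolding M_def by (intro summable_add L \<open>summable (\<lambda>k. norm (D k))\<close>)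
  have qM: "norm (q k y) \<le> M k * norm (y - x)" for k y
  proof -
    have "norm (q k y) \<le> norm (p k y - p k x) + norm (D k *v (y - x))"
      unfolding q_def by (rule norm_triangle_ineq4)
    also have "\<dots> \<le> L k * norm (y - x) + norm (D k) * norm (y - x)"
      by (intro add_mono norm_mult_vec_le lipschitz_on_normD[OF lip]) auto
    finally show ?thesis by (simp add: M_def algebra_simps)
  qed
  have sDv: "summable (\<lambda>k. D k *v (y - x))" for y
    using bounded_linear.summable[OF bl sD] .
  have q_sum: "(\<Sum>k. q k y) = (\<Sum>k. p k y) - (\<Sum>k. p k x) - (\<Sum>k. D k) *v (y - x)"
    and sq: "summable (\<lambda>k. q k y)" for y
    unfolding q_def using sm sDv[of y] bounded_linear.suminf[OF bl[of "y - x"] sD]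
    by (auto simp: suminf_diff[symmetric] summable_diff)
  show "((\<lambda>y. \<Sum>k. p k y) has_derivative (*v) (\<Sum>k. D k)) (at x)"
    unfolding has_derivative_at_alt
  proof (intro conjI allI impI)
    show "bounded_linear ((*v) (\<Sum>k. D k))" by simp
    fix e :: real assume "0 < e"
    then obtain N where N: "norm (\<Sum>i. M (i + N)) < e / 2"
      using suminf_exist_split[OF _ sM, of "e / 2"] by auto
    have "((\<lambda>y. \<Sum>k<N. p k y) has_derivative (\<lambda>h. \<Sum>k<N. D k *v h)) (at x)"
      by (intro has_derivative_sum D)
    then obtain d where d: "d > 0"
      "\<And>y. norm (y - x) < d \<Longrightarrow> norm ((\<Sum>k<N. p k y) - (\<Sum>k<N. p k x) - (\<Sum>k<N. D k *v (y - x))) \<le> e / 2 * norm (y - x)"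
      using \<open>0 < e\<close> unfolding has_derivative_at_alt by (metis half_gt_zero)
    show "\<exists>d>0. \<forall>y. norm (y - x) < d \<longrightarrow>
        norm ((\<Sum>k. p k y) - (\<Sum>k. p k x) - (\<Sum>k. D k) *v (y - x)) \<le> e * norm (y - x)"
    proof (intro exI[of _ d] conjI allI impI d(1))
      fix y assume y: "norm (y - x) < d"
      have "(\<Sum>k<N. q k y) = (\<Sum>k<N. p k y) - (\<Sum>k<N. p k x) - (\<Sum>k<N. D k *v (y - x))"
        by (simp add: q_def sum_subtractf)
      then have head: "norm (\<Sum>k<N. q k y) \<le> e / 2 * norm (y - x)" using d(2)[OF y] by simp
      have sMN: "summable (\<lambda>i. M (i + N))" using sM by (simp add: summable_iff_shift)
      have "norm (\<Sum>i. q (i + N) y) \<le> (\<Sum>i. M (i + N) * norm (y - x))"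
        by (rule norm_suminf_le) (use qM sMN in \<open>auto intro: summable_mult2\<close>)
      also have "\<dots> = (\<Sum>i. M (i + N)) * norm (y - x)" by (rule suminf_mult2[symmetric, OF sMN])
      also have "\<dots> \<le> e / 2 * norm (y - x)" using N by (intro mult_right_mono) auto
      finally have tail: "norm (\<Sum>i. q (i + N) y) \<le> e / 2 * norm (y - x)" .
      have "(\<Sum>k. q k y) = (\<Sum>i. q (i + N) y) + (\<Sum>k<N. q k y)"
        by (rule suminf_split_initial_segment[OF sq])
      then have "norm (\<Sum>k. q k y) \<le> e / 2 * norm (y - x) + e / 2 * norm (y - x)"
        using norm_triangle_mono[OF tail head] by simp
      then show "norm ((\<Sum>k. p k y) - (\<Sum>k. p k x) - (\<Sum>k. D k) *v (y - x)) \<le> e * norm (y - x)"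
        by (simp add: q_sum)
    qed
  qed
qed

lemma lipschitz_series:
  fixes p :: "nat \<Rightarrow> 'a::metric_space \<Rightarrow> 'b::banach"
  assumes lip: "\<And>k. (L k)-lipschitz_on UNIV (p k)" and L: "summable L"
    and sm: "\<And>y. summable (\<lambda>k. p k y)"
  shows "(\<Sum>k. L k)-lipschitz_on UNIV (\<lambda>y. \<Sum>k. p k y)"
proof (rule lipschitz_onI)
  show "0 \<le> (\<Sum>k. L k)" using lip lipschitz_on_nonneg by (intro suminf_nonneg L) auto
  fix x y :: 'a
  have "norm (\<Sum>k. p k x - p k y) \<le> (\<Sum>k. L k * dist x y)"
    using lipschitz_onD[OF lip] by (intro norm_suminf_le summable_mult2 L) (auto simp: dist_norm)
  then show "dist (\<Sum>k. p k x) (\<Sum>k. p k y) \<le> (\<Sum>k. L k) * dist x y"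
    by (simp add: dist_norm suminf_diff[OF sm sm] suminf_mult2[OF L])
qed

lemma is_open_traceless_admissible: "is_open_traceless (admissible s)"
  unfolding is_open_traceless_def
proof (intro ballI conjI)
  fix F assume F: "F \<in> admissible s"
  then show "trace F = 0" by (simp add: admissible_def)
  obtain \<eta> where "\<eta> > 0" "\<And>H. \<lbrakk>trace H = 0; norm (H - F) < \<eta>\<rbrakk> \<Longrightarrow> H \<in> admissible s"
    by (rule admissible_open[OF F]) (rule that)
  then show "\<exists>\<eta>>0. \<forall>H. trace H = 0 \<and> norm (H - F) < \<eta> \<longrightarrow> H \<in> admissible s" by blast
qed

lemma admissible_splits_into:
  assumes F: "F \<in> admissible s"
  shows "splits_into (sqrt s) (admissible (5/6 * s)) F"
proof -
  obtain a b \<tau> where "norm a = 1" "norm b = 1" "a \<bullet> b = 0" "0 < \<tau>" "\<tau> \<le> sqrt s"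
    "F + \<tau> *\<^sub>R outer a b \<in> admissible (5/6 * s)" "F - \<tau> *\<^sub>R outer a b \<in> admissible (5/6 * s)"
    by (rule admissible_split[OF F]) (rule that)
  moreover have "trace F = 0" using F by (simp add: admissible_def)
  ultimately show ?thesis unfolding splits_into_def by blast
qed

text \<open>
  The strict inequalities that define admissibility pass to the limit as weak ones, which are exactly the
  hypotheses of \<open>V_energy_zero\<close>.
\<close>

lemma limit_zero_energy:
  assumes lim: "F \<longlonglongrightarrow> A" and F: "\<And>n. F n \<in> admissible (s n)" and s: "s \<longlonglongrightarrow> 0"
  shows "trace A = 0" "V_energy (sym_part A) = 0"
proof -
  have "(\<lambda>n. trace (F n)) \<longlonglongrightarrow> trace A"
    unfolding trace_def by (intro tendsto_intros lim)
  moreover have "trace (F n) = 0" for n using F[of n] by (simp add: admissible_def)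
  ultimately show tr: "trace A = 0" by (simp add: LIMSEQ_const_iff)
  show "V_energy (sym_part A) = 0"
  proof (rule V_energy_zero[OF tr])
    fix x :: "real^3"
    have "bounded_linear (\<lambda>A. A *v x)"
      unfolding linear_conv_bounded_linear[symmetric]
      by (rule linearI) (simp_all add: matrix_vector_mult_add_rdistrib scaleR_matrix_vector_assoc)
    from bounded_linear.tendsto[OF this lim]
    have "(\<lambda>n. x \<bullet> (F n *v x) + (x \<bullet> x) / 2) \<longlonglongrightarrow> x \<bullet> (A *v x) + (x \<bullet> x) / 2"
      by (intro tendsto_intros)
    moreover have "0 \<le> x \<bullet> (F n *v x) + (x \<bullet> x) / 2" for n
      using F[of n] by (cases "x = 0") (auto simp: admissible_def less_imp_le)
    ultimately show "0 \<le> x \<bullet> (A *v x) + (x \<bullet> x) / 2" by (meson LIMSEQ_le_const)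
  next
    have "(\<lambda>n. 3/2 - (norm (sym_part (F n)))\<^sup>2) \<longlonglongrightarrow> 3/2 - (norm (sym_part A))\<^sup>2"
      by (intro tendsto_intros bounded_linear.tendsto[OF bounded_linear_sym_part] lim)
    then show "3/2 - (norm (sym_part A))\<^sup>2 \<le> 0"
      by (rule LIMSEQ_le[OF _ s]) (use F in \<open>auto simp: admissible_def less_imp_le\<close>)
  qed
qed

type_synonym stage = "(real^3 \<Rightarrow> real^3) \<times> (real^3 \<Rightarrow> real^3^3) \<times> (real^3) set"

text \<open>
  In the triple \<open>(u, F, G)\<close>, \<open>F\<close> is the gradient of \<open>u\<close> on the open set \<open>G\<close> of full measure in
  \<open>\<Omega>\<close>.
\<close>

definition is_stage :: "(real^3) set \<Rightarrow> real \<Rightarrow> stage \<Rightarrow> bool" where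
  "is_stage \<Omega> s = (\<lambda>(u, F, G). open G \<and> G \<subseteq> \<Omega> \<and> negligible (\<Omega> - G) \<and>
     (\<forall>x\<in>G. (u has_derivative (*v) (F x)) (at x) \<and> isCont F x \<and> F x \<in> admissible s))"

definition is_correction :: "(real^3) set \<Rightarrow> real \<Rightarrow> real \<Rightarrow> (real^3 \<Rightarrow> real^3) \<Rightarrow> bool" where
  "is_correction \<Omega> L e p \<longleftrightarrow> L-lipschitz_on UNIV p \<and> (\<forall>x. x \<notin> \<Omega> \<longrightarrow> p x = 0) \<and> (\<forall>x. norm (p x) \<le> e)"

lemma next_stage:
  assumes st: "is_stage \<Omega> s (u, F, G)" and s: "0 < s" and e: "0 < e"
  shows "\<exists>u' F' G'. is_stage \<Omega> (5/6 * s) (u', F', G') \<and> is_correction \<Omega> (6 * sqrt s) e (\<lambda>x. u' x - u x)"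
proof -
  have G: "open G" "G \<subseteq> \<Omega>" "negligible (\<Omega> - G)"
    and u: "\<And>x. x \<in> G \<Longrightarrow> (u has_derivative (*v) (F x)) (at x)" and F: "\<And>x. x \<in> G \<Longrightarrow> isCont F x"
    and adm: "\<And>x. x \<in> G \<Longrightarrow> F x \<in> admissible s"
    using st by (auto simp: is_stage_def)
  have s0: "0 \<le> sqrt s" using s by simp
  obtain p G' F' where p: "open G'" "G' \<subseteq> G" "negligible (G - G')"
    "(6 * sqrt s)-lipschitz_on UNIV p" "\<And>x. x \<notin> G \<Longrightarrow> p x = 0" "\<And>x. norm (p x) \<le> e"
    "\<And>x. x \<in> G' \<Longrightarrow> ((\<lambda>y. u y + p y) has_derivative (*v) (F' x)) (at x)"
    "\<And>x. x \<in> G' \<Longrightarrow> isCont F' x" "\<And>x. x \<in> G' \<Longrightarrow> F' x \<in> admissible (5/6 * s)"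
    by (rule perturbation_step[OF G(1) u F admissible_splits_into[OF adm] is_open_traceless_admissible e s0])
       (assumption, assumption, assumption, rule that)
  have "\<Omega> - G' \<subseteq> (\<Omega> - G) \<union> (G - G')" by blast
  then have "negligible (\<Omega> - G')" using G(3) p(3) negligible_Un negligible_subset by meson
  then have "is_stage \<Omega> (5/6 * s) (\<lambda>y. u y + p y, F', G')"
    using p G unfolding is_stage_def by auto
  moreover have "is_correction \<Omega> (6 * sqrt s) e (\<lambda>x. (u x + p x) - u x)"
    using p(4,5,6) G(2) by (auto simp: is_correction_def)
  ultimately show ?thesis by blast
qed

lemma stage_sequence:
  assumes st: "is_stage \<Omega> 2 (w, F, G)" and e: "0 < e"
  obtains u :: "nat \<Rightarrow> real^3 \<Rightarrow> real^3" and F' G' where "u 0 = w"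
    "\<And>n. is_stage \<Omega> (2 * (5/6) ^ n) (u n, F' n, G' n)"
    "\<And>n. is_correction \<Omega> (6 * sqrt (2 * (5/6) ^ n)) (e * (1/2) ^ Suc n) (\<lambda>x. u (Suc n) x - u n x)"
proof -
  let ?P = "\<lambda>n t :: stage. is_stage \<Omega> (2 * (5/6) ^ n) t \<and> (n = 0 \<longrightarrow> fst t = w)"
  let ?Q = "\<lambda>n (t :: stage) t' :: stage. is_correction \<Omega> (6 * sqrt (2 * (5/6) ^ n)) (e * (1/2) ^ Suc n) (\<lambda>x. fst t' x - fst t x)"
  have "\<exists>f. \<forall>n. ?P n (f n) \<and> ?Q n (f n) (f (Suc n))"
  proof (rule dependent_nat_choice)
    show "\<exists>t. ?P 0 t" using st by (intro exI[of _ "(w, F, G)"]) simp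
    fix t :: stage and n assume t: "?P n t"
    obtain u F G where tt: "t = (u, F, G)" by (cases t)
    have "is_stage \<Omega> (2 * (5/6) ^ n) (u, F, G)" using t tt by simp
    from next_stage[OF this, of "e * (1/2) ^ Suc n"] e obtain u' F' G' where
      "is_stage \<Omega> (5/6 * (2 * (5/6) ^ n)) (u', F', G')"
      "is_correction \<Omega> (6 * sqrt (2 * (5/6) ^ n)) (e * (1/2) ^ Suc n) (\<lambda>x. u' x - u x)" by auto
    then show "\<exists>t'. ?P (Suc n) t' \<and> ?Q n t t'"
      by (intro exI[of _ "(u', F', G')"]) (simp add: tt mult.left_commute)
  qed
  then obtain f where f: "\<And>n. ?P n (f n)" "\<And>n. ?Q n (f n) (f (Suc n))" by blast
  show ?thesis
    by (rule that[of "\<lambda>n. fst (f n)" "\<lambda>n. fst (snd (f n))" "\<lambda>n. snd (snd (f n))"])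
       (use f in auto)
qed

text \<open>
  The Lipschitz constants \<open>6 sqrt (2 (5/6)\<^sup>n)\<close> of the corrections form a geometric series. At a point
  that lies in the good sets of all stages, which is almost every point of \<open>\<Omega>\<close>, the derivatives of the
  corrections telescope, so the gradient of the sum is the limit of the gradients of the stages.
\<close>

lemma exact_solution_near_stage:
  assumes st: "is_stage \<Omega> 2 (w, F, G)" and e: "0 < e"
  obtains v :: "real^3 \<Rightarrow> real^3" and L N where "L-lipschitz_on UNIV v" "\<And>x. x \<notin> \<Omega> \<Longrightarrow> v x = 0"
    "\<And>x. norm (v x) \<le> e" "negligible N"
    "\<And>x. x \<in> \<Omega> - N \<Longrightarrow> \<exists>A. ((\<lambda>y. w y + v y) has_derivative (*v) A) (at x) \<and> trace A = 0 \<and>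
       V_energy (sym_part A) = 0"
proof -
  obtain u F' G' where u0: "u 0 = w"
    and stage: "\<And>n. is_stage \<Omega> (2 * (5/6) ^ n) (u n, F' n, G' n)"
    and corr: "\<And>n. is_correction \<Omega> (6 * sqrt (2 * (5/6) ^ n)) (e * (1/2) ^ Suc n) (\<lambda>x. u (Suc n) x - u n x)"
    by (rule stage_sequence[OF st e]) (rule that)
  define p where "p = (\<lambda>n x. u (Suc n) x - u n x)"
  define L where "L = (\<lambda>n. 6 * sqrt (2 * (5/6::real) ^ n))"
  have lip: "(L n)-lipschitz_on UNIV (p n)" and p0: "\<And>x. x \<notin> \<Omega> \<Longrightarrow> p n x = 0"
    and pe: "\<And>x. norm (p n x) \<le> e * (1/2) ^ Suc n" for n
    using corr[of n] by (auto simp: is_correction_def p_def L_def)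
  have "L = (\<lambda>n. 6 * sqrt 2 * (sqrt (5/6)) ^ n)"
    by (simp add: L_def real_sqrt_mult real_sqrt_power fun_eq_iff)
  then have sL: "summable L" by (simp add: summable_mult summable_geometric)
  have se: "(\<lambda>n. e * (1/2) ^ Suc n) sums e"
    using sums_mult[OF power_half_series, of e] by simp
  have sp: "summable (\<lambda>n. p n x)" for x
    by (rule summable_comparison_test'[OF sums_summable[OF se], of 0]) (rule pe)
  define v where "v = (\<lambda>x. \<Sum>n. p n x)"
  define N where "N = (\<Union>n. \<Omega> - G' n)"
  show ?thesis
  proof (rule that[of "suminf L" v N])
    show "(suminf L)-lipschitz_on UNIV v"
      unfolding v_def by (rule lipschitz_series[OF lip sL sp])
    show "v x = 0" if "x \<notin> \<Omega>" for x using p0[OF that] by (simp add: v_def)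
    show "norm (v x) \<le> e" for x
      using norm_suminf_le[of "\<lambda>n. p n x", OF pe sums_summable[OF se]] sums_unique[OF se] by (simp add: v_def)
    show "negligible N"
      unfolding N_def using stage by (intro negligible_countable_Union) (auto simp: is_stage_def)
    fix x assume "x \<in> \<Omega> - N"
    then have "x \<in> G' n" for n by (auto simp: N_def)
    then have der: "(u n has_derivative (*v) (F' n x)) (at x)" and adm: "F' n x \<in> admissible (2 * (5/6) ^ n)" for n
      using stage[of n] by (auto simp: is_stage_def)
    define D where "D = (\<lambda>n. F' (Suc n) x - F' n x)"
    have D: "(p n has_derivative (*v) (D n)) (at x)" for n
      using has_derivative_diff[OF der[of "Suc n"] der[of n]]
      by (simp add: p_def D_def matrix_vector_mult_diff_rdistrib[abs_def])
    note ser = has_derivative_lipschitz_series[OF lip sL sp D]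
    define A where "A = F' 0 x + (\<Sum>n. D n)"
    have "((\<lambda>y. w y + v y) has_derivative (*v) A) (at x)"
      using has_derivative_add[OF der[of 0] ser(2)]
      by (simp add: u0 v_def A_def matrix_vector_mult_add_rdistrib[abs_def])
    moreover have "(\<lambda>n. F' n x) \<longlonglongrightarrow> A"
    proof -
      have "(\<lambda>n. F' 0 x + (\<Sum>k<n. D k)) \<longlonglongrightarrow> A"
        unfolding A_def by (intro tendsto_intros summable_LIMSEQ ser(1))
      moreover have "F' 0 x + (\<Sum>k<n. D k) = F' n x" for n
        by (simp add: D_def sum_lessThan_telescope[where f = "\<lambda>k. F' k x"])
      ultimately show ?thesis by simp
    qed
    moreover have "(\<lambda>n. 2 * (5/6::real) ^ n) \<longlonglongrightarrow> 0"
      using tendsto_mult_right_zero[OF LIMSEQ_power_zero[of "5/6::real"], of 2] by simp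
    ultimately show "\<exists>A. ((\<lambda>y. w y + v y) has_derivative (*v) A) (at x) \<and> trace A = 0 \<and> V_energy (sym_part A) = 0"
      using limit_zero_energy[of "\<lambda>n. F' n x" A, OF _ adm] by blast
  qed
qed

section \<open>Continuously differentiable maps on Lipschitz domains\<close>

lemma C1_segment_bound:
  fixes w :: "real^'n \<Rightarrow> real^'m"
  assumes w: "\<And>x. x \<in> \<Omega> \<Longrightarrow> (w has_derivative (*v) (G x)) (at x)"
    and K: "\<And>x. x \<in> \<Omega> \<Longrightarrow> norm (G x) \<le> K" and seg: "closed_segment y z \<subseteq> \<Omega>"
  shows "norm (w z - w y) \<le> K * norm (z - y)"
proof -
  have o: "onorm ((*v) (G x)) \<le> K" if "x \<in> closed_segment y z" for x
  proof (rule onorm_bound)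
    have x: "norm (G x) \<le> K" by (rule K[OF subsetD[OF seg that]])
    show "0 \<le> K" by (rule order_trans[OF norm_ge_zero x])
    show "norm (G x *v h) \<le> K * norm h" for h
      by (rule order_trans[OF norm_mult_vec_le mult_right_mono[OF x norm_ge_zero]])
  qed
  have d: "(w has_derivative (*v) (G x)) (at x within closed_segment y z)" if "x \<in> closed_segment y z" for x
    by (rule has_derivative_at_withinI[OF w[OF subsetD[OF seg that]]])
  show ?thesis
    by (rule differentiable_bound[where f' = "\<lambda>x. (*v) (G x)", OF convex_closed_segment d o]) auto
qed
text \<open>
  Two points of an epigraph are joined by moving up by \<open>t = L |z - y|\<close>, across, and down again. The
  vertical parts stay in the epigraph, and the height \<open>t\<close> compensates the variation of the Lipschitz
  graph below the horizontal part. The factor \<open>2 + 2L\<close> in the assumptions on the distances to \<open>x\<close>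
  leaves room for the detour within the ball in which the domain is an epigraph.
\<close>

lemma epigraph_C1_bound:
  fixes w :: "real^'n \<Rightarrow> real^'m"
  assumes w: "\<And>x. x \<in> \<Omega> \<Longrightarrow> (w has_derivative (*v) (G x)) (at x)"
    and K: "\<And>x. x \<in> \<Omega> \<Longrightarrow> norm (G x) \<le> K"
    and e: "norm e = 1" and \<gamma>: "L-lipschitz_on {z. z \<bullet> e = 0} \<gamma>"
    and epi: "\<Omega> \<inter> ball x r = {y \<in> ball x r. \<gamma> (y - (y \<bullet> e) *\<^sub>R e) < y \<bullet> e}"
    and y: "y \<in> \<Omega>" "dist x y * (2 + 2 * L) < r" and z: "z \<in> \<Omega>" "dist x z * (2 + 2 * L) < r"
  shows "norm (w z - w y) \<le> K * (2 * L + 1) * norm (z - y)"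
proof -
  have L: "0 \<le> L" using \<gamma> by (rule lipschitz_on_nonneg)
  have ee: "e \<bullet> e = 1" using e by (simp add: dot_square_norm)
  define h where "h = (\<lambda>c. \<gamma> (c - (c \<bullet> e) *\<^sub>R e))"
  have hlip: "h c \<le> h c' + L * norm (c - c')" for c c'
  proof -
    let ?P = "\<lambda>c. c - (c \<bullet> e) *\<^sub>R e"
    have P0: "?P c \<bullet> e = 0" for c by (simp add: inner_diff_left ee)
    have PP: "?P c - ?P c' = ?P (c - c')" by (simp add: inner_diff_left algebra_simps)
    have "norm (?P (c - c')) \<le> norm (c - c')"
    proof -
      have "?P d \<bullet> ?P d = d \<bullet> d - (d \<bullet> e)\<^sup>2" for d
        by (simp add: inner_diff_left inner_diff_right ee inner_commute[of e d] power2_eq_square)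
      then show ?thesis unfolding norm_le by simp
    qed
    then have "L * norm (?P (c - c')) \<le> L * norm (c - c')" using L by (rule mult_left_mono)
    moreover have "dist (\<gamma> (?P c)) (\<gamma> (?P c')) \<le> L * dist (?P c) (?P c')"
      by (rule lipschitz_onD[OF \<gamma>]) (use P0 in auto)
    then have "\<bar>h c - h c'\<bar> \<le> L * norm (?P (c - c'))"
      unfolding h_def dist_norm real_norm_def PP .
    ultimately show ?thesis by linarith
  qed
  have h_shift: "h (c + s *\<^sub>R e) = h c" for c s
    by (simp add: h_def inner_add_left ee algebra_simps)
  have in\<Omega>: "c \<in> \<Omega>" if "c \<in> ball x r" "h c < c \<bullet> e" for c
    using epi that unfolding h_def by blast
  define t where "t = L * norm (z - y)"
  have t0: "0 \<le> t" using L by (simp add: t_def)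
  define R where "R = max (dist x y) (dist x z)"
  have R: "dist x y \<le> R" "dist x z \<le> R" "R * (2 + 2 * L) < r" using y z by (auto simp: R_def max_def)
  have "norm (z - y) \<le> 2 * R" using R dist_triangle3[of y z x] by (simp add: dist_norm norm_minus_commute)
  then have "t \<le> L * (2 * R)" unfolding t_def using L by (rule mult_left_mono)
  moreover have R0: "0 \<le> R" by (rule order_trans[OF zero_le_dist R(1)])
  ultimately have Rt: "R + t < r" using R(3) by (simp add: algebra_simps)
  have hy: "h y < y \<bullet> e" and hz: "h z < z \<bullet> e"
  proof -
    have "R \<le> R * (2 + 2 * L)" using R0 L by (simp add: algebra_simps)
    then have "y \<in> ball x r" "z \<in> ball x r" using R by auto
    then show "h y < y \<bullet> e" "h z < z \<bullet> e" using epi y z unfolding h_def by blast+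
  qed
  have up: "closed_segment c (c + t *\<^sub>R e) \<subseteq> \<Omega>" if c: "dist x c \<le> R" "h c < c \<bullet> e" for c
  proof
    fix d assume "d \<in> closed_segment c (c + t *\<^sub>R e)"
    then obtain s where s: "0 \<le> s" "s \<le> 1" "d = (1 - s) *\<^sub>R c + s *\<^sub>R (c + t *\<^sub>R e)"
      by (auto simp: in_segment)
    then have d: "d = c + (s * t) *\<^sub>R e" by (simp add: algebra_simps)
    have st: "0 \<le> s * t" "s * t \<le> t" using s t0 by (auto simp: mult_left_le_one_le)
    have "dist x d \<le> dist x c + dist c d" by (rule dist_triangle)
    also have "dist c d = s * t" using st by (simp add: d dist_norm e)
    finally have "d \<in> ball x r" using c st Rt by simp
    moreover have "h d < d \<bullet> e" using c st unfolding d h_shift by (simp add: inner_add_left ee)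
    ultimately show "d \<in> \<Omega>" by (rule in\<Omega>)
  qed
  have across: "closed_segment (y + t *\<^sub>R e) (z + t *\<^sub>R e) \<subseteq> \<Omega>"
  proof
    fix d assume "d \<in> closed_segment (y + t *\<^sub>R e) (z + t *\<^sub>R e)"
    then obtain s where s: "0 \<le> s" "s \<le> 1" "d = (1 - s) *\<^sub>R (y + t *\<^sub>R e) + s *\<^sub>R (z + t *\<^sub>R e)"
      by (auto simp: in_segment)
    define c where "c = (1 - s) *\<^sub>R y + s *\<^sub>R z"
    have d: "d = c + t *\<^sub>R e" using s(3) by (simp add: c_def algebra_simps)
    have "c \<in> closed_segment y z" using s(1,2) by (auto simp: c_def in_segment)
    moreover have "closed_segment y z \<subseteq> cball x R"
      using R by (intro closed_segment_subset) auto
    ultimately have "dist x c \<le> R" by auto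
    moreover have "dist x d \<le> dist x c + dist c d" by (rule dist_triangle)
    moreover have "dist c d = t" using t0 by (simp add: d dist_norm e)
    ultimately have "d \<in> ball x r" using Rt by simp
    moreover have "h d < d \<bullet> e"
    proof -
      have "c - y = s *\<^sub>R (z - y)" "c - z = (1 - s) *\<^sub>R (y - z)" by (simp_all add: c_def algebra_simps)
      then have n: "L * norm (c - y) = s * t" "L * norm (c - z) = (1 - s) * t"
        using s by (simp_all add: t_def norm_minus_commute)
      have st: "s * t \<le> t" "(1 - s) * t \<le> t" using s t0 by (auto simp: mult_left_le_one_le)
      have "h c = (1 - s) * h c + s * h c" by (simp add: algebra_simps)
      also have "\<dots> \<le> (1 - s) * (h y + t) + s * (h z + t)"
        using hlip[of c y] hlip[of c z] n st s by (intro add_mono mult_left_mono) auto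
      also have "\<dots> < (1 - s) * (y \<bullet> e + t) + s * (z \<bullet> e + t)"
      proof (cases "s = 0")
        case False
        then have "s * (h z + t) < s * (z \<bullet> e + t)" using s hz by simp
        moreover have "(1 - s) * (h y + t) \<le> (1 - s) * (y \<bullet> e + t)"
          using s hy by (intro mult_left_mono) auto
        ultimately show ?thesis by linarith
      qed (use hy in simp)
      also have "\<dots> = d \<bullet> e" by (simp add: d c_def inner_add_left ee algebra_simps)
      finally show ?thesis by (simp add: d h_shift)
    qed
    ultimately show "d \<in> \<Omega>" by (rule in\<Omega>)
  qed
  note seg = C1_segment_bound[of \<Omega> w G K, OF w K]
  have "norm (w (y + t *\<^sub>R e) - w y) \<le> K * t"
    using seg[OF _ _ up[of y]] R hy t0 by (simp add: e)
  moreover have "norm (w (z + t *\<^sub>R e) - w z) \<le> K * t"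
    using seg[OF _ _ up[of z]] R hz t0 by (simp add: e)
  moreover have "norm (w (z + t *\<^sub>R e) - w (y + t *\<^sub>R e)) \<le> K * norm (z - y)"
    using seg[OF _ _ across] by simp
  moreover have "w z - w y = (w (z + t *\<^sub>R e) - w (y + t *\<^sub>R e)) + (w (y + t *\<^sub>R e) - w y) - (w (z + t *\<^sub>R e) - w z)"
    by simp
  ultimately have "norm (w z - w y) \<le> K * norm (z - y) + K * t + K * t"
    by (smt (verit, best) norm_triangle_ineq norm_triangle_ineq4)
  also have "\<dots> = K * (2 * L + 1) * norm (z - y)" by (simp add: t_def algebra_simps)
  finally show ?thesis .
qed

lemma C1_lipschitz_domain_local:
  fixes w :: "real^'n \<Rightarrow> real^'m"
  assumes dom: "lipschitz_domain \<Omega>"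
    and w: "\<And>x. x \<in> \<Omega> \<Longrightarrow> (w has_derivative (*v) (G x)) (at x)"
    and K: "\<And>x. x \<in> \<Omega> \<Longrightarrow> norm (G x) \<le> K" "0 \<le> K" and x: "x \<in> closure \<Omega>"
  shows "\<exists>r C. 0 < r \<and> 0 \<le> C \<and> (\<forall>y\<in>\<Omega> \<inter> ball x r. \<forall>z\<in>\<Omega> \<inter> ball x r. norm (w z - w y) \<le> C * norm (z - y))"
proof (cases "x \<in> \<Omega>")
  case True
  have "open \<Omega>" using dom by (simp add: lipschitz_domain_def)
  then obtain r where r: "r > 0" "ball x r \<subseteq> \<Omega>" using True openE by blast
  have "norm (w z - w y) \<le> K * norm (z - y)" if "y \<in> ball x r" "z \<in> ball x r" for y z
  proof (rule C1_segment_bound[of \<Omega> w G K, OF w K(1)])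
    show "closed_segment y z \<subseteq> \<Omega>" using r that closed_segment_subset[of y "ball x r" z] by auto
  qed
  then show ?thesis using r K by blast
next
  case False
  then have "x \<in> frontier \<Omega>" using x dom by (simp add: frontier_def lipschitz_domain_def interior_open)
  moreover have "\<forall>x\<in>frontier \<Omega>. \<exists>r>0. \<exists>e \<gamma> L. norm e = 1 \<and> L-lipschitz_on {z. z \<bullet> e = 0} \<gamma> \<and>
      \<Omega> \<inter> ball x r = {y \<in> ball x r. \<gamma> (y - (y \<bullet> e) *\<^sub>R e) < y \<bullet> e}"
    using dom unfolding lipschitz_domain_def by (elim conjE)
  ultimately have "\<exists>r>0. \<exists>e \<gamma> L. norm e = 1 \<and> L-lipschitz_on {z. z \<bullet> e = 0} \<gamma> \<and>
      \<Omega> \<inter> ball x r = {y \<in> ball x r. \<gamma> (y - (y \<bullet> e) *\<^sub>R e) < y \<bullet> e}" by (rule bspec[rotated])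
  then obtain r e \<gamma> L where r: "r > 0" "norm e = 1" "L-lipschitz_on {z. z \<bullet> e = 0} \<gamma>"
    "\<Omega> \<inter> ball x r = {y \<in> ball x r. \<gamma> (y - (y \<bullet> e) *\<^sub>R e) < y \<bullet> e}"
    by (elim exE conjE) (rule that)
  have L: "0 \<le> L" using r(3) by (rule lipschitz_on_nonneg)
  define s where "s = r / (2 + 2 * L)"
  have s: "s > 0" using r L by (simp add: s_def)
  have close: "dist x y * (2 + 2 * L) < r" if "y \<in> ball x s" for y
    using that L by (simp add: s_def pos_less_divide_eq)
  have "norm (w z - w y) \<le> K * (2 * L + 1) * norm (z - y)" if "y \<in> \<Omega> \<inter> ball x s" "z \<in> \<Omega> \<inter> ball x s" for y z
    using that close by (intro epigraph_C1_bound[OF w K(1) r(2-4)]) auto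
  moreover have "0 \<le> K * (2 * L + 1)" using K L by simp
  ultimately show ?thesis using s by blast
qed

text \<open>
  By compactness finitely many local estimates suffice for all pairs of points at distance less than some
  \<open>\<delta>\<close>; for the other pairs the boundedness of \<open>w\<close> is enough.
\<close>

lemma C1_lipschitz_domain_lipschitz:
  fixes w :: "real^'n \<Rightarrow> real^'m"
  assumes bdd: "bounded \<Omega>" and dom: "lipschitz_domain \<Omega>" and cw: "continuous_on (closure \<Omega>) w"
    and w: "\<And>x. x \<in> \<Omega> \<Longrightarrow> (w has_derivative (*v) (G x)) (at x)" and cG: "continuous_on (closure \<Omega>) G"
  shows "lipschitz_map \<Omega> w"
proof -
  have cpt: "compact (closure \<Omega>)" using bdd by simp
  obtain K where K: "0 < K" "\<And>x. x \<in> closure \<Omega> \<Longrightarrow> norm (G x) \<le> K"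
    using compact_imp_bounded[OF compact_continuous_image[OF cG cpt]] bounded_pos by (metis imageI)
  obtain B where B: "0 < B" "\<And>x. x \<in> closure \<Omega> \<Longrightarrow> norm (w x) \<le> B"
    using compact_imp_bounded[OF compact_continuous_image[OF cw cpt]] bounded_pos by (metis imageI)
  have "\<forall>x\<in>closure \<Omega>. \<exists>rC. 0 < fst rC \<and> 0 \<le> snd rC \<and>
      (\<forall>y\<in>\<Omega> \<inter> ball x (fst rC). \<forall>z\<in>\<Omega> \<inter> ball x (fst rC). norm (w z - w y) \<le> snd rC * norm (z - y))"
  proof
    fix x assume x: "x \<in> closure \<Omega>"
    have "\<exists>r C. 0 < r \<and> 0 \<le> C \<and> (\<forall>y\<in>\<Omega> \<inter> ball x r. \<forall>z\<in>\<Omega> \<inter> ball x r. norm (w z - w y) \<le> C * norm (z - y))"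
      using K closure_subset by (intro C1_lipschitz_domain_local[OF dom w _ _ x, of K]) auto
    then show "\<exists>rC. 0 < fst rC \<and> 0 \<le> snd rC \<and>
      (\<forall>y\<in>\<Omega> \<inter> ball x (fst rC). \<forall>z\<in>\<Omega> \<inter> ball x (fst rC). norm (w z - w y) \<le> snd rC * norm (z - y))"
      by simp
  qed
  from bchoice[OF this] obtain rC where rC0: "\<forall>x\<in>closure \<Omega>. 0 < fst (rC x) \<and> 0 \<le> snd (rC x) \<and>
      (\<forall>y\<in>\<Omega> \<inter> ball x (fst (rC x)). \<forall>z\<in>\<Omega> \<inter> ball x (fst (rC x)). norm (w z - w y) \<le> snd (rC x) * norm (z - y))" ..
  have rC: "0 < fst (rC x)" "0 \<le> snd (rC x)"
    "\<And>y z. \<lbrakk>y \<in> \<Omega> \<inter> ball x (fst (rC x)); z \<in> \<Omega> \<inter> ball x (fst (rC x))\<rbrakk> \<Longrightarrow> norm (w z - w y) \<le> snd (rC x) * norm (z - y)"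
    if "x \<in> closure \<Omega>" for x
    using bspec[OF rC0 that] by simp_all
  let ?b = "\<lambda>x. ball x (fst (rC x))"
  have cover: "closure \<Omega> \<subseteq> (\<Union>x\<in>closure \<Omega>. ?b x)" using rC(1) by force
  obtain X where X: "X \<subseteq> closure \<Omega>" "finite X" "closure \<Omega> \<subseteq> (\<Union>x\<in>X. ?b x)"
    by (rule compactE_image[OF cpt _ cover]) (simp, rule that)
  obtain \<delta> where \<delta>: "\<delta> > 0" "\<And>y. y \<in> closure \<Omega> \<Longrightarrow> \<exists>B\<in>?b ` X. ball y \<delta> \<subseteq> B"
    using Heine_Borel_lemma[OF cpt X(3)] by auto
  define C where "C = (\<Sum>x\<in>X. snd (rC x))"
  have C: "snd (rC x) \<le> C" "0 \<le> snd (rC x)" if "x \<in> X" for x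
    unfolding C_def using that X rC(2) by (auto intro!: member_le_sum)
  have C0: "0 \<le> C" unfolding C_def using X rC(2) by (auto intro!: sum_nonneg)
  have "(C + 2 * B / \<delta>)-lipschitz_on \<Omega> w"
  proof (rule lipschitz_onI)
    show "0 \<le> C + 2 * B / \<delta>" using C0 B \<delta> by simp
    fix y z assume y: "y \<in> \<Omega>" and z: "z \<in> \<Omega>"
    then have yz: "y \<in> closure \<Omega>" "z \<in> closure \<Omega>" using closure_subset by auto
    have n0: "0 \<le> 2 * B / \<delta> * dist y z" "0 \<le> C * dist y z" using B \<delta> C0 by auto
    show "dist (w y) (w z) \<le> (C + 2 * B / \<delta>) * dist y z"
    proof (cases "dist y z < \<delta>")
      case True
      obtain x where x: "x \<in> X" "ball y \<delta> \<subseteq> ?b x" using \<delta>(2)[OF yz(1)] by blast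
      have "y \<in> ?b x" "z \<in> ?b x" using x(2) \<delta>(1) True by (meson centre_in_ball mem_ball subsetD)+
      then have "norm (w y - w z) \<le> snd (rC x) * norm (y - z)"
        using rC(3)[of x z y] x X(1) y z by auto
      also have "\<dots> \<le> C * norm (y - z)" using C[OF x(1)] by (intro mult_right_mono) auto
      finally show ?thesis using n0 by (simp add: dist_norm distrib_right)
    next
      case False
      have "dist (w y) (w z) \<le> 2 * B"
        using norm_triangle_ineq4[of "w y" "w z"] B(2)[OF yz(1)] B(2)[OF yz(2)] by (simp add: dist_norm)
      also have "\<dots> = 2 * B / \<delta> * \<delta>" using \<delta> by simp
      also have "\<dots> \<le> 2 * B / \<delta> * dist y z" using False B \<delta> by (intro mult_left_mono) auto
      finally show ?thesis using n0 by (simp add: distrib_right)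
    qed
  qed
  then show ?thesis unfolding lipschitz_map_def using lipschitz_on_closure[OF _ cw] by blast
qed

section \<open>Solutions with prescribed boundary values\<close>

lemma AE_lebesgue_on_negligible:
  assumes "S \<in> sets lebesgue"
  shows "(AE x in lebesgue_on S. P x) \<longleftrightarrow> (\<exists>N. negligible N \<and> (\<forall>x\<in>S - N. P x))"
proof -
  have "(AE x in lebesgue_on S. P x) \<longleftrightarrow> (AE x in lebesgue. x \<in> S \<longrightarrow> P x)"
    using assms by (subst AE_restrict_space_iff) auto
  also have "\<dots> \<longleftrightarrow> (\<exists>N. negligible N \<and> (\<forall>x\<in>S - N. P x))"
    unfolding eventually_ae_filter_negligible by blast
  finally show ?thesis .
qed

lemma strain_sym_part: "strain u x = sym_part (jacobian u (at x))"
  by (simp add: strain_def sym_part_def)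

lemma jacobian_eq:
  fixes u :: "real^'n \<Rightarrow> real^'m"
  assumes "(u has_derivative (*v) A) (at x)"
  shows "jacobian u (at x) = A"
  unfolding jacobian_def frechet_derivative_at[OF assms, symmetric] by simp

lemma essinf_greater_AE:
  assumes "essinf M (\<lambda>x. ereal (f x)) > ereal c"
  shows "AE x in M. f x > c"
proof -
  let ?s = "esssup M (\<lambda>x. - ereal (f x))"
  have s: "?s < ereal (- c)"
    using assms unfolding essinf_def by (metis ereal_less_uminus_reorder uminus_ereal.simps(1))
  have "AE x in M. - ereal (f x) \<le> ?s" by (rule esssup_AE)
  then show ?thesis
  proof eventually_elim
    fix x assume "- ereal (f x) \<le> ?s"
    then have "- ereal (f x) < ereal (- c)" using s by (rule order_le_less_trans)
    then show "c < f x" by simp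
  qed
qed

lemma piecewise_affine_locally_C1:
  fixes w :: "real^'n \<Rightarrow> real^'m"
  assumes "piecewise_affine \<Omega> w"
  obtains G where "open G" "G \<subseteq> \<Omega>" "negligible (\<Omega> - G)" "\<And>x. x \<in> G \<Longrightarrow> w differentiable (at x)"
    "\<And>x. x \<in> G \<Longrightarrow> isCont (\<lambda>x. jacobian w (at x)) x"
proof -
  obtain \<D> where D': "\<forall>D\<in>\<D>. lipschitz_domain D \<and> D \<subseteq> \<Omega> \<and> affine_on D w"
    and D2: "negligible (\<Omega> - \<Union>\<D>)"
    using assms unfolding piecewise_affine_def by (elim exE conjE) (rule that)
  note D = bspec[OF D'] D2
  have op: "open D" if "D \<in> \<D>" for D using D(1)[OF that] by (simp add: lipschitz_domain_def)
  have loc: "w differentiable (at x) \<and> isCont (\<lambda>x. jacobian w (at x)) x" if x: "x \<in> \<Union>\<D>" for x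
  proof -
    obtain D where xD: "D \<in> \<D>" "x \<in> D" using x by blast
    obtain h b where h: "linear h" "\<And>y. y \<in> D \<Longrightarrow> w y = h y + b"
      using D(1)[OF xD(1)] unfolding affine_on_def by blast
    have der: "(w has_derivative (*v) (matrix h)) (at y)" if y: "y \<in> D" for y
    proof -
      have "bounded_linear h" using h(1) by (simp add: linear_conv_bounded_linear)
      then have "(h has_derivative h) (at y)" by (rule bounded_linear_imp_has_derivative)
      then have "((\<lambda>y. h y + b) has_derivative h) (at y)" by (rule has_derivative_add_const)
      moreover have "(*v) (matrix h) = h" using h(1) by (simp add: fun_eq_iff)
      ultimately have "((\<lambda>y. h y + b) has_derivative (*v) (matrix h)) (at y)" by simp
      then show ?thesis
        by (rule has_derivative_transform_within_open[OF _ op[OF xD(1)] y]) (simp add: h(2))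
    qed
    have "eventually (\<lambda>y. y \<in> D) (nhds x)" using op[OF xD(1)] xD(2) by (rule eventually_nhds_in_open)
    then have "eventually (\<lambda>y. jacobian w (at y) = matrix h) (nhds x)"
      by eventually_elim (rule jacobian_eq[OF der])
    from isCont_cong[OF this] have "isCont (\<lambda>x. jacobian w (at x)) x" by simp
    moreover have "w differentiable (at x)" using der[OF xD(2)] by (rule differentiableI)
    ultimately show ?thesis by simp
  qed
  show ?thesis
  proof (rule that[of "\<Union>\<D>"])
    show "open (\<Union>\<D>)" using op by blast
    show "\<Union>\<D> \<subseteq> \<Omega>" using D(1) by (simp add: Sup_le_iff)
    show "negligible (\<Omega> - \<Union>\<D>)" by (rule D(2))
  qed (use loc in simp_all)
qed

lemma C1_locally_C1:
  fixes w :: "real^'n \<Rightarrow> real^'m"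
  assumes "open \<Omega>" and w: "\<And>x. x \<in> \<Omega> \<Longrightarrow> (w has_derivative (*v) (G x)) (at x)"
    and G: "continuous_on \<Omega> G" and x: "x \<in> \<Omega>"
  shows "w differentiable (at x)" "isCont (\<lambda>x. jacobian w (at x)) x"
proof -
  show "w differentiable (at x)" using w[OF x] by (rule differentiableI)
  have "eventually (\<lambda>y. y \<in> \<Omega>) (nhds x)" using \<open>open \<Omega>\<close> x by (rule eventually_nhds_in_open)
  then have "eventually (\<lambda>y. jacobian w (at y) = G y) (nhds x)"
    by eventually_elim (rule jacobian_eq[OF w])
  moreover have "isCont G x" using G \<open>open \<Omega>\<close> x by (simp add: continuous_on_eq_continuous_at)
  ultimately show "isCont (\<lambda>x. jacobian w (at x)) x" by (simp add: isCont_cong)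
qed

text \<open>
  Where the gradient is continuous, an equation that holds almost everywhere holds everywhere, since a
  nonempty open set is not null. Positive definiteness is an open condition, so it is enough to discard the
  points where it fails, and these form a null set.
\<close>

lemma initial_stage:
  fixes w :: "real^3 \<Rightarrow> real^3"
  assumes \<Omega>: "open \<Omega>" and G: "open G" "G \<subseteq> \<Omega>" "negligible (\<Omega> - G)"
    and diff: "\<And>x. x \<in> G \<Longrightarrow> w differentiable (at x)"
    and cont: "\<And>x. x \<in> G \<Longrightarrow> isCont (\<lambda>x. jacobian w (at x)) x"
    and N: "negligible N" "\<And>x. x \<in> \<Omega> - N \<Longrightarrow> trace (jacobian w (at x)) = 0 \<and> mu 1 (strain w x) > - 1 / 2"
  shows "\<exists>G'. is_stage \<Omega> 2 (w, \<lambda>x. jacobian w (at x), G')"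
proof -
  let ?J = "\<lambda>x. jacobian w (at x)"
  have near: "eventually (\<lambda>y. y \<in> G \<and> norm (?J y - ?J x) < \<eta>) (nhds x)" if "x \<in> G" "\<eta> > 0" for x \<eta>
  proof -
    have "eventually (\<lambda>y. dist (?J y) (?J x) < \<eta>) (nhds x)"
      using cont[OF that(1)] that(2) unfolding isCont_def tendsto_at_iff_tendsto_nhds[of ?J] by (rule tendstoD)
    moreover have "eventually (\<lambda>y. y \<in> G) (nhds x)" using G(1) that(1) by (rule eventually_nhds_in_open)
    ultimately show ?thesis by eventually_elim (simp add: dist_norm)
  qed
  have cont_on: "continuous_on G ?J" using cont by (simp add: continuous_at_imp_continuous_on)
  have "continuous_on G (\<lambda>x. trace (?J x))"
    unfolding trace_def by (intro continuous_intros cont_on)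
  then have "open (G \<inter> (\<lambda>x. trace (?J x)) -` (- {0}))"
    by (intro continuous_open_preimage G) auto
  moreover have "negligible (G \<inter> (\<lambda>x. trace (?J x)) -` (- {0}))"
    by (rule negligible_subset[OF N(1)]) (use N(2) G(2) in auto)
  ultimately have "G \<inter> (\<lambda>x. trace (?J x)) -` (- {0}) = {}" using open_not_negligible by blast
  then have tr: "trace (?J x) = 0" if "x \<in> G" for x using that by auto
  define G' where "G' = {x \<in> G. ?J x \<in> admissible 2}"
  have "open G'"
    unfolding open_subopen[of G']
  proof
    fix x assume "x \<in> G'"
    then have x: "x \<in> G" "?J x \<in> admissible 2" by (auto simp: G'_def)
    obtain \<eta> where \<eta>: "\<eta> > 0" "\<And>H. \<lbrakk>trace H = 0; norm (H - ?J x) < \<eta>\<rbrakk> \<Longrightarrow> H \<in> admissible 2"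
      by (rule admissible_open[OF x(2)]) (rule that)
    obtain S where "open S" "x \<in> S" "\<forall>y\<in>S. y \<in> G \<and> norm (?J y - ?J x) < \<eta>"
      using near[OF x(1) \<eta>(1)] unfolding eventually_nhds by blast
    moreover then have "S \<subseteq> G'" using \<eta>(2) tr by (auto simp: G'_def)
    ultimately show "\<exists>T. open T \<and> x \<in> T \<and> T \<subseteq> G'" by blast
  qed
  moreover have "negligible (\<Omega> - G')"
  proof (rule negligible_subset[OF negligible_Un[OF G(3) N(1)]])
    show "\<Omega> - G' \<subseteq> \<Omega> - G \<union> N"
    proof
      fix x assume x: "x \<in> \<Omega> - G'"
      show "x \<in> \<Omega> - G \<union> N"
      proof (rule ccontr)
        assume "x \<notin> \<Omega> - G \<union> N"
        then have xG: "x \<in> G" and xN: "x \<in> \<Omega> - N" using x by auto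
        have mu: "mu 1 (sym_part (?J x)) > - 1 / 2" using N(2)[OF xN] by (simp add: strain_sym_part)
        have "?J x \<in> admissible 2"
          by (rule admissible_two[OF tr[OF xG]]) (rule mu_1_pos_def[OF _ tr[OF xG]], use mu in simp_all)
        then show False using xG x by (simp add: G'_def)
      qed
    qed
  qed
  moreover have "(w has_derivative (*v) (?J x)) (at x)" if "x \<in> G" for x
    using diff[OF that] jacobian_works by blast
  ultimately have "is_stage \<Omega> 2 (w, ?J, G')"
    using G(2) cont by (auto simp: is_stage_def G'_def)
  then show ?thesis by blast
qed

theorem theorem3p7:
  fixes \<Omega> :: "(real^3) set" and w :: "real^3 \<Rightarrow> real^3"
  assumes "bounded \<Omega>" and "lipschitz_domain \<Omega>"
    and "(piecewise_affine \<Omega> w \<and> lipschitz_map \<Omega> w) \<or>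
         (\<exists>\<alpha>. 0 < \<alpha> \<and> \<alpha> < 1 \<and> C1_Hoelder \<alpha> \<Omega> w)"
    and "AE x in lebesgue_on \<Omega>. trace (jacobian w (at x)) = 0"
    and "essinf (lebesgue_on \<Omega>) (\<lambda>x. ereal (mu 1 (strain w x))) > ereal (- 1 / 2)"
    and "esssup (lebesgue_on \<Omega>) (\<lambda>x. ereal (mu 3 (strain w x))) < ereal 1"
  shows "\<forall>\<epsilon>>0. \<exists>u :: real^3 \<Rightarrow> real^3. lipschitz_map \<Omega> u \<and> zero_energy \<Omega> u \<and>
           (\<forall>x\<in>frontier \<Omega>. u x = w x) \<and> Linf_norm \<Omega> (\<lambda>x. u x - w x) \<le> ereal \<epsilon>"
proof (intro allI impI)
  fix \<epsilon> :: real assume \<epsilon>: "0 < \<epsilon>"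
  have \<Omega>: "open \<Omega>" using assms(2) by (simp add: lipschitz_domain_def)
  then have \<Omega>m: "\<Omega> \<in> sets lebesgue" by simp
  have "AE x in lebesgue_on \<Omega>. trace (jacobian w (at x)) = 0 \<and> mu 1 (strain w x) > - 1 / 2"
    using assms(4) essinf_greater_AE[OF assms(5)] by eventually_elim simp
  then obtain N where N: "negligible N"
    "\<And>x. x \<in> \<Omega> - N \<Longrightarrow> trace (jacobian w (at x)) = 0 \<and> mu 1 (strain w x) > - 1 / 2"
    unfolding AE_lebesgue_on_negligible[OF \<Omega>m] by blast
  have "lipschitz_map \<Omega> w \<and> (\<exists>G. is_stage \<Omega> 2 (w, \<lambda>x. jacobian w (at x), G))"
    using assms(3)
  proof
    assume pa: "piecewise_affine \<Omega> w \<and> lipschitz_map \<Omega> w"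
    obtain G where "open G" "G \<subseteq> \<Omega>" "negligible (\<Omega> - G)" "\<And>x. x \<in> G \<Longrightarrow> w differentiable (at x)"
      "\<And>x. x \<in> G \<Longrightarrow> isCont (\<lambda>x. jacobian w (at x)) x"
      by (rule piecewise_affine_locally_C1[OF conjunct1[OF pa]]) (rule that)
    then have "\<exists>G. is_stage \<Omega> 2 (w, \<lambda>x. jacobian w (at x), G)"
      by (rule initial_stage[OF \<Omega> _ _ _ _ _ N])
    with pa show ?thesis by simp
  next
    assume "\<exists>\<alpha>. 0 < \<alpha> \<and> \<alpha> < 1 \<and> C1_Hoelder \<alpha> \<Omega> w"
    then obtain G where cw: "continuous_on (closure \<Omega>) w"
      and w: "\<And>x. x \<in> \<Omega> \<Longrightarrow> (w has_derivative (*v) (G x)) (at x)" and cG: "continuous_on (closure \<Omega>) G"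
      unfolding C1_Hoelder_def by blast
    have "lipschitz_map \<Omega> w"
      by (rule C1_lipschitz_domain_lipschitz[OF assms(1,2) cw w cG])
    moreover have "continuous_on \<Omega> G" using cG closure_subset by (rule continuous_on_subset)
    note C1 = C1_locally_C1[OF \<Omega> w this]
    have "\<exists>G. is_stage \<Omega> 2 (w, \<lambda>x. jacobian w (at x), G)"
    proof (rule initial_stage[OF \<Omega> \<Omega> order_refl _ _ _ N])
      show "negligible (\<Omega> - \<Omega>)" by simp
      show "w differentiable (at x)" "isCont (\<lambda>x. jacobian w (at x)) x" if "x \<in> \<Omega>" for x
        using C1 that by simp_all
    qed
    ultimately show ?thesis by simp
  qed
  then obtain G L where stage: "is_stage \<Omega> 2 (w, \<lambda>x. jacobian w (at x), G)"
    and L: "L-lipschitz_on (closure \<Omega>) w"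
    unfolding lipschitz_map_def by blast
  obtain v L' N' where v: "L'-lipschitz_on UNIV v" "\<And>x. x \<notin> \<Omega> \<Longrightarrow> v x = 0" "\<And>x. norm (v x) \<le> \<epsilon>"
    and N': "negligible N'" "\<And>x. x \<in> \<Omega> - N' \<Longrightarrow>
      \<exists>A. ((\<lambda>y. w y + v y) has_derivative (*v) A) (at x) \<and> trace A = 0 \<and> V_energy (sym_part A) = 0"
    by (rule exact_solution_near_stage[OF stage \<epsilon>]) (rule that)
  define u where "u = (\<lambda>x. w x + v x)"
  show "\<exists>u. lipschitz_map \<Omega> u \<and> zero_energy \<Omega> u \<and>
           (\<forall>x\<in>frontier \<Omega>. u x = w x) \<and> Linf_norm \<Omega> (\<lambda>x. u x - w x) \<le> ereal \<epsilon>"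
  proof (intro exI[of _ u] conjI ballI)
    have "(L + L')-lipschitz_on (closure \<Omega>) u"
      unfolding u_def using L lipschitz_on_subset[OF v(1)] by (intro lipschitz_on_add) auto
    then show "lipschitz_map \<Omega> u" unfolding lipschitz_map_def by blast
    have good: "u differentiable (at x) \<and> trace (jacobian u (at x)) = 0 \<and> V_energy (strain u x) = 0"
      if x: "x \<in> \<Omega> - N'" for x
    proof -
      obtain A where A: "(u has_derivative (*v) A) (at x)" "trace A = 0" "V_energy (sym_part A) = 0"
        using N'(2)[OF x] unfolding u_def by blast
      then show ?thesis
        using jacobian_eq[OF A(1)] differentiableI[OF A(1)] by (simp add: strain_sym_part)
    qed
    then show "zero_energy \<Omega> u"
      unfolding zero_energy_def AE_lebesgue_on_negligible[OF \<Omega>m] using N'(1) by blast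
    show "u x = w x" if "x \<in> frontier \<Omega>" for x
    proof -
      have "x \<notin> \<Omega>" using that \<Omega> by (simp add: frontier_def interior_open)
      then show ?thesis using v(2) by (simp add: u_def)
    qed
    have "continuous_on \<Omega> v"
      by (rule continuous_on_subset[OF lipschitz_on_continuous_on[OF v(1)]]) simp
    then have "v \<in> borel_measurable (lebesgue_on \<Omega>)"
      using \<Omega>m by (rule continuous_imp_measurable_on_sets_lebesgue)
    then have "(\<lambda>x. ereal (norm (u x - w x))) \<in> borel_measurable (lebesgue_on \<Omega>)"
      by (simp add: u_def)
    then show "Linf_norm \<Omega> (\<lambda>x. u x - w x) \<le> ereal \<epsilon>"
      unfolding Linf_norm_def by (rule esssup_I) (simp add: u_def v(3))
  qed
qed

end
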